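(* Let $x$ and $t$ be integers with $t \geq 1$, $x \geq 2$, and $x$ not a multiple of $6$. Put $v = 6xt$, $N = 2x$ and $\beta = 3xt - 2$. Then a solution to $\mathrm{HWP}(v;6,N;1,\beta)$ exists if and only if $6 \mid v$ and $N \mid v$, except possibly when $\gcd(6,N) = 1$, or when $\gcd(6,N) = 2$ and $x = 3$.
   Context: For integers $M,N \geq 3$ and $v$, a solution to the uniform Hamilton–Waterloo problem $\mathrm{HWP}(v;M,N;\alpha,\beta)$ is a decomposition of the edge set of $K_v$ (if $v$ is odd) or of $K_v - F$ for some 1-factor (perfect matching) $F$ of $K_v$ (if $v$ is even) into $\alpha$ $C_M$-factors and $\beta$ $C_N$-factors. Here a $C_M$-factor is a spanning subgraph all of whose connected components are cycles of length $M$. *)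

theory Defs
  imports Main "HOL-Library.Disjoint_Sets"
begin

text \<open>A simple graph is given by a vertex set \<open>V\<close> and a set \<open>E\<close> of two-element subsets of \<open>V\<close>.\<close>

definition complete_graph_edges :: "'a set \<Rightarrow> 'a set set" where
  "complete_graph_edges V = {e. e \<subseteq> V \<and> card e = 2}"

definition adjacency :: "'a set set \<Rightarrow> ('a \<times> 'a) set" where
  "adjacency E = {(a, b). {a, b} \<in> E}"

definition component_of :: "'a set \<Rightarrow> 'a set set \<Rightarrow> 'a \<Rightarrow> 'a set" where
  "component_of V E u = {w \<in> V. (u, w) \<in> (adjacency E)\<^sup>*}"

definition graph_components :: "'a set \<Rightarrow> 'a set set \<Rightarrow> 'a set set" where
  "graph_components V E = component_of V E ` V"

definition is_cycle_graph :: "nat \<Rightarrow> 'a set \<Rightarrow> 'a set set \<Rightarrow> bool" where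
  "is_cycle_graph m V E \<longleftrightarrow> m \<ge> 3 \<and>
     (\<exists>f. bij_betw f {..<m} V \<and> E = (\<lambda>i. {f i, f (Suc i mod m)}) ` {..<m})"

text \<open>The spanning subgraph with edge set \<open>H\<close> is a factor of the complete graph on \<open>V\<close>; the
  component on the vertex set \<open>C\<close> consists of those edges of \<open>H\<close> that lie inside \<open>C\<close>.\<close>

definition is_cycle_factor :: "nat \<Rightarrow> 'a set \<Rightarrow> 'a set set \<Rightarrow> bool" where
  "is_cycle_factor m V H \<longleftrightarrow> H \<subseteq> complete_graph_edges V \<and>
     (\<forall>C \<in> graph_components V H. is_cycle_graph m C {e \<in> H. e \<subseteq> C})"

definition is_one_factor :: "'a set \<Rightarrow> 'a set set \<Rightarrow> bool" where
  "is_one_factor V F \<longleftrightarrow> F \<subseteq> complete_graph_edges V \<and> (\<forall>u \<in> V. \<exists>!e. e \<in> F \<and> u \<in> e)"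

text \<open>The factors are indexed by \<open>{..<\<alpha> + \<beta>}\<close>: the first \<open>\<alpha>\<close> are \<open>C\<^sub>M\<close>-factors and
  the remaining \<open>\<beta>\<close> are \<open>C\<^sub>N\<close>-factors.\<close>

definition decomposes_into_cycle_factors ::
    "'a set \<Rightarrow> 'a set set \<Rightarrow> nat \<Rightarrow> nat \<Rightarrow> nat \<Rightarrow> nat \<Rightarrow> (nat \<Rightarrow> 'a set set) \<Rightarrow> bool" where
  "decomposes_into_cycle_factors V E M N \<alpha> \<beta> H \<longleftrightarrow>
     disjoint_family_on H {..<\<alpha> + \<beta>} \<and>
     (\<Union>i<\<alpha> + \<beta>. H i) = E \<and>
     (\<forall>i<\<alpha>. is_cycle_factor M V (H i)) \<and>
     (\<forall>i\<in>{\<alpha>..<\<alpha> + \<beta>}. is_cycle_factor N V (H i))"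

definition HWP_solution_exists :: "nat \<Rightarrow> nat \<Rightarrow> nat \<Rightarrow> nat \<Rightarrow> nat \<Rightarrow> bool" where
  "HWP_solution_exists v M N \<alpha> \<beta> \<longleftrightarrow>
     (let V = {..<v}; K = complete_graph_edges V in
      if odd v then \<exists>H. decomposes_into_cycle_factors V K M N \<alpha> \<beta> H
      else \<exists>F H. is_one_factor V F \<and> decomposes_into_cycle_factors V (K - F) M N \<alpha> \<beta> H)"

end

theory Submission
  imports Defs
begin

text \<open>Since the factors of a solution have together exactly as many edges as the complete graph, it
  suffices to find factors whose union covers all pairs of vertices.

  For even \<open>x\<close> the vertices are arranged in \<open>6 t\<close> groups, each a copy of the integers modulo \<open>x\<close>. Two
  classes of edges between two groups whose differences are consecutive form a \<open>2 x\<close>-cycle, so almost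
  everything splits along a 1-factorization of the graph of groups. The 6-cycles, the 1-factor and
  Walecki's cycles leave an odd number of classes on some pairs of groups; these are absorbed by closed
  walks through four groups.

  For odd \<open>x\<close> the complete graph on \<open>x t\<close> vertices is blown up by \<open>6\<close>. Its cycles whose length is a
  multiple of \<open>x\<close> are handled by Haggkvist's doubling lemma, and two exceptional pieces (a cycle of length
  \<open>x\<close> together with the copies of \<open>K\<^sub>6\<close>, and the complete bipartite graph for even \<open>t\<close>) are
  decomposed column by column, using three explicit columns that are repeated in the pattern
  \<open>0, 1, 2, 1, 2, \<dots>\<close>.\<close>

section \<open>Covering by cycle factors\<close>

text \<open>The count behind the reduction to covers is v/2 + (\<beta> + 1) v = v (v - 1) / 2 for v
  = 2 (\<beta> + 2): the prescribed number of factors leaves no room for overlaps. Hence each piece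
  only has to exhibit enough edges; disjointness and the absence of further edges need not be
  tracked. Parity dictates the rest. Between two groups of x vertices there are x differences, and
  2x-cycles consume them two at a time. For even x only the objects that use up a single class cause
  trouble. For odd x one difference is always left over, so cycles whose length is a multiple of x
  are used as carriers instead: doubling turns them into 2x-cycles. Where only a matching of copies
  is available, the three differences 0, 1 and -1 are taken together. The computed pieces must serve
  every odd x with finitely many checks. With the columns numbered from 0, the last one has an even
  number, so the only transitions that occur are 0 to 1, 1 to 2, 2 to 1 and, closing the ring, 2 to
  0.\<close>

definition cycle_edges :: "nat \<Rightarrow> (nat \<Rightarrow> 'a) \<Rightarrow> 'a set set" where
  "cycle_edges n f = (\<lambda>k. {f k, f (Suc k mod n)}) ` {..<n}"

text \<open>A cycle of length \<open>2\<close> is a single edge here, so that \<open>cycle_factor 2\<close> describes perfect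
  matchings.\<close>

inductive cycle_factor :: "nat \<Rightarrow> 'a set \<Rightarrow> 'a set set \<Rightarrow> bool" for n where
  cycle_factor_empty: "cycle_factor n {} {}"
| cycle_factor_add: "cycle_factor n V H \<Longrightarrow> inj_on f {..<n} \<Longrightarrow> f ` {..<n} \<inter> V = {} \<Longrightarrow>
    cycle_factor n (f ` {..<n} \<union> V) (cycle_edges n f \<union> H)"

lemma cycle_factor_Un:
  assumes "cycle_factor n V H" "cycle_factor n W K" "V \<inter> W = {}"
  shows "cycle_factor n (V \<union> W) (H \<union> K)"
  using assms
proof (induction rule: cycle_factor.induct)
  case (cycle_factor_add V H f)
  have "cycle_factor n (f ` {..<n} \<union> (V \<union> W)) (cycle_edges n f \<union> (H \<union> K))"
    using cycle_factor_add by (intro cycle_factor.cycle_factor_add) auto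
  then show ?case by (simp add: Un_assoc)
qed simp

lemma cycle_edges_comp: "cycle_edges n (g \<circ> f) = (`) g ` cycle_edges n f"
  unfolding cycle_edges_def by (simp add: image_image)

lemma cycle_factor_image:
  assumes "cycle_factor n V H" "inj_on g V"
  shows "cycle_factor n (g ` V) ((`) g ` H)"
  using assms
proof (induction rule: cycle_factor.induct)
  case (cycle_factor_add V H f)
  have "cycle_factor n ((g \<circ> f) ` {..<n} \<union> g ` V) (cycle_edges n (g \<circ> f) \<union> (`) g ` H)"
  proof (rule cycle_factor.cycle_factor_add)
    show "cycle_factor n (g ` V) ((`) g ` H)" using cycle_factor_add by (auto intro: inj_on_subset)
    show "inj_on (g \<circ> f) {..<n}"
      using cycle_factor_add.hyps(2) cycle_factor_add.prems by (intro comp_inj_on) (auto intro: inj_on_subset)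
    show "(g \<circ> f) ` {..<n} \<inter> g ` V = {}"
      using cycle_factor_add.hyps(3) inj_on_image_Int[OF cycle_factor_add.prems, of "f ` {..<n}" V]
      by (simp add: image_comp)
  qed
  then show ?case by (simp add: cycle_edges_comp image_Un image_comp)
qed (simp add: cycle_factor_empty)

lemma cycle_factor_family:
  assumes "finite J" "inj_on (\<lambda>(j, k). \<phi> j k) (J \<times> {..<n})"
  shows "cycle_factor n ((\<lambda>(j, k). \<phi> j k) ` (J \<times> {..<n})) (\<Union>j\<in>J. cycle_edges n (\<phi> j))"
  using assms
proof (induction J)
  case (insert j J)
  have "cycle_factor n (\<phi> j ` {..<n} \<union> (\<lambda>(j, k). \<phi> j k) ` (J \<times> {..<n}))
          (cycle_edges n (\<phi> j) \<union> (\<Union>j\<in>J. cycle_edges n (\<phi> j)))"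
  proof (rule cycle_factor_add)
    show "cycle_factor n ((\<lambda>(j, k). \<phi> j k) ` (J \<times> {..<n})) (\<Union>j\<in>J. cycle_edges n (\<phi> j))"
      by (rule insert.IH, rule inj_on_subset[OF insert.prems]) auto
    show "inj_on (\<phi> j) {..<n}"
      using insert.prems by (auto simp: inj_on_def)
    show "\<phi> j ` {..<n} \<inter> (\<lambda>(j, k). \<phi> j k) ` (J \<times> {..<n}) = {}"
    proof (intro equals0I, elim IntE imageE)
      fix x k p assume "k \<in> {..<n}" "x = \<phi> j k" "p \<in> J \<times> {..<n}" "x = (case p of (j, k) \<Rightarrow> \<phi> j k)"
      then have "(j, k) = p" by (intro inj_onD[OF insert.prems]) auto
      then show False using insert.hyps(2) \<open>p \<in> _\<close> by auto
    qed
  qed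
  moreover have "\<phi> j ` {..<n} \<union> (\<lambda>(j, k). \<phi> j k) ` (J \<times> {..<n})
      = (\<lambda>(j, k). \<phi> j k) ` (insert j J \<times> {..<n})" by auto
  ultimately show ?case by simp
qed (simp add: cycle_factor_empty)

text \<open>The factors may contain more than \<open>E\<close>, so pieces can be shrunk and glued
  freely. Edges are given as ordered pairs, in one orientation only where convenient;
  \<open>covers_sym\<close> supplies the other. The list of lengths records how many factors of each
  kind have been spent.\<close>

definition covers :: "nat list \<Rightarrow> 'a set \<Rightarrow> ('a \<times> 'a) set \<Rightarrow> bool" where
  "covers ns V E \<longleftrightarrow> (\<exists>Hs. list_all2 (\<lambda>n. cycle_factor n V) ns Hs \<and> (\<forall>u w. (u, w) \<in> E \<longrightarrow> (\<exists>H\<in>set Hs. {u, w} \<in> H)))"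

lemma covers_mono: "covers ns V E \<Longrightarrow> E' \<subseteq> E \<Longrightarrow> covers ns V E'"
  unfolding covers_def by blast

lemma covers_sym: "covers ns V E \<Longrightarrow> covers ns V (E \<union> E\<inverse>)"
proof -
  assume "covers ns V E"
  then obtain Hs where "list_all2 (\<lambda>n. cycle_factor n V) ns Hs"
    "\<forall>u w. (u, w) \<in> E \<longrightarrow> (\<exists>H\<in>set Hs. {u, w} \<in> H)" unfolding covers_def by blast
  then show ?thesis
    unfolding covers_def by (intro exI[of _ Hs]) (simp, metis insert_commute)
qed

lemma covers_Nil: "covers [] V {}"
  unfolding covers_def by auto

lemma covers_append: "covers ns V E \<Longrightarrow> covers ms V E' \<Longrightarrow> covers (ns @ ms) V (E \<union> E')"
  unfolding covers_def
proof (elim exE conjE)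
  fix Hs Ks
  assume "list_all2 (\<lambda>n. cycle_factor n V) ns Hs" "list_all2 (\<lambda>n. cycle_factor n V) ms Ks"
    "\<forall>u w. (u, w) \<in> E \<longrightarrow> (\<exists>H\<in>set Hs. {u, w} \<in> H)" "\<forall>u w. (u, w) \<in> E' \<longrightarrow> (\<exists>H\<in>set Ks. {u, w} \<in> H)"
  then show "\<exists>Hs. list_all2 (\<lambda>n. cycle_factor n V) (ns @ ms) Hs \<and>
      (\<forall>u w. (u, w) \<in> E \<union> E' \<longrightarrow> (\<exists>H\<in>set Hs. {u, w} \<in> H))"
    by (intro exI[of _ "Hs @ Ks"]) (simp add: list_all2_appendI bex_Un; blast)
qed

text \<open>Serves to single out one factor that is to receive special treatment; the two parts are
  whatever the respective factors happen to cover.\<close>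

lemma covers_split:
  assumes "covers (ns @ ms) V E"
  obtains E1 E2 where "covers ns V E1" "covers ms V E2" "E \<subseteq> E1 \<union> E2"
proof -
  from assms obtain Hs where H: "list_all2 (\<lambda>n. cycle_factor n V) (ns @ ms) Hs"
    "\<forall>u w. (u, w) \<in> E \<longrightarrow> (\<exists>H\<in>set Hs. {u, w} \<in> H)" unfolding covers_def by blast
  then obtain Hs1 Hs2 where Hs: "Hs = Hs1 @ Hs2" "list_all2 (\<lambda>n. cycle_factor n V) ns Hs1"
    "list_all2 (\<lambda>n. cycle_factor n V) ms Hs2" by (auto simp: list_all2_append1)
  show thesis
  proof (rule that)
    show "covers ns V {(u, w). \<exists>H\<in>set Hs1. {u, w} \<in> H}" using Hs unfolding covers_def by auto
    show "covers ms V {(u, w). \<exists>H\<in>set Hs2. {u, w} \<in> H}" using Hs unfolding covers_def by auto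
  qed (use H(2) Hs(1) in fastforce)
qed

lemma covers_concat:
  assumes "\<And>i. i < k \<Longrightarrow> covers ns V (E i)"
  shows "covers (concat (replicate k ns)) V (\<Union>i<k. E i)"
  using assms
proof (induction k)
  case (Suc k)
  have "covers (ns @ concat (replicate k ns)) V (E k \<union> (\<Union>i<k. E i))"
    using Suc by (intro covers_append) auto
  then show ?case by (simp add: lessThan_Suc)
qed (simp add: covers_Nil)

lemma concat_replicate2: "concat (replicate k (replicate l x)) = replicate (k * l) x"
  by (induction k) (auto simp: replicate_add)

lemma covers_replicate:
  assumes "\<And>i. i < k \<Longrightarrow> covers (replicate l n) V (E i)"
  shows "covers (replicate (k * l) n) V (\<Union>i<k. E i)"
  using covers_concat[OF assms, of k] by (simp add: concat_replicate2)

lemma covers_image: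
  assumes "covers ns V E" "inj_on g V"
  shows "covers ns (g ` V) (map_prod g g ` E)"
proof -
  from assms(1) obtain Hs where H: "list_all2 (\<lambda>n. cycle_factor n V) ns Hs"
    "\<forall>u w. (u, w) \<in> E \<longrightarrow> (\<exists>H\<in>set Hs. {u, w} \<in> H)" unfolding covers_def by blast
  have "list_all2 (\<lambda>n. cycle_factor n (g ` V)) ns (map (\<lambda>H. (`) g ` H) Hs)"
    using H(1) assms(2) by (auto simp: list_all2_conv_all_nth intro: cycle_factor_image)
  moreover have "\<forall>u w. (u, w) \<in> map_prod g g ` E \<longrightarrow> (\<exists>H\<in>set (map (\<lambda>H. (`) g ` H) Hs). {u, w} \<in> H)"
  proof clarify
    fix a b assume "(a, b) \<in> E"
    then obtain K where "K \<in> set Hs" "{a, b} \<in> K" using H(2) by blast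
    then show "\<exists>H\<in>set (map (\<lambda>H. (`) g ` H) Hs). {g a, g b} \<in> H"
      by (intro bexI[of _ "(`) g ` K"]) (auto intro: rev_image_eqI)
  qed
  ultimately show ?thesis unfolding covers_def by blast
qed

text \<open>Both sides spend the same list of lengths, so factors at equal positions can be
  united.\<close>

lemma covers_Un:
  assumes "covers ns V E" "covers ns W D" "V \<inter> W = {}"
  shows "covers ns (V \<union> W) (E \<union> D)"
proof -
  from assms(1) obtain Hs where H: "list_all2 (\<lambda>n. cycle_factor n V) ns Hs"
    "\<forall>u w. (u, w) \<in> E \<longrightarrow> (\<exists>H\<in>set Hs. {u, w} \<in> H)" unfolding covers_def by blast
  from assms(2) obtain Ks where K: "list_all2 (\<lambda>n. cycle_factor n W) ns Ks"
    "\<forall>u w. (u, w) \<in> D \<longrightarrow> (\<exists>H\<in>set Ks. {u, w} \<in> H)" unfolding covers_def by blast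
  let ?L = "map2 (\<union>) Hs Ks"
  have len: "length Hs = length ns" "length Ks = length ns"
    using list_all2_lengthD[OF H(1)] list_all2_lengthD[OF K(1)] by simp_all
  have fac: "list_all2 (\<lambda>n. cycle_factor n (V \<union> W)) ns ?L"
    unfolding list_all2_conv_all_nth
  proof (intro conjI allI impI)
    fix i assume "i < length ns"
    then show "cycle_factor (ns ! i) (V \<union> W) (?L ! i)"
      using cycle_factor_Un[OF list_all2_nthD[OF H(1)] list_all2_nthD[OF K(1)] assms(3)] len by simp
  qed (simp add: len)
  have nth: "Hs ! i \<union> Ks ! i \<in> set ?L" if "i < length ns" for i
  proof -
    have "?L ! i \<in> set ?L" using that len by (intro nth_mem) simp
    then show ?thesis using that len by simp
  qed
  have cov: "\<exists>H\<in>set ?L. {u, w} \<in> H" if "(u, w) \<in> E \<union> D" for u w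
  proof -
    have "(\<exists>H\<in>set Hs. {u, w} \<in> H) \<or> (\<exists>H\<in>set Ks. {u, w} \<in> H)"
      using that H(2) K(2) by blast
    then have "\<exists>i<length ns. {u, w} \<in> Hs ! i \<union> Ks ! i"
      using len by (metis Un_iff in_set_conv_nth)
    then show ?thesis using nth by blast
  qed
  show ?thesis unfolding covers_def
  proof (intro exI conjI)
    show "\<forall>u w. (u, w) \<in> E \<union> D \<longrightarrow> (\<exists>H\<in>set ?L. {u, w} \<in> H)"
      using cov by blast
  qed (rule fac)
qed

lemma covers_empty: "covers ns {} {}"
  unfolding covers_def
  by (rule exI[of _ "replicate (length ns) {}"]) (auto simp: list_all2_conv_all_nth cycle_factor_empty)

text \<open>The lexicographic product of the m-cycle with an edgeless graph on \<open>Y\<close>,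
  oriented along the cycle. Below, \<open>blow\<close> is the same product for an arbitrary base
  graph, and \<open>inner\<close> places a graph inside every fibre.\<close>

definition ring_blow :: "nat \<Rightarrow> 'b set \<Rightarrow> ((nat \<times> 'b) \<times> (nat \<times> 'b)) set" where
  "ring_blow m Y = {((k, a), (Suc k mod m, b)) | k a b. k < m \<and> a \<in> Y \<and> b \<in> Y}"

definition blow :: "('a \<times> 'a) set \<Rightarrow> 'b set \<Rightarrow> (('a \<times> 'b) \<times> ('a \<times> 'b)) set" where
  "blow E Y = {((u, a), (w, b)) | u a w b. (u, w) \<in> E \<and> a \<in> Y \<and> b \<in> Y}"

definition inner :: "'a set \<Rightarrow> ('b \<times> 'b) set \<Rightarrow> (('a \<times> 'b) \<times> ('a \<times> 'b)) set" where
  "inner W D = {((u, a), (u, b)) | u a b. u \<in> W \<and> (a, b) \<in> D}"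

lemma covers_copies:
  assumes "finite W" "covers ns Y D"
  shows "covers ns (W \<times> Y) (inner W D)"
  using assms(1)
proof induction
  case empty
  then show ?case by (simp add: covers_empty inner_def)
next
  case (insert w W)
  have "covers ns (Pair w ` Y) (map_prod (Pair w) (Pair w) ` D)"
    by (rule covers_image[OF assms(2)]) (auto simp: inj_on_def)
  moreover have "Pair w ` Y \<inter> W \<times> Y = {}" using insert.hyps by auto
  ultimately have "covers ns (Pair w ` Y \<union> W \<times> Y) (map_prod (Pair w) (Pair w) ` D \<union> inner W D)"
    by (intro covers_Un insert.IH)
  moreover have "Pair w ` Y \<union> W \<times> Y = insert w W \<times> Y" by auto
  moreover have "inner (insert w W) D \<subseteq> map_prod (Pair w) (Pair w) ` D \<union> inner W D"
    unfolding inner_def by (force simp: image_iff)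
  ultimately show ?case by (auto intro: covers_mono)
qed

text \<open>Each cycle of the m-factor receives its own copy of the given cover, and disjoint copies
  are united. The graph \<open>D\<close> inside the fibres is carried along because the exceptional
  1-factor and 6-cycles have to be found together with it.\<close>

lemma covers_subst:
  assumes "cycle_factor m W H" "covers ns ({..<m} \<times> Y) (ring_blow m Y \<union> inner {..<m} D)"
  shows "covers ns (W \<times> Y) (blow {(u, w). {u, w} \<in> H} Y \<union> inner W D)"
  using assms(1)
proof induction
  case cycle_factor_empty
  then show ?case by (simp add: blow_def inner_def covers_empty)
next
  case (cycle_factor_add V H f)
  let ?g = "map_prod f id :: nat \<times> 'b \<Rightarrow> _" let ?B = "ring_blow m Y \<union> inner {..<m} D"
  have "covers ns (?g ` ({..<m} \<times> Y)) (map_prod ?g ?g ` ?B)"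
    by (rule covers_image[OF assms(2)]) (use cycle_factor_add.hyps(2) in \<open>auto simp: inj_on_def\<close>)
  note covers_sym[OF this]
  moreover have "?g ` ({..<m} \<times> Y) \<inter> V \<times> Y = {}" using cycle_factor_add.hyps(3) by auto
  ultimately have fcU: "covers ns (?g ` ({..<m} \<times> Y) \<union> V \<times> Y) (map_prod ?g ?g ` ?B \<union>
     (map_prod ?g ?g ` ?B)\<inverse> \<union> (blow {(u, w). {u, w} \<in> H} Y \<union> inner V D))"
    by (intro covers_Un cycle_factor_add.IH)
  have eq: "?g ` ({..<m} \<times> Y) \<union> V \<times> Y = (f ` {..<m} \<union> V) \<times> Y" by force
  have img: "((f k, a), (f l, b)) \<in> map_prod ?g ?g ` ?B" if "((k, a), (l, b)) \<in> ?B" for k a l b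
    using imageI[OF that, of "map_prod ?g ?g"] by simp
  \<comment> \<open>An edge of the cycle may be met against its orientation; then the fibre
    coordinates are exchanged and the converse pair is used.\<close>
  have cross: "((u, a), (w, b)) \<in> map_prod ?g ?g ` ?B \<union> (map_prod ?g ?g ` ?B)\<inverse>"
    if "{u, w} \<in> cycle_edges m f" "a \<in> Y" "b \<in> Y" for u w a b
  proof -
    from that(1) obtain k where k: "k < m" "{u, w} = {f k, f (Suc k mod m)}"
      unfolding cycle_edges_def by auto
    have "((k, a), (Suc k mod m, b)) \<in> ?B" "((k, b), (Suc k mod m, a)) \<in> ?B"
      using k that unfolding ring_blow_def by auto
    from img[OF this(1)] img[OF this(2)] k(2) show ?thesis
      by (simp only: doubleton_eq_iff Un_iff converse_iff) metis
  qed
  have inn: "((u, a), (u, b)) \<in> map_prod ?g ?g ` ?B" if "u \<in> f ` {..<m}" "(a, b) \<in> D" for u a b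
  proof -
    from that obtain k where "k < m" "u = f k" by auto
    then show ?thesis using that img[of k a k b] unfolding inner_def by auto
  qed
  have sub: "blow {(u, w). {u, w} \<in> cycle_edges m f \<union> H} Y \<union> inner (f ` {..<m} \<union> V) D
    \<subseteq> map_prod ?g ?g ` ?B \<union> (map_prod ?g ?g ` ?B)\<inverse> \<union>
      (blow {(u, w). {u, w} \<in> H} Y \<union> inner V D)" (is "?L \<subseteq> ?R")
  proof
    fix e assume "e \<in> ?L"
    then consider u w a b where "e = ((u, a), (w, b))" "{u, w} \<in> cycle_edges m f" "a \<in> Y" "b \<in> Y"
      | "e \<in> blow {(u, w). {u, w} \<in> H} Y" | "e \<in> inner V D"
      | u a b where "e = ((u, a), (u, b))" "u \<in> f ` {..<m}" "(a, b) \<in> D"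
      unfolding blow_def inner_def by blast
    then show "e \<in> ?R" by cases (use cross inn in auto)
  qed
  show ?case using covers_mono[OF _ sub] fcU eq by simp
qed

text \<open>The basic recursion: each of the k base factors turns into l factors of the
  product.\<close>

lemma covers_blow:
  assumes "covers (replicate k m) W E" "covers (replicate l n) ({..<m} \<times> Y) (ring_blow m Y)"
  shows "covers (replicate (k * l) n) (W \<times> Y) (blow E Y)"
proof -
  from assms(1) obtain Hs where H: "list_all2 (\<lambda>n. cycle_factor n W) (replicate k m) Hs"
    "\<forall>u w. (u, w) \<in> E \<longrightarrow> (\<exists>H\<in>set Hs. {u, w} \<in> H)" unfolding covers_def by blast
  have *: "covers (replicate l n) (W \<times> Y) (blow {(u, w). {u, w} \<in> Hs ! i} Y)" if "i < k" for i
  proof -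
    have "cycle_factor m W (Hs ! i)" using H(1) that by (auto simp: list_all2_conv_all_nth)
    from covers_subst[OF this, of _ Y "{}"] assms(2) show ?thesis by (simp add: inner_def)
  qed
  have "length Hs = k" using H(1) by (auto dest: list_all2_lengthD)
  then have sub: "blow E Y \<subseteq> (\<Union>i<k. blow {(u, w). {u, w} \<in> Hs ! i} Y)"
    using H(2) by (fastforce simp: blow_def in_set_conv_nth)
  from covers_replicate[OF *] show ?thesis using sub by (rule covers_mono)
qed

text \<open>A map onto a finite set as large as its domain is injective. So for a factor given by a
  formula it suffices to hit every vertex; that the cycles are genuine and disjoint follows by
  counting.\<close>

lemma covers_singleI_edge:
  assumes "finite J" "finite V" "card J * n = card V"
    and surj: "\<And>v. v \<in> V \<Longrightarrow> \<exists>j\<in>J. \<exists>k<n. \<phi> j k = v"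
    and cov: "\<And>u w. (u, w) \<in> E \<Longrightarrow> \<exists>j\<in>J. \<exists>k<n. {u, w} = {\<phi> j k, \<phi> j (Suc k mod n)}"
  shows "covers [n] V E"
proof -
  let ?f = "\<lambda>(j, k). \<phi> j k"
  have sub: "V \<subseteq> ?f ` (J \<times> {..<n})" using surj by force
  have "card (?f ` (J \<times> {..<n})) \<le> card V"
    using card_image_le[of "J \<times> {..<n}" ?f] assms(1,3) by (simp add: card_cartesian_product)
  then have eq: "?f ` (J \<times> {..<n}) = V" using card_seteq[OF _ sub] assms(1) by auto
  then have "inj_on ?f (J \<times> {..<n})"
    using assms(1,3) by (intro eq_card_imp_inj_on) (auto simp: card_cartesian_product)
  from cycle_factor_family[OF assms(1) this] have "cycle_factor n V (\<Union>j\<in>J. cycle_edges n (\<phi> j))" by (simp add: eq)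
  moreover have "{u, w} \<in> (\<Union>j\<in>J. cycle_edges n (\<phi> j))" if "(u, w) \<in> E" for u w
    using cov[OF that] unfolding cycle_edges_def by blast
  ultimately show ?thesis unfolding covers_def by (intro exI[of _ "[\<Union>j\<in>J. cycle_edges n (\<phi> j)]"]) auto
qed

text \<open>The case of \<open>covers_blow\<close> with one-point fibres, needed to cut even cycles
  into matchings.\<close>

lemma covers_refine:
  assumes "covers (replicate k m) W E" "covers (replicate l n) {..<m} {(i, Suc i mod m) | i. i < m}"
  shows "covers (replicate (k * l) n) W E"
proof -
  have "covers (replicate l n) ((\<lambda>i. (i, ())) ` {..<m})
     (map_prod (\<lambda>i. (i, ())) (\<lambda>i. (i, ())) ` {(i, Suc i mod m) | i. i < m})"
    by (rule covers_image[OF assms(2)]) (auto simp: inj_on_def)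
  moreover have "(\<lambda>i. (i, ())) ` {..<m} = {..<m} \<times> UNIV" by auto
  moreover have "ring_blow m UNIV \<subseteq> map_prod (\<lambda>i. (i, ())) (\<lambda>i. (i, ())) ` {(i, Suc i mod m) | i. i < m}"
    by (force simp: ring_blow_def)
  ultimately have "covers (replicate l n) ({..<m} \<times> UNIV) (ring_blow m (UNIV :: unit set))"
    by (auto intro: covers_mono)
  from covers_blow[OF assms(1) this] have "covers (replicate (k * l) n) (W \<times> (UNIV :: unit set)) (blow E UNIV)" .
  from covers_image[OF this, of fst]
  have "covers (replicate (k * l) n) (fst ` (W \<times> (UNIV :: unit set)))
      (map_prod fst fst ` blow E (UNIV :: unit set))"
    by (simp add: inj_on_def)
  moreover have "E \<subseteq> map_prod fst fst ` blow E (UNIV :: unit set)" by (force simp: blow_def)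
  ultimately show ?thesis by (auto intro: covers_mono)
qed

section \<open>From covers to solutions\<close>

lemma cycle_factor_finite: "cycle_factor n V H \<Longrightarrow> finite V \<and> finite H"
  by (induction rule: cycle_factor.induct) (auto simp: cycle_edges_def)

lemma card_cycle_edges_le: "card (cycle_edges n f) \<le> n"
  unfolding cycle_edges_def using card_image_le[of "{..<n}"] by fastforce

lemma cycle_factor_card: "cycle_factor n V H \<Longrightarrow> card H \<le> card V"
proof (induction rule: cycle_factor.induct)
  case (cycle_factor_add V H f)
  have "card (cycle_edges n f \<union> H) \<le> card (cycle_edges n f) + card H" by (rule card_Un_le)
  also have "\<dots> \<le> card (f ` {..<n}) + card V"
    using card_cycle_edges_le[of n f] cycle_factor_add by (simp add: card_image)
  also have "\<dots> = card (f ` {..<n} \<union> V)"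
    using cycle_factor_add.hyps(3) cycle_factor_finite[OF cycle_factor_add.hyps(1)] by (subst card_Un_disjoint) auto
  finally show ?case .
qed simp

text \<open>For length 2 the two steps of a cycle traverse the same edge, which halves the general
  bound.\<close>

lemma cycle_factor_2_card: "cycle_factor 2 V H \<Longrightarrow> 2 * card H \<le> card V"
proof (induction rule: cycle_factor.induct)
  case (cycle_factor_add V H f)
  have c: "cycle_edges 2 f = {{f 0, f 1}}"
    unfolding cycle_edges_def by (auto simp: lessThan_Suc numeral_2_eq_2)
  have "card (cycle_edges 2 f \<union> H) \<le> card (cycle_edges 2 f) + card H" by (rule card_Un_le)
  then have "2 * card (cycle_edges 2 f \<union> H) \<le> card (f ` {..<2}) + card V"
    using c cycle_factor_add by (simp add: card_image)
  also have "\<dots> = card (f ` {..<2} \<union> V)"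
    using cycle_factor_add.hyps(3) cycle_factor_finite[OF cycle_factor_add.hyps(1)] by (subst card_Un_disjoint) auto
  finally show ?case .
qed simp

lemma cycle_edges_complete:
  assumes "n \<ge> 2" "inj_on f {..<n}"
  shows "cycle_edges n f \<subseteq> complete_graph_edges (f ` {..<n})"
proof -
  have "f k \<noteq> f (Suc k mod n)" if "k < n" for k
  proof -
    have "k \<noteq> Suc k mod n" using that assms(1) by (cases "Suc k = n") auto
    then show ?thesis using that assms by (auto dest: inj_onD)
  qed
  then show ?thesis
    unfolding cycle_edges_def complete_graph_edges_def using assms(1) by (auto simp: card_insert_if)
qed

lemma complete_mono: "V \<subseteq> W \<Longrightarrow> complete_graph_edges V \<subseteq> complete_graph_edges W"
  unfolding complete_graph_edges_def by auto

lemma cycle_factor_complete: "cycle_factor n V H \<Longrightarrow> n \<ge> 2 \<Longrightarrow> H \<subseteq> complete_graph_edges V"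
proof (induction rule: cycle_factor.induct)
  case (cycle_factor_add V H f)
  then show ?case
    using cycle_edges_complete[of n f] complete_mono[of V "f ` {..<n} \<union> V"]
      complete_mono[of "f ` {..<n}" "f ` {..<n} \<union> V"] by blast
qed simp

lemma cycle_factor_2_one_factor: "cycle_factor 2 V H \<Longrightarrow> is_one_factor V H"
proof (induction rule: cycle_factor.induct)
  case cycle_factor_empty
  then show ?case by (simp add: is_one_factor_def)
next
  case (cycle_factor_add V H f)
  have c: "cycle_edges 2 f = {{f 0, f 1}}" "f ` {..<2} = {f 0, f 1}"
    unfolding cycle_edges_def by (auto simp: lessThan_Suc numeral_2_eq_2)
  have sub: "H \<subseteq> complete_graph_edges V" using cycle_factor_add by (auto simp: is_one_factor_def)
  have comp: "cycle_edges 2 f \<union> H \<subseteq> complete_graph_edges (f ` {..<2} \<union> V)"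
    using cycle_factor_complete[OF cycle_factor.cycle_factor_add[OF cycle_factor_add.hyps]] by simp
  have "\<exists>!e. e \<in> cycle_edges 2 f \<union> H \<and> u \<in> e" if "u \<in> f ` {..<2} \<union> V" for u
  proof (cases "u \<in> V")
    case True
    then have "\<exists>!e. e \<in> H \<and> u \<in> e" using cycle_factor_add.IH by (auto simp: is_one_factor_def)
    moreover have "u \<notin> {f 0, f 1}" using True cycle_factor_add.hyps(3) c by auto
    ultimately show ?thesis using c by auto
  next
    case False
    then have "u \<in> {f 0, f 1}" "\<And>e. e \<in> H \<Longrightarrow> u \<notin> e"
      using that c sub by (auto simp: complete_graph_edges_def)
    then show ?thesis using c by auto
  qed
  then show ?case using comp unfolding is_one_factor_def by blast
qed

section \<open>Connected components of a disjoint union of cycles\<close>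

lemma adjacency_sym: "(a, b) \<in> (adjacency E)\<^sup>* \<Longrightarrow> (b, a) \<in> (adjacency E)\<^sup>*"
  by (rule symD[OF sym_rtrancl]) (auto simp: sym_def adjacency_def insert_commute)

text \<open>A walk starting in \<open>V\<close> never meets an edge of \<open>K\<close>, because
  these lie in the disjoint set \<open>W\<close>.\<close>

lemma component_of_Un:
  assumes "H \<subseteq> complete_graph_edges V" "K \<subseteq> complete_graph_edges W" "V \<inter> W = {}" "u \<in> V"
  shows "component_of (W \<union> V) (K \<union> H) u = component_of V H u"
proof -
  have "w \<in> V \<and> (u, w) \<in> (adjacency H)\<^sup>*" if "(u, w) \<in> (adjacency (K \<union> H))\<^sup>*" for w
    using that
  proof induction
    case (step y z)
    have "{y, z} \<in> K \<union> H" using step.hyps(2) by (simp add: adjacency_def)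
    moreover have "{y, z} \<notin> K" using step.IH assms(2,3) by (auto simp: complete_graph_edges_def)
    ultimately have e: "{y, z} \<in> H" by simp
    then have "z \<in> V" using assms(1) by (auto simp: complete_graph_edges_def)
    moreover have "(y, z) \<in> adjacency H" using e by (simp add: adjacency_def)
    ultimately show ?case using step.IH by (auto intro: rtrancl_into_rtrancl)
  qed (use assms(4) in simp)
  moreover have "(adjacency H)\<^sup>* \<subseteq> (adjacency (K \<union> H))\<^sup>*"
    by (rule rtrancl_mono) (auto simp: adjacency_def)
  ultimately show ?thesis unfolding component_of_def by blast
qed

lemma component_of_cycle_edges:
  assumes "u \<in> f ` {..<n}"
  shows "component_of (f ` {..<n}) (cycle_edges n f) u = f ` {..<n}"
proof -
  have 0: "(f 0, f k) \<in> (adjacency (cycle_edges n f))\<^sup>*" if "k < n" for k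
    using that
  proof (induction k)
    case (Suc k)
    then have "{f k, f (Suc k)} \<in> cycle_edges n f" unfolding cycle_edges_def by (intro image_eqI[of _ _ k]) auto
    then show ?case using Suc by (auto intro: rtrancl_into_rtrancl simp: adjacency_def)
  qed simp
  have "(f i, f j) \<in> (adjacency (cycle_edges n f))\<^sup>*" if "i < n" "j < n" for i j
    using adjacency_sym[OF 0[OF that(1)]] 0[OF that(2)] by (rule rtrancl_trans)
  then show ?thesis using assms unfolding component_of_def by auto
qed

lemma cycle_factor_imp_is_cycle_factor: "cycle_factor n V H \<Longrightarrow> n \<ge> 3 \<Longrightarrow> is_cycle_factor n V H"
proof (induction rule: cycle_factor.induct)
  case cycle_factor_empty
  then show ?case by (simp add: is_cycle_factor_def graph_components_def)
next
  case (cycle_factor_add V H f)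
  let ?W = "f ` {..<n}" let ?K = "cycle_edges n f"
  have H: "H \<subseteq> complete_graph_edges V" using cycle_factor_add by (auto simp: is_cycle_factor_def)
  have K: "?K \<subseteq> complete_graph_edges ?W" using cycle_edges_complete[of n f] cycle_factor_add by simp
  \<comment> \<open>An empty edge would lie inside every component; excluding it lets the condition
    \<open>e \<subseteq> C\<close> separate the edges of \<open>H\<close> from those of the new
    cycle.\<close>
  have ne: "e \<noteq> {}" if "e \<in> H \<union> ?K" for e
    using that H K by (auto simp: complete_graph_edges_def)
  have HV: "e \<subseteq> V" if "e \<in> H" for e using that H by (auto simp: complete_graph_edges_def)
  have KW: "e \<subseteq> ?W" if "e \<in> ?K" for e using that K by (auto simp: complete_graph_edges_def)
  have disj: "?W \<inter> V = {}" by (rule cycle_factor_add.hyps(3))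
  have "is_cycle_graph n C {e \<in> ?K \<union> H. e \<subseteq> C}" if "C \<in> graph_components (?W \<union> V) (?K \<union> H)" for C
  proof -
    from that obtain u where u: "u \<in> ?W \<union> V" "C = component_of (?W \<union> V) (?K \<union> H) u"
      unfolding graph_components_def by auto
    show ?thesis
    proof (cases "u \<in> V")
      case True
      have C: "C = component_of V H u" using component_of_Un[OF H K] disj True u by auto
      then have CV: "C \<subseteq> V" by (auto simp: component_of_def)
      have "\<not> e \<subseteq> C" if "e \<in> ?K" for e
        using KW[OF that] ne[of e] that CV disj by blast
      then have "{e \<in> ?K \<union> H. e \<subseteq> C} = {e \<in> H. e \<subseteq> C}" by blast
      then show ?thesis
        using cycle_factor_add.IH[OF cycle_factor_add.prems] True C by (auto simp: is_cycle_factor_def graph_components_def)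
    next
      case False
      then have uW: "u \<in> ?W" using u by auto
      have "C = component_of ?W ?K u"
        using component_of_Un[OF K H disj uW] u by (simp add: Un_commute)
      then have C: "C = ?W" using component_of_cycle_edges[OF uW] by simp
      have "\<not> e \<subseteq> C" if "e \<in> H" for e
        using HV[OF that] ne[of e] that C disj by blast
      then have "{e \<in> ?K \<union> H. e \<subseteq> C} = ?K" using KW C by blast
      moreover have "bij_betw f {..<n} ?W" using cycle_factor_add.hyps(2) by (simp add: bij_betw_def)
      ultimately show ?thesis using cycle_factor_add.prems C unfolding is_cycle_graph_def cycle_edges_def by blast
    qed
  qed
  moreover have "?K \<union> H \<subseteq> complete_graph_edges (?W \<union> V)"
    using cycle_factor_complete[OF cycle_factor.cycle_factor_add[OF cycle_factor_add.hyps]] cycle_factor_add.prems by simp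
  ultimately show ?case unfolding is_cycle_factor_def by blast
qed

definition distinct_pairs :: "'a set \<Rightarrow> ('a \<times> 'a) set" where
  "distinct_pairs V = {(u, w). u \<in> V \<and> w \<in> V \<and> u \<noteq> w}"

lemma complete_iff: "e \<in> complete_graph_edges V \<longleftrightarrow> (\<exists>u w. e = {u, w} \<and> (u, w) \<in> distinct_pairs V)"
  unfolding complete_graph_edges_def distinct_pairs_def by (auto simp: card_2_iff)

text \<open>Equality in the union bound: any overlap would make the union smaller than the sum of
  the sizes.\<close>

lemma disjoint_of_card:
  fixes n :: nat
  assumes "\<And>i. i < n \<Longrightarrow> finite (A i)" "(\<Sum>i<n. card (A i)) \<le> card (\<Union>i<n. A i)"
  shows "disjoint_family_on A {..<n}"
  using assms
proof (induction n)
  case (Suc n)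
  let ?U = "\<Union>i<n. A i"
  have fin: "finite ?U" "finite (A n)" using Suc.prems(1) by auto
  have "card (A n \<union> ?U) + card (A n \<inter> ?U) = card (A n) + card ?U"
    using card_Un_Int[OF fin(2,1)] by simp
  moreover have "card ?U \<le> (\<Sum>i<n. card (A i))" by (rule card_UN_le) simp
  moreover have "(\<Sum>i<n. card (A i)) + card (A n) \<le> card (A n \<union> ?U)"
    using Suc.prems(2) by (simp add: lessThan_Suc)
  ultimately have "card (A n \<inter> ?U) = 0" "(\<Sum>i<n. card (A i)) \<le> card ?U" by linarith+
  then have "disjoint_family_on A {..<n}" "A n \<inter> ?U = {}" using Suc fin by auto
  then show ?case by (simp add: lessThan_Suc disjoint_family_on_insert)
qed (simp add: disjoint_family_on_def)

text \<open>The matching has at most v/2 edges and each of the other \<beta> + 1 factors at most v.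
  As v - 1 = 2 \<beta> + 3, these bounds add up to v (v - 1) / 2, the number of edges of the
  complete graph, so the cover is a partition.\<close>

lemma covers_imp_HWP:
  assumes covers: "covers (2 # 6 # replicate \<beta> N) V (distinct_pairs V)" and fin: "finite V"
    and card: "card V = v" "v = 2 * (\<beta> + 2)" and N: "N \<ge> 3"
  shows "HWP_solution_exists v 6 N 1 \<beta>"
proof -
  obtain g where g: "bij_betw g V {..<v}"
    using ex_bij_betw_finite_nat[OF fin] card(1) by (auto simp: atLeast0LessThan)
  then have inj: "inj_on g V" and im: "g ` V = {..<v}" by (auto simp: bij_betw_def)
  have fcv: "covers (2 # 6 # replicate \<beta> N) {..<v} (map_prod g g ` distinct_pairs V)"
    using covers_image[OF covers inj] im by simp
  have "distinct_pairs {..<v} \<subseteq> map_prod g g ` distinct_pairs V"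
    unfolding im[symmetric] distinct_pairs_def by (auto simp: image_iff map_prod_def)
  from covers_mono[OF fcv this] obtain Hs where
    Hs: "list_all2 (\<lambda>n. cycle_factor n {..<v}) (2 # 6 # replicate \<beta> N) Hs"
    "\<forall>u w. (u, w) \<in> distinct_pairs {..<v} \<longrightarrow> (\<exists>H\<in>set Hs. {u, w} \<in> H)"
    unfolding covers_def by blast
  let ?n = "\<beta> + 2"
  have len: "length Hs = ?n" using list_all2_lengthD[OF Hs(1)] by simp
  have cf: "cycle_factor ((2 # 6 # replicate \<beta> N) ! i) {..<v} (Hs ! i)" if "i < ?n" for i
    using list_all2_nthD[OF Hs(1)] that by simp
  have cfN: "cycle_factor N {..<v} (Hs ! i)" if "2 \<le> i" "i < ?n" for i
    using cf[OF that(2)] that by (simp add: nth_Cons' numeral_2_eq_2)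
  have cf0: "cycle_factor 2 {..<v} (Hs ! 0)" using cf[of 0] by simp
  have cf1: "cycle_factor 6 {..<v} (Hs ! 1)" using cf[of 1] by simp
  have ge2: "(2 # 6 # replicate \<beta> N) ! i \<ge> 2" if "i < ?n" for i
    using that N by (auto simp: nth_Cons' )
  have sub: "Hs ! i \<subseteq> complete_graph_edges {..<v}" if "i < ?n" for i
    using cycle_factor_complete[OF cf[OF that] ge2[OF that]] .
  have U: "(\<Union>i<?n. Hs ! i) = complete_graph_edges {..<v}"
  proof
    show "complete_graph_edges {..<v} \<subseteq> (\<Union>i<?n. Hs ! i)"
    proof
      fix e :: "nat set" assume "e \<in> complete_graph_edges {..<v}"
      then obtain H where "H \<in> set Hs" "e \<in> H" using Hs(2) unfolding complete_iff by blast
      then show "e \<in> (\<Union>i<?n. Hs ! i)" using len by (auto simp: in_set_conv_nth)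
    qed
  qed (use sub in blast)
  have "(\<Sum>i<?n. card (Hs ! i)) = card (Hs ! 0) + (\<Sum>i\<in>{1..<?n}. card (Hs ! i))"
    by (simp add: lessThan_atLeast0 sum.atLeast_Suc_lessThan)
  also have "\<dots> \<le> v div 2 + (\<Sum>i\<in>{1..<?n}. v)"
  proof (intro add_mono sum_mono)
    show "card (Hs ! 0) \<le> v div 2" using cycle_factor_2_card[OF cf0] by simp
    fix i assume "i \<in> {1..<?n}"
    then show "card (Hs ! i) \<le> v" using cycle_factor_card[OF cf[of i]] by simp
  qed
  also have "\<dots> = (v * (v - 1)) div 2"
    using card(2) by (simp add: algebra_simps)
  also have "\<dots> = card (complete_graph_edges {..<v})"
    using n_subsets[of "{..<v}" 2] by (simp add: complete_graph_edges_def choose_two)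
  finally have disj: "disjoint_family_on (\<lambda>i. Hs ! i) {..<?n}"
    using U cf cycle_factor_finite by (intro disjoint_of_card) fastforce+
  \<comment> \<open>Position 0 of the list holds the 1-factor; the shift makes the 6-cycles factor
    number 0.\<close>
  define H where "H i = Hs ! Suc i" for i
  have "decomposes_into_cycle_factors {..<v} (complete_graph_edges {..<v} - Hs ! 0) 6 N 1 \<beta> H"
    unfolding decomposes_into_cycle_factors_def
  proof (intro conjI)
    show "disjoint_family_on H {..<1 + \<beta>}"
      using disj unfolding disjoint_family_on_def H_def by auto
    have "Hs ! 0 \<inter> Hs ! Suc i = {}" if "i < 1 + \<beta>" for i
      using disj that unfolding disjoint_family_on_def by auto
    moreover have "(\<Union>i<?n. Hs ! i) = Hs ! 0 \<union> (\<Union>i<1 + \<beta>. Hs ! Suc i)"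
      using lessThan_Suc_eq_insert_0[of "1 + \<beta>"] by auto
    ultimately show "(\<Union>i<1 + \<beta>. H i) = complete_graph_edges {..<v} - Hs ! 0"
      unfolding U H_def by blast
    show "\<forall>i<1. is_cycle_factor 6 {..<v} (H i)"
      using cycle_factor_imp_is_cycle_factor[OF cf1] by (simp add: H_def)
    show "\<forall>i\<in>{1..<1 + \<beta>}. is_cycle_factor N {..<v} (H i)"
      using cycle_factor_imp_is_cycle_factor[OF cfN N] by (simp add: H_def)
  qed
  moreover have "even v" using card by simp
  ultimately show ?thesis
    using cycle_factor_2_one_factor[OF cf0] unfolding HWP_solution_exists_def Let_def by auto
qed

section \<open>Blowing up cycles\<close>

lemma mod_add_surj:
  assumes "a < (q::nat)"
  obtains c where "c < q" "(c + s) mod q = a"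
proof
  show "(a + (q - s mod q)) mod q < q" using assms by simp
  have "s mod q < q" using assms by simp
  have "((a + (q - s mod q)) mod q + s) mod q = (a + (q - s mod q) + s mod q) mod q"
    by (simp add: mod_simps)
  also have "a + (q - s mod q) + s mod q = a + q" using \<open>s mod q < q\<close> by simp
  finally show "((a + (q - s mod q)) mod q + s) mod q = a" using assms by simp
qed

text \<open>Factor s consists of the cycles with value c in even columns and c + s in odd ones; they
  close because m is even. An edge belongs to the factor given by its difference, always measured
  from the even to the odd column.\<close>

lemma covers_ring_even:
  assumes "even m" "m > 0"
  shows "covers (replicate q m) ({..<m} \<times> {..<q}) (ring_blow m {..<q})"
proof -
  define E where "E s = {((k, a), (Suc k mod m, b)) | k a b.
     k < m \<and> a < q \<and> b < q \<and> (if even k then b = (a + s) mod q else a = (b + s) mod q)}" for s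
  have parity: "even (Suc k mod m) \<longleftrightarrow> odd k" for k using assms(1) by (simp add: dvd_mod_iff)
  have "covers [m] ({..<m} \<times> {..<q}) (E s)" for s
  proof (rule covers_singleI_edge[where J = "{..<q}" and \<phi> = "\<lambda>c k. (k, if even k then c else (c + s) mod q)"])
    fix v assume "v \<in> {..<m} \<times> {..<q}"
    then obtain k a where v: "v = (k, a)" "k < m" "a < q" by auto
    obtain c where "c < q" "(c + s) mod q = a" by (rule mod_add_surj[OF v(3)])
    then show "\<exists>j\<in>{..<q}. \<exists>k<m. (k, if even k then j else (j + s) mod q) = v" using v by auto
  next
    fix u w assume "(u, w) \<in> E s"
    then obtain k a b where "u = (k, a)" "w = (Suc k mod m, b)" "k < m" "a < q" "b < q"
      "if even k then b = (a + s) mod q else a = (b + s) mod q" unfolding E_def by blast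
    then show "\<exists>j\<in>{..<q}. \<exists>k<m. {u, w} = {(k, if even k then j else (j + s) mod q),
        (Suc k mod m, if even (Suc k mod m) then j else (j + s) mod q)}"
      unfolding parity by (intro bexI[of _ "if even k then a else b"] exI[of _ k]) auto
  qed auto
  then have "covers (replicate (q * 1) m) ({..<m} \<times> {..<q}) (\<Union>s<q. E s)"
    by (intro covers_replicate) simp
  moreover have "ring_blow m {..<q} \<subseteq> (\<Union>s<q. E s)"
  proof
    fix e assume "e \<in> ring_blow m {..<q}"
    then obtain k a b where e: "e = ((k, a), (Suc k mod m, b))" "k < m" "a < q" "b < q"
      unfolding ring_blow_def by auto
    obtain s where "s < q" "(s + a) mod q = b" by (rule mod_add_surj[OF e(4)])
    moreover obtain s' where "s' < q" "(s' + b) mod q = a" by (rule mod_add_surj[OF e(3)])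
    ultimately show "e \<in> (\<Union>s<q. E s)" using e unfolding E_def
      by (intro UN_I[of "if even k then s else s'"]) (auto simp: add.commute)
  qed
  ultimately show ?thesis by (auto intro: covers_mono)
qed

text \<open>Haggkvist's lemma: a cycle of length \<open>2 x\<close> runs along \<open>x + 1\<close> consecutive columns and back; the
  second factor is the complement, with the end points exchanged and the other columns crossed.\<close>

lemma covers_ring_double:
  assumes "x \<ge> 2" "m = x * d" "d > 0"
  shows "covers (replicate 2 (2 * x)) ({..<m} \<times> {..<2::nat}) (ring_blow m {..<2})"
proof -
  \<comment> \<open>Here r is the factor and s the arc. The cycle meets its first column only in row
    r and its last column only in row 1 - r, so neighbouring arcs share a column without sharing a
    vertex. In between it goes out through row l r modulo 2 and returns through the other
    row.\<close>
  define \<phi> where "\<phi> r s l = (if l = 0 then (s * x, r) else if l < x then (s * x + l, (l * r) mod 2)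
     else if l = x then (Suc s * x mod m, 1 - r)
     else (s * x + (2 * x - l), Suc ((2 * x - l) * r) mod 2))" for r s l :: nat
  define E where "E r = {(u, w). \<exists>s<d. \<exists>l<2*x. {u, w} = {\<phi> r s l, \<phi> r s (Suc l mod (2 * x))}}" for r
  have m: "m > 0" using assms by simp
  have fst0: "\<phi> r s 0 = (s * x, r)" for r s by (simp add: \<phi>_def)
  have fwd: "\<phi> r s l = (s * x + l, (l * r) mod 2)" if "0 < l" "l < x" for r s l
    using that by (simp add: \<phi>_def)
  have end_: "\<phi> r s x = (Suc s * x mod m, 1 - r)" for r s using assms(1) by (simp add: \<phi>_def)
  have bwd: "\<phi> r s (2 * x - l) = (s * x + l, Suc (l * r) mod 2)" if "0 < l" "l < x" for r s l
  proof -
    have "2 * x - l > x" "2 * x - (2 * x - l) = l" using that by auto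
    then show ?thesis using that by (simp add: \<phi>_def)
  qed
  have col: "\<exists>s l. k = s * x + l \<and> s < d \<and> l < x" if "k < m" for k
  proof (intro exI conjI)
    show "k = (k div x) * x + k mod x" by simp
    show "k div x < d" using that assms(2) by (simp add: less_mult_imp_div_less mult.commute)
    show "k mod x < x" using assms by simp
  qed
  have "covers [2 * x] ({..<m} \<times> {..<2}) (E r)" if r: "r < 2" for r
  proof (rule covers_singleI_edge[where J = "{..<d}" and \<phi> = "\<phi> r"])
    fix v :: "nat \<times> nat" assume "v \<in> {..<m} \<times> {..<2}"
    then obtain k a where v: "v = (k, a)" "k < m" "a < 2" by auto
    obtain s l where k: "k = s * x + l" "s < d" "l < x" using col[OF v(2)] by blast
    show "\<exists>s\<in>{..<d}. \<exists>l<2 * x. \<phi> r s l = v"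
    proof (cases "l = 0")
      case True
      show ?thesis
      proof (cases "a = r")
        case True
        then have "\<phi> r s 0 = v" using \<open>l = 0\<close> v k fst0 by simp
        then show ?thesis using k(2) assms(1) by force
      next
        case False
        then have "a = 1 - r" using v(3) r by auto
        obtain s' where s': "s' < d" "(s' + 1) mod d = s" by (rule mod_add_surj[OF k(2)])
        have "Suc s' * x mod m = x * (Suc s' mod d)"
          unfolding assms(2) by (metis mult.commute mult_mod_right)
        then have "\<phi> r s' x = v" using \<open>l = 0\<close> v k s' \<open>a = 1 - r\<close> end_ by (simp add: mult.commute)
        then show ?thesis using s'(1) assms(1) by force
      qed
    next
      case False
      show ?thesis
      proof (cases "a = (l * r) mod 2")
        case True
        then have "\<phi> r s l = v" using False v k fwd by simp
        then show ?thesis using k by force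
      next
        case neq: False
        then have "a = Suc (l * r) mod 2" using v(3) by (auto simp: mod_Suc)
        then have "\<phi> r s (2 * x - l) = v" using False v k bwd by simp
        moreover have "2 * x - l < 2 * x" using False k by simp
        ultimately show ?thesis using k(2) by blast
      qed
    qed
  next
    fix u w assume "(u, w) \<in> E r"
    then show "\<exists>s\<in>{..<d}. \<exists>l<2 * x. {u, w} = {\<phi> r s l, \<phi> r s (Suc l mod (2 * x))}"
      unfolding E_def mem_Collect_eq prod.case Bex_def lessThan_iff .
  qed (use assms in auto)
  then have "covers (replicate (2 * 1) (2 * x)) ({..<m} \<times> {..<2}) (\<Union>r<2. E r)"
    by (intro covers_replicate) simp
  moreover have "ring_blow m {..<2::nat} \<subseteq> (\<Union>r<2. E r)"
  proof
    fix e assume "e \<in> ring_blow m {..<2::nat}"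
    then obtain k a b where e: "e = ((k, a), (Suc k mod m, b))" "k < m" "a < 2" "b < 2"
      unfolding ring_blow_def by auto
    obtain s l where k: "k = s * x + l" "s < d" "l < x" using col[OF e(2)] by blast
    have cov: "\<exists>r<2. \<exists>j<2*x. {(k, a), (Suc k mod m, b)} = {\<phi> r s j, \<phi> r s (Suc j mod (2 * x))}"
      if "r < 2" "j < 2 * x" "(k, a) = \<phi> r s j \<and> (Suc k mod m, b) = \<phi> r s (Suc j mod (2 * x)) \<or>
        (Suc k mod m, b) = \<phi> r s j \<and> (k, a) = \<phi> r s (Suc j mod (2 * x))" for r j
    proof -
      have "{(k, a), (Suc k mod m, b)} = {\<phi> r s j, \<phi> r s (Suc j mod (2 * x))}"
        using that(3) by (elim disjE conjE) (simp_all only: insert_commute)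
      then show ?thesis using that(1,2) by blast
    qed
    have k1: "Suc k mod m = s * x + Suc l" if "Suc l < x"
    proof -
      have "s * x + Suc l < Suc s * x" using that by simp
      also have "\<dots> \<le> d * x" using k(2) by (intro mult_le_mono1) simp
      finally show ?thesis using k that assms(2) by (simp add: mult.commute)
    qed
    consider "l = 0" | "l > 0" "Suc l = x" | "l > 0" "Suc l < x" using k(3) by linarith
    then have "\<exists>r<2. \<exists>j<2*x. {(k, a), (Suc k mod m, b)} = {\<phi> r s j, \<phi> r s (Suc j mod (2 * x))}"
    proof cases
      case 1
      have k0: "(k, a) = \<phi> a s 0" using 1 k fst0 by simp
      have x: "Suc 0 < x" using assms(1) by simp
      show ?thesis
      proof (cases "b = a mod 2")
        case True
        then have "(Suc k mod m, b) = \<phi> a s (Suc 0 mod (2 * x))"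
          using k1 1 x fwd[of 1 a s] by simp
        then show ?thesis using k0 e(3) x by (intro cov[of a 0]) auto
      next
        case False
        then have "b = Suc a mod 2" using e by (auto simp: mod_Suc)
        then have "(Suc k mod m, b) = \<phi> a s (2 * x - 1)"
          using k1 1 x bwd[of 1 a s] by simp
        moreover have "Suc (2 * x - 1) mod (2 * x) = 0" using x by simp
        ultimately show ?thesis using k0 e(3) x by (intro cov[of a "2 * x - 1"]) auto
      qed
    next
      case 2
      have "Suc k = s * x + Suc l" using k(1) by simp
      then have "Suc k mod m = Suc s * x mod m" unfolding 2(2) by (simp add: add.commute)
      \<comment> \<open>At the right end of an arc the row alone determines the factor, since factor
        r reaches that column only in row 1 - r. At the left end the factor is the row
        itself.\<close>
      then have b: "(Suc k mod m, b) = \<phi> (1 - b) s x" using end_ e(4) by simp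
      show ?thesis
      proof (cases "a = (l * (1 - b)) mod 2")
        case True
        then have "(k, a) = \<phi> (1 - b) s l" using k(1) 2 fwd[of l] k(3) by simp
        then show ?thesis using b 2 by (intro cov[of "1 - b" l]) auto
      next
        case False
        then have "a = Suc (l * (1 - b)) mod 2" using e by (auto simp: mod_Suc)
        then have "(k, a) = \<phi> (1 - b) s (2 * x - l)" using k bwd[of l "1 - b" s] 2 by simp
        moreover have "Suc x mod (2 * x) = 2 * x - l" using 2 by simp
        ultimately show ?thesis using b assms(1) by (intro cov[of "1 - b" x]) auto
      qed
    next
      case 3
      \<comment> \<open>Between inner columns, factor 0 has the straight edges and factor 1 the
        crossing ones.\<close>
      define r where "r = (a + b) mod 2"
      have r: "r < 2" by (simp add: r_def)
      have ab: "a \<in> {0, 1}" "b \<in> {0, 1}" using e by auto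
      show ?thesis
      proof (cases "a = (l * r) mod 2")
        case True
        then have "b = (Suc l * r) mod 2" using ab unfolding r_def
          by (cases "even l") (auto simp: mod_Suc odd_iff_mod_2_eq_one)
        then have "(Suc k mod m, b) = \<phi> r s (Suc l)" using fwd[of "Suc l" r s] k1 3 by simp
        moreover have "(k, a) = \<phi> r s l" using True fwd[of l r s] k 3 by simp
        ultimately show ?thesis using 3 r by (intro cov[of r l]) auto
      next
        case False
        then have a: "a = Suc (l * r) mod 2" using ab by (auto simp: mod_Suc)
        then have "b = Suc (Suc l * r) mod 2" using ab unfolding r_def
          by (cases "even l") (auto simp: mod_Suc odd_iff_mod_2_eq_one)
        then have "(Suc k mod m, b) = \<phi> r s (2 * x - Suc l)" using bwd[of "Suc l" r s] k1 3 by simp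
        moreover have "(k, a) = \<phi> r s (2 * x - l)" using a bwd[of l r s] k 3 by simp
        moreover have "Suc (2 * x - Suc l) mod (2 * x) = 2 * x - l" using 3 by simp
        ultimately show ?thesis using 3 r by (intro cov[of r "2 * x - Suc l"]) auto
      qed
    qed
    then have "\<exists>r<2. ((k, a), (Suc k mod m, b)) \<in> E r"
      unfolding E_def mem_Collect_eq prod.case using k(2) by blast
    then show "e \<in> (\<Union>r<2. E r)" using e(1) by blast
  qed
  ultimately show ?thesis by (auto intro: covers_mono)
qed

lemma covers_family:
  assumes "\<And>i. i < k \<Longrightarrow> covers [n] V (E i)"
  shows "covers (replicate k n) V (\<Union>i<k. E i)"
  using covers_replicate[of k 1 n V E] assms by simp

lemma covers_singleI:
  assumes "finite J" "finite V" "card J * n = card V"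
    and surj: "\<And>v. v \<in> V \<Longrightarrow> \<exists>j\<in>J. \<exists>k<n. \<phi> j k = v"
    and cov: "\<And>u w. (u, w) \<in> E \<Longrightarrow> \<exists>j\<in>J. \<exists>k<n. (\<phi> j k = u \<and> \<phi> j (Suc k mod n) = w) \<or>
      (\<phi> j k = w \<and> \<phi> j (Suc k mod n) = u)"
  shows "covers [n] V E"
proof (rule covers_singleI_edge[OF assms(1-3) surj])
  fix u w assume "(u, w) \<in> E"
  from cov[OF this] obtain j k where jk: "j \<in> J" "k < n" "(\<phi> j k = u \<and> \<phi> j (Suc k mod n) = w) \<or>
      (\<phi> j k = w \<and> \<phi> j (Suc k mod n) = u)" by blast
  have "{u, w} = {\<phi> j k, \<phi> j (Suc k mod n)}"
    using jk(3) by (elim disjE conjE) (simp_all only: insert_commute)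
  then show "\<exists>j\<in>J. \<exists>k<n. {u, w} = {\<phi> j k, \<phi> j (Suc k mod n)}" using jk(1,2) by blast
qed assumption

text \<open>Since 6 = 2 * 3, doubling first yields two factors into cycles of length 2 x; these are
  even, so a further blow-up by 3 keeps the length.\<close>

lemma covers_ring_six:
  assumes "x \<ge> 2" "m = x * d" "d > 0"
  shows "covers (replicate 6 (2 * x)) ({..<m} \<times> {..<6::nat}) (ring_blow m {..<6})"
proof -
  let ?g = "\<lambda>((k, a), b). (k, 2 * b + a) :: nat \<times> nat"
  let ?V = "({..<m} \<times> {..<2::nat}) \<times> {..<3::nat}"
  have 0: "covers (replicate 3 (2 * x)) ({..<2 * x} \<times> {..<3::nat}) (ring_blow (2 * x) {..<3})"
    using assms by (intro covers_ring_even) auto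
  have inj: "inj_on ?g ?V"
  proof (rule inj_onI)
    fix u w assume uw: "u \<in> ?V" "w \<in> ?V" "?g u = ?g w"
    obtain k a b k' a' b' where e: "u = ((k, a), b)" "w = ((k', a'), b')" by (metis surj_pair)
    have "a < 2" "a' < 2" "k = k'" "2 * b + a = 2 * b' + a'" using uw e by auto
    moreover from this have "a = a'" by presburger
    ultimately show "u = w" using e by simp
  qed
  have ex: "\<exists>b<3. \<exists>a<2. y = 2 * b + a" if "y < 6" for y :: nat
    using that by (intro exI[of _ "y div 2"] conjI exI[of _ "y mod 2"]) auto
  have "?g ` ?V = {..<m} \<times> {..<6}"
  proof (intro set_eqI iffI)
    fix v assume "v \<in> {..<m} \<times> {..<6::nat}"
    then obtain k y where v: "v = (k, y)" "k < m" "y < 6" by auto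
    from ex[OF v(3)] obtain b a where "b < 3" "a < 2" "y = 2 * b + a" by blast
    then show "v \<in> ?g ` ?V" using v by (intro image_eqI[of _ _ "((k, a), b)"]) auto
  qed auto
  moreover have "ring_blow m {..<6} \<subseteq> map_prod ?g ?g ` blow (ring_blow m {..<2::nat}) {..<3::nat}"
  proof
    fix e assume "e \<in> ring_blow m {..<6::nat}"
    then obtain k y z where e: "e = ((k, y), (Suc k mod m, z))" "k < m" "y < 6" "z < 6"
      unfolding ring_blow_def by auto
    from ex[OF e(3)] obtain b a where y: "b < 3" "a < 2" "y = 2 * b + a" by blast
    from ex[OF e(4)] obtain b' a' where z: "b' < 3" "a' < 2" "z = 2 * b' + a'" by blast
    have "(((k, a), b), ((Suc k mod m, a'), b')) \<in> blow (ring_blow m {..<2::nat}) {..<3::nat}"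
      using e y z unfolding blow_def ring_blow_def by auto
    from imageI[OF this, of "map_prod ?g ?g"]
    show "e \<in> map_prod ?g ?g ` blow (ring_blow m {..<2::nat}) {..<3::nat}" using e(1) y z by simp
  qed
  ultimately show ?thesis
    using covers_image[OF covers_blow[OF covers_ring_double[OF assms] 0] inj] by (auto intro: covers_mono)
qed

section \<open>Hamilton cycles in blown-up odd cycles\<close>

lemma Suc_mult_add_mod:
  assumes "r < t" "q < (x::nat)"
  shows "Suc (q * t + r) mod (t * x) = (if Suc r < t then q * t + Suc r else (Suc q mod x) * t)"
proof (cases "Suc r < t")
  case True
  then have "q * t + Suc r < Suc q * t" by simp
  also have "\<dots> \<le> x * t" using assms by (intro mult_le_mono1) simp
  finally show ?thesis using True by (simp add: mult.commute)
next
  case False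
  then have "Suc (q * t + r) = Suc q * t" using assms by simp
  also have "\<dots> mod (t * x) = (Suc q mod x) * t" by (metis mult.commute mult_mod_right)
  finally show ?thesis using False by simp
qed

lemma mult_add_less:
  assumes "r < t" "q < (x::nat)" shows "q * t + r < t * x"
proof -
  have "q * t + r < Suc q * t" using assms by simp
  also have "\<dots> \<le> x * t" using assms by (intro mult_le_mono1) simp
  finally show ?thesis by (simp add: mult.commute)
qed

text \<open>The cycle runs around the \<open>t\<close> columns with offsets \<open>0, k, 2 k, k, 2 k, \<dots>, k, 2 k\<close>, and one
  turn advances it by \<open>1\<close>; the multipliers \<open>1\<close>, \<open>1\<close>, \<open>-1\<close>, \<open>-2\<close> of \<open>k\<close> in the steps are units
  modulo the odd number \<open>x\<close>.\<close>

lemma covers_ring_odd_hamilton: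
  assumes "odd t" "t \<ge> 3" "odd x"
  shows "covers (replicate x (t * x)) ({..<t} \<times> {..<x}) (ring_blow t {..<x})"
proof -
  define c :: "nat \<Rightarrow> nat" where "c r = (if r = 0 then 0 else if odd r then 1 else 2)" for r
  define \<phi> where "\<phi> k u = (u mod t, (u div t + c (u mod t) * k) mod x)" for k u
  have x: "x > 0" and t: "t > 0" using assms by (auto intro: odd_pos)
  have \<phi>: "\<phi> k (q * t + r) = (r, (q + c r * k) mod x)" if "r < t" for k q r
    using that by (simp add: \<phi>_def)
  define E where "E k = {(u, w). \<exists>l<t * x. \<phi> k l = u \<and> \<phi> k (Suc l mod (t * x)) = w}" for k
  have "covers [t * x] ({..<t} \<times> {..<x}) (E k)" for k
  proof (rule covers_singleI[where J = "{0::nat}" and \<phi> = "\<lambda>_. \<phi> k"])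
    fix v assume "v \<in> {..<t} \<times> {..<x}"
    then obtain r a where v: "v = (r, a)" "r < t" "a < x" by auto
    obtain q where "q < x" "(q + c r * k) mod x = a" by (rule mod_add_surj[OF v(3)])
    then have "\<phi> k (q * t + r) = v" "q * t + r < t * x" using v \<phi> mult_add_less by auto
    then show "\<exists>j\<in>{0::nat}. \<exists>u<t * x. \<phi> k u = v" by blast
  next
    fix u w assume "(u, w) \<in> E k"
    then show "\<exists>j\<in>{0::nat}. \<exists>l<t * x. \<phi> k l = u \<and> \<phi> k (Suc l mod (t * x)) = w \<or>
        \<phi> k l = w \<and> \<phi> k (Suc l mod (t * x)) = u"
      unfolding E_def by blast
  qed auto
  then have "covers (replicate (x * 1) (t * x)) ({..<t} \<times> {..<x}) (\<Union>k<x. E k)"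
    by (intro covers_replicate) simp
  moreover have "ring_blow t {..<x} \<subseteq> (\<Union>k<x. E k)"
  proof
    fix e assume "e \<in> ring_blow t {..<x}"
    then obtain r i j where e: "e = ((r, i), (Suc r mod t, j))" "r < t" "i < x" "j < x"
      unfolding ring_blow_def by auto
    have "\<exists>k<x. \<exists>q<x. (q + c r * k) mod x = i \<and>
      (if Suc r < t then (q + c (Suc r) * k) mod x = j else Suc q mod x = j)"
    proof -
      consider "Suc r < t" "r = 0" | "Suc r < t" "odd r" | "Suc r < t" "even r" "r > 0" | "Suc r = t"
        using e(2) by linarith
      then show ?thesis
      proof cases
        case 1
        obtain k where "k < x" "(k + i) mod x = j" by (rule mod_add_surj[OF e(4)])
        then show ?thesis using 1 e(3) by (intro exI[of _ k] conjI exI[of _ i])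
            (auto simp: c_def add.commute)
      next
        case 2
        obtain k where k: "k < x" "(k + i) mod x = j" by (rule mod_add_surj[OF e(4)])
        obtain q where q: "q < x" "(q + k) mod x = i" by (rule mod_add_surj[OF e(3)])
        have "(q + 2 * k) mod x = ((q + k) mod x + k) mod x" by (simp add: mod_simps mult_2 add.assoc)
        then have "(q + 2 * k) mod x = j" using k q by (simp add: add.commute)
        then show ?thesis using 2 k q by (intro exI[of _ k] conjI exI[of _ q]) (auto simp: c_def)
      next
        case 3
        obtain k where k: "k < x" "(k + j) mod x = i" by (rule mod_add_surj[OF e(3)])
        obtain q where q: "q < x" "(q + k) mod x = j" by (rule mod_add_surj[OF e(4)])
        have "(q + 2 * k) mod x = ((q + k) mod x + k) mod x" by (simp add: mod_simps mult_2 add.assoc)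
        then have "(q + 2 * k) mod x = i" using k q by (simp add: add.commute)
        then show ?thesis using 3 k q by (intro exI[of _ k] conjI exI[of _ q]) (auto simp: c_def)
      next
        case 4
        obtain q where q: "q < x" "(q + 1) mod x = j" by (rule mod_add_surj[OF e(4)])
        obtain d where d: "d < x" "(d + q) mod x = i" by (rule mod_add_surj[OF e(3)])
        \<comment> \<open>Half of d modulo the odd number x, as required by the closing step with
          multiplier -2.\<close>
        define k where "k = (if even d then d div 2 else (d + x) div 2)"
        have k: "k < x" "2 * k = d \<or> 2 * k = d + x" using d(1) assms(3) by (auto simp: k_def)
        then have "q + 2 * k = d + q \<or> q + 2 * k = d + q + x" by linarith
        then have "(q + 2 * k) mod x = (d + q) mod x" by (elim disjE) (simp_all only: mod_add_self2)
        moreover have "c r = 2" using 4 assms by (auto simp: c_def)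
        ultimately show ?thesis using 4 k q d by (intro exI[of _ k] conjI exI[of _ q]) auto
      qed
    qed
    then obtain k q where kq: "k < x" "q < x" "(q + c r * k) mod x = i"
      "if Suc r < t then (q + c (Suc r) * k) mod x = j else Suc q mod x = j" by blast
    have "\<phi> k (q * t + r) = (r, i)" using \<phi>[OF e(2)] kq by simp
    moreover have "\<phi> k (Suc (q * t + r) mod (t * x)) = (Suc r mod t, j)"
    proof (cases "Suc r < t")
      case True
      then show ?thesis using Suc_mult_add_mod[OF e(2) kq(2)] kq(4) \<phi>[OF True] by simp
    next
      case False
      then have "Suc r = t" using e(2) by simp
      then show ?thesis using Suc_mult_add_mod[OF e(2) kq(2)] kq(4) False \<phi>[OF t, of k "Suc q mod x"]
          e(4) by (simp add: c_def)
    qed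
    ultimately have "e \<in> E k" unfolding E_def e(1) using mult_add_less[OF e(2) kq(2)] by blast
    then show "e \<in> (\<Union>k<x. E k)" using kq(1) by blast
  qed
  ultimately show ?thesis by (auto intro: covers_mono)
qed

text \<open>Crossing with difference r + 1 and returning along difference r advances the index by 1,
  so the two classes form a single Hamilton cycle of the bipartite graph, whatever the parity of
  x.\<close>

lemma covers_bip_shift:
  assumes "x > 0"
  shows "covers [2 * x] ({..<2::nat} \<times> {..<x})
    {((0, i), (1, (i + s) mod x)) | i s. i < x \<and> (s = r \<or> s = Suc r)}"
proof (rule covers_singleI[where J = "{0::nat}"
    and \<phi> = "\<lambda>_ k. if even k then (0, k div 2) else (1, (k div 2 + Suc r) mod x)"])
  fix v assume "v \<in> {..<2::nat} \<times> {..<x}"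
  then obtain b i where v: "v = (b, i)" "b < 2" "i < x" by auto
  obtain c where c: "c < x" "(c + Suc r) mod x = i" by (rule mod_add_surj[OF v(3)])
  show "\<exists>j\<in>{0::nat}. \<exists>k<2 * x. (if even k then (0, k div 2) else (1, (k div 2 + Suc r) mod x)) = v"
  proof (cases "b = 0")
    case True
    then show ?thesis using v by (intro bexI[of _ 0] exI[of _ "2 * i"]) simp_all
  next
    case False
    then show ?thesis using v c by (intro bexI[of _ 0] exI[of _ "2 * c + 1"]) simp_all
  qed
next
  fix u w :: "nat \<times> nat"
  let ?\<phi> = "\<lambda>k::nat. if even k then (0, k div 2) else (1, (k div 2 + Suc r) mod x)"
  assume "(u, w) \<in> {((0, i), (1, (i + s) mod x)) | i s. i < x \<and> (s = r \<or> s = Suc r)}"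
  then obtain i s where uw: "u = (0, i)" "w = (1, (i + s) mod x)" "i < x" "s = r \<or> s = Suc r"
    by auto
  have "\<exists>k<2 * x. ?\<phi> k = u \<and> ?\<phi> (Suc k mod (2 * x)) = w \<or> ?\<phi> k = w \<and> ?\<phi> (Suc k mod (2 * x)) = u"
  proof (cases "s = r")
    case False
    then have "s = Suc r" using uw by simp
    moreover have "Suc (2 * i) mod (2 * x) = Suc (2 * i)" using uw by simp
    ultimately show ?thesis using uw by (intro exI[of _ "2 * i"]) simp
  next
    case True
    show ?thesis
    proof (cases i)
      case 0
      \<comment> \<open>The last position of the cycle, whose successor is position 0.\<close>
      define y where "y = 2 * x - 1"
      have y: "Suc y = 2 * x" "odd y" "y div 2 + Suc r = r + x"
        using assms by (auto simp: y_def)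
      have "(y div 2 + Suc r) mod x = r mod x" unfolding y(3) by simp
      then show ?thesis using uw True 0 y(1,2) assms by (intro exI[of _ y]) simp
    next
      case (Suc i')
      have "Suc (2 * i' + 1) mod (2 * x) = 2 * i" "(2 * i' + 1) div 2 = i'" "2 * i' + 1 < 2 * x"
        using Suc uw by auto
      then show ?thesis using uw True Suc by (intro exI[of _ "2 * i' + 1"]) simp
    qed
  qed
  then show "\<exists>j\<in>{0::nat}. \<exists>k<2 * x. ?\<phi> k = u \<and> ?\<phi> (Suc k mod (2 * x)) = w \<or>
      ?\<phi> k = w \<and> ?\<phi> (Suc k mod (2 * x)) = u" by blast
qed auto

lemma covers_bip_classes:
  assumes "x > 0"
  shows "covers (replicate d (2 * x)) ({..<2::nat} \<times> {..<x})
    {((0, i), (1, (i + s) mod x)) | i s. i < x \<and> s0 \<le> s \<and> s < s0 + 2 * d}"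
proof -
  have "covers (replicate d (2 * x)) ({..<2::nat} \<times> {..<x})
    (\<Union>e<d. {((0, i), (1, (i + s) mod x)) | i s. i < x \<and> (s = s0 + 2 * e \<or> s = Suc (s0 + 2 * e))})"
    by (intro covers_family covers_bip_shift assms)
  moreover have "{((0, i), (1, (i + s) mod x)) | i s. i < x \<and> s0 \<le> s \<and> s < s0 + 2 * d} \<subseteq>
    (\<Union>e<d. {((0, i), (1, (i + s) mod x)) | i s. i < x \<and> (s = s0 + 2 * e \<or> s = Suc (s0 + 2 * e))})"
    (is "_ \<subseteq> (\<Union>e<d. ?C e)")
  proof clarify
    fix i s assume *: "i < x" "s0 \<le> s" "s < s0 + 2 * d"
    have "(s - s0) div 2 < d" "s = s0 + 2 * ((s - s0) div 2) \<or> s = Suc (s0 + 2 * ((s - s0) div 2))"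
      using * by presburger+
    then show "((0, i), (1, (i + s) mod x)) \<in> (\<Union>e<d. ?C e)"
      using *(1) by (intro UN_I[of "(s - s0) div 2"]) blast+
  qed
  ultimately show ?thesis by (rule covers_mono)
qed

section \<open>Walecki cycles and one-factorizations\<close>

lemma mod_add_left_inj:
  assumes "b < N" "b' < N" "(a + b) mod N = (a + b') mod (N::nat)"
  shows "b = b'"
proof -
  have *: "((a + y) mod N + (N - a mod N)) mod N = y" if "y < N" for y
  proof -
    have "a mod N \<le> N" using that by simp
    then have "a mod N + y + (N - a mod N) = y + N" by simp
    then have "(a mod N + y + (N - a mod N)) mod N = y" using that by simp
    moreover have "((a + y) mod N + (N - a mod N)) mod N = (a mod N + y + (N - a mod N)) mod N"
      by (metis mod_add_left_eq)
    ultimately show ?thesis by (simp only:)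
  qed
  have "b = ((a + b) mod N + (N - a mod N)) mod N" by (rule *[OF assms(1), symmetric])
  also have "\<dots> = ((a + b') mod N + (N - a mod N)) mod N" unfolding assms(3) ..
  also have "\<dots> = b'" by (rule *[OF assms(2)])
  finally show ?thesis .
qed

text \<open>Walecki's path c, c + 1, c - 1, c + 2, c - 2, ... through the integers modulo N, closed
  up by the additional vertex N. Sums of neighbours alternate between 2 c + 1 and 2 c, so an edge
  can be recognised by its sum. Adding \<open>N - k div 2\<close> avoids truncated
  subtraction.\<close>

definition zigzag :: "nat \<Rightarrow> nat \<Rightarrow> nat \<Rightarrow> nat" where
  "zigzag N c k = (if k = N then N else if even k then (c + (N - k div 2)) mod N
     else (c + Suc (k div 2)) mod N)"

lemma zigzag_surj:
  assumes "v < N" "c < N"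
  shows "\<exists>k<N. zigzag N c k = v"
proof -
  obtain d where d: "d < N" "(d + c) mod N = v" by (rule mod_add_surj[OF assms(1)])
  consider "d = 0" | "d > 0" "2 * d \<le> N" | "2 * d > N" by linarith
  then show ?thesis
  proof cases
    case 1
    then show ?thesis using assms d by (intro exI[of _ 0]) (simp add: zigzag_def)
  next
    case 2
    define k where "k = 2 * d - 1"
    have "odd k" "Suc (k div 2) = d" "k < N" using 2 by (auto simp: k_def)
    then show ?thesis using d by (intro exI[of _ k]) (simp add: zigzag_def add.commute)
  next
    case 3
    define k where "k = 2 * (N - d)"
    have "even k" "k < N" "N - k div 2 = d" using 3 d by (auto simp: k_def)
    then show ?thesis using d by (intro exI[of _ k]) (simp add: zigzag_def add.commute)
  qed
qed

text \<open>With a = c + d the sum forces b = c - d or b = c + 1 - d, and two such values stand next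
  to each other in the zigzag.\<close>

lemma zigzag_step:
  assumes "a < N" "b < N" "a \<noteq> b" "c < N"
    and sum: "(a + b) mod N = 2 * c mod N \<or> (a + b) mod N = Suc (2 * c) mod N"
  shows "\<exists>k. Suc k < N \<and> (zigzag N c k = a \<and> zigzag N c (Suc k) = b \<or>
      zigzag N c k = b \<and> zigzag N c (Suc k) = a)"
proof -
  obtain d where d: "d < N" "(d + c) mod N = a" by (rule mod_add_surj[OF assms(1)])
  have "N > 0" using assms by simp
  have da: "(a + z mod N) mod N = ((d + c) + z) mod N" for z
  proof -
    have "(a + z mod N) mod N = ((d + c) mod N + z) mod N" by (simp only: d(2) mod_add_right_eq)
    then show ?thesis by (simp only: mod_add_left_eq)
  qed
  have z_odd: "zigzag N c (2 * e - 1) = (c + e) mod N" if "e > 0" "2 * e - 1 < N" for e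
  proof -
    have "odd (2 * e - 1)" "Suc ((2 * e - 1) div 2) = e" using that by auto
    then show ?thesis using that(2) by (simp add: zigzag_def)
  qed
  have z_even: "zigzag N c (2 * e) = (c + (N - e)) mod N" if "2 * e < N" for e
    using that by (simp add: zigzag_def)
  show ?thesis using sum
  proof
    assume s: "(a + b) mod N = 2 * c mod N"
    have "(a + (c + (N - d)) mod N) mod N = ((d + c) + (c + (N - d))) mod N"
      by (rule da)
    also have "(d + c) + (c + (N - d)) = 2 * c + N" using d by simp
    finally have "(a + b) mod N = (a + (c + (N - d)) mod N) mod N" using s by simp
    then have b: "b = (c + (N - d)) mod N"
      by (rule mod_add_left_inj[OF assms(2), rotated]) (use \<open>N > 0\<close> in simp)
    have a: "a = (c + d) mod N" using d by (simp add: add.commute)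
    have "d \<noteq> 0" using a b assms(3) by (metis add_0_right diff_zero mod_add_self2)
    have "2 * d \<noteq> N"
    proof
      assume "2 * d = N"
      then have "N - d = d" by simp
      then show False using a b assms(3) by simp
    qed
    \<comment> \<open>Odd positions lie above the centre and even ones below. The smaller of d and N
      - d tells which of a and b is reached upwards, hence first.\<close>
    then consider "2 * d < N" | "2 * (N - d) < N" using d by linarith
    then show ?thesis
    proof cases
      case 1
      then show ?thesis using \<open>d \<noteq> 0\<close> a b z_odd[of d] z_even[of d]
        by (intro exI[of _ "2 * d - 1"]) simp
    next
      case 2
      have "N - (N - d) = d" "N - d > 0" using d by auto
      then show ?thesis using 2 a b z_odd[of "N - d"] z_even[of "N - d"]
        by (intro exI[of _ "2 * (N - d) - 1"]) simp
    qed
  next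
    assume s: "(a + b) mod N = Suc (2 * c) mod N"
    have "(a + (c + Suc (N - d)) mod N) mod N = ((d + c) + (c + Suc (N - d))) mod N"
      by (rule da)
    also have "(d + c) + (c + Suc (N - d)) = Suc (2 * c) + N" using d by simp
    finally have "(a + b) mod N = (a + (c + Suc (N - d)) mod N) mod N"
      using s by (simp only: mod_add_self2)
    then have b: "b = (c + Suc (N - d)) mod N"
      by (rule mod_add_left_inj[OF assms(2), rotated]) (use \<open>N > 0\<close> in simp)
    have a: "a = (c + d) mod N" using d by (simp add: add.commute)
    have "2 * d \<noteq> Suc N"
    proof
      assume "2 * d = Suc N"
      then have "Suc (N - d) = d" using d by simp
      then show False using a b assms(3) by simp
    qed
    moreover have "N > 1" using assms(1-3) by simp
    ultimately have "d = 0 \<or> d > 0 \<and> 2 * d \<le> N \<or> d > 1 \<and> 2 * Suc (N - d) \<le> N"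
      using d(1) by presburger
    then consider "d = 0" | "d > 0" "2 * d \<le> N" | "d > 1" "2 * Suc (N - d) \<le> N" by blast
    then show ?thesis
    proof cases
      case 1
      have "c + Suc (N - d) = Suc c + N" using 1 by simp
      then have "b = Suc c mod N" using b by (simp only: mod_add_self2)
      then show ?thesis using a assms(4) 1 \<open>N > 1\<close> z_odd[of 1] z_even[of 0]
        by (intro exI[of _ 0]) simp
    next
      case 2
      define e where "e = d - 1"
      have e: "d = Suc e" using 2 by (simp add: e_def)
      have "N - e = Suc (N - d)" using d e by simp
      then have "zigzag N c (2 * e) = b" "zigzag N c (Suc (2 * e)) = a"
        using a b z_even[of e] z_odd[of d] e 2 by auto
      then show ?thesis using e 2 by (intro exI[of _ "2 * e"]) simp
    next
      case 3
      define e where "e = N - d"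
      have "N - e = d" using d e_def by simp
      then have "zigzag N c (2 * e) = a" "zigzag N c (Suc (2 * e)) = b"
        using a b z_even[of e] z_odd[of "Suc e"] e_def 3 by auto
      then show ?thesis using e_def 3 by (intro exI[of _ "2 * e"]) simp
    qed
  qed
qed

lemma covers_zigzag:
  assumes "c < N"
  shows "covers [Suc N] {..<Suc N} ({(a, b). a < N \<and> b < N \<and> a \<noteq> b \<and>
     ((a + b) mod N = 2 * c mod N \<or> (a + b) mod N = Suc (2 * c) mod N)} \<union>
     {(c, N), (zigzag N c (N - 1), N)})"
proof (rule covers_singleI[where J = "{0::nat}" and \<phi> = "\<lambda>_. zigzag N c"])
  fix v assume "v \<in> {..<Suc N}"
  then consider "v = N" | "v < N" by fastforce
  then show "\<exists>j\<in>{0::nat}. \<exists>k<Suc N. zigzag N c k = v"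
  proof cases
    case 1
    then show ?thesis by (intro bexI[of _ 0] exI[of _ N]) (auto simp: zigzag_def)
  next
    case 2
    from zigzag_surj[OF this assms] show ?thesis using less_SucI by blast
  qed
next
  fix u w
  assume "(u, w) \<in> {(a, b). a < N \<and> b < N \<and> a \<noteq> b \<and>
     ((a + b) mod N = 2 * c mod N \<or> (a + b) mod N = Suc (2 * c) mod N)} \<union>
     {(c, N), (zigzag N c (N - 1), N)}"
  then consider "u < N" "w < N" "u \<noteq> w"
      "(u + w) mod N = 2 * c mod N \<or> (u + w) mod N = Suc (2 * c) mod N"
    | "u = c" "w = N" | "u = zigzag N c (N - 1)" "w = N" by blast
  then show "\<exists>j\<in>{0::nat}. \<exists>k<Suc N. (zigzag N c k = u \<and> zigzag N c (Suc k mod Suc N) = w) \<or>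
      (zigzag N c k = w \<and> zigzag N c (Suc k mod Suc N) = u)"
  proof cases
    case 1
    from zigzag_step[OF 1(1-3) assms 1(4)] obtain k where k: "Suc k < N"
      "zigzag N c k = u \<and> zigzag N c (Suc k) = w \<or> zigzag N c k = w \<and> zigzag N c (Suc k) = u"
      by blast
    moreover have "Suc k mod Suc N = Suc k" using k(1) by simp
    ultimately show ?thesis by (intro bexI[of _ 0] exI[of _ k]) auto
  next
    case 2
    have "zigzag N c N = N" "zigzag N c 0 = c" using assms by (auto simp: zigzag_def)
    then show ?thesis using 2 by (intro bexI[of _ 0] exI[of _ N]) auto
  next
    case 3
    have "zigzag N c N = N" "Suc (N - 1) mod Suc N = N" using assms by (auto simp: zigzag_def)
    then show ?thesis using 3 assms by (intro bexI[of _ 0] exI[of _ "N - 1"]) auto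
  qed
qed auto

text \<open>Modulo 2 h, the sums 2 c and 2 c + 1 of the h centres exhaust all residues. The ends c
  and c + h of the zigzags run through all vertices, so every edge at the additional vertex occurs
  as well.\<close>

lemma covers_walecki_odd:
  assumes "h > 0"
  shows "covers (replicate h (2 * h + 1)) {..<2 * h + 1} (distinct_pairs {..<2 * h + 1})"
proof -
  let ?N = "2 * h"
  let ?E = "\<lambda>c. {(a, b). a < ?N \<and> b < ?N \<and> a \<noteq> b \<and>
     ((a + b) mod ?N = 2 * c mod ?N \<or> (a + b) mod ?N = Suc (2 * c) mod ?N)} \<union>
     {(c, ?N), (zigzag ?N c (?N - 1), ?N)}"
  have "covers (replicate h (Suc ?N)) {..<Suc ?N} (\<Union>c<h. ?E c)"
    by (intro covers_family covers_zigzag) simp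
  from covers_sym[OF this] have covers: "covers (replicate h (Suc ?N)) {..<Suc ?N} ((\<Union>c<h. ?E c) \<union> (\<Union>c<h. ?E c)\<inverse>)"
    by simp
  have N: "(a, ?N) \<in> (\<Union>c<h. ?E c)" if "a < ?N" for a
  proof (cases "a < h")
    case True
    then show ?thesis by blast
  next
    case False
    define y where "y = 2 * h - 1"
    have "odd y" "Suc (y div 2) = h" "y \<noteq> 2 * h" using assms by (auto simp: y_def)
    then have "zigzag ?N (a - h) y = a" using that False by (simp add: zigzag_def)
    then have "(a, ?N) \<in> ?E (a - h)" by (simp add: y_def)
    then show ?thesis using that by (intro UN_I[of "a - h"]) auto
  qed
  have "distinct_pairs {..<Suc ?N} \<subseteq> (\<Union>c<h. ?E c) \<union> (\<Union>c<h. ?E c)\<inverse>"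
  proof
    fix e assume "e \<in> distinct_pairs {..<Suc ?N}"
    then obtain a b where e: "e = (a, b)" "a < Suc ?N" "b < Suc ?N" "a \<noteq> b"
      unfolding distinct_pairs_def by auto
    then consider "a < ?N" "b < ?N" | "a < ?N" "b = ?N" | "b < ?N" "a = ?N" by linarith
    then show "e \<in> (\<Union>c<h. ?E c) \<union> (\<Union>c<h. ?E c)\<inverse>"
    proof cases
      case 1
      define s where "s = (a + b) mod ?N"
      have "s < ?N" using assms by (simp add: s_def)
      then have "s div 2 < h" "s = 2 * (s div 2) \<or> s = Suc (2 * (s div 2))" by presburger+
      then have "(a + b) mod ?N = 2 * (s div 2) mod ?N \<or> (a + b) mod ?N = Suc (2 * (s div 2)) mod ?N"
        unfolding s_def by (metis mod_mod_trivial)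
      then have "(a, b) \<in> ?E (s div 2)" using e(4) 1 by simp
      then show ?thesis using \<open>s div 2 < h\<close> e(1) by blast
    qed (use N e(1) in blast)+
  qed
  from covers_mono[OF covers this] show ?thesis by simp
qed

text \<open>The 1-factor missed by the Walecki cycles on 2 h + 2 vertices: the pairs with sum 2 h,
  together with the edge from their fixed point h to the additional vertex 2 h + 1.\<close>

definition partner :: "nat \<Rightarrow> nat \<Rightarrow> nat" where
  "partner h v = (if v = h then 2 * h + 1 else if v = 2 * h + 1 then h else 2 * h - v)"

text \<open>Modulo 2 h + 1, the h centres use the sums 0, ..., 2 h - 1 and leave only the sum 2 h.
  The ends c and c + h + 1 of the zigzags reach every vertex except h.\<close>

lemma covers_walecki_even:
  "covers (replicate h (2 * h + 2)) {..<2 * h + 2}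
     {(a, b). a < 2 * h + 2 \<and> b < 2 * h + 2 \<and> a \<noteq> b \<and> b \<noteq> partner h a}"
proof (cases "h = 0")
  case True
  have "a = b" if "a < Suc (Suc 0)" "b < Suc (Suc 0)" "b \<noteq> partner 0 a" for a b
    using that by (auto simp: partner_def less_Suc_eq)
  then have "{(a, b). a < 2 * h + 2 \<and> b < 2 * h + 2 \<and> a \<noteq> b \<and> b \<noteq> partner h a} = {}"
    using True by (auto simp del: One_nat_def)
  then show ?thesis unfolding True by (simp only: replicate_0 covers_Nil)
next
  case False
  let ?N = "2 * h + 1"
  let ?E = "\<lambda>c. {(a, b). a < ?N \<and> b < ?N \<and> a \<noteq> b \<and>
     ((a + b) mod ?N = 2 * c mod ?N \<or> (a + b) mod ?N = Suc (2 * c) mod ?N)} \<union>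
     {(c, ?N), (zigzag ?N c (?N - 1), ?N)}"
  have "covers (replicate h (Suc ?N)) {..<Suc ?N} (\<Union>c<h. ?E c)"
    by (intro covers_family covers_zigzag) simp
  from covers_sym[OF this] have covers: "covers (replicate h (Suc ?N)) {..<Suc ?N} ((\<Union>c<h. ?E c) \<union> (\<Union>c<h. ?E c)\<inverse>)"
    by simp
  have N: "(a, ?N) \<in> (\<Union>c<h. ?E c)" if "a < ?N" "a \<noteq> h" for a
  proof (cases "a < h")
    case True
    then show ?thesis by blast
  next
    case False
    have "zigzag ?N (a - Suc h) (2 * h) = a" using that False by (simp add: zigzag_def)
    then have "(a, ?N) \<in> ?E (a - Suc h)" by simp
    then show ?thesis using that False by (intro UN_I[of "a - Suc h"]) auto
  qed
  have "{(a, b). a < 2 * h + 2 \<and> b < 2 * h + 2 \<and> a \<noteq> b \<and> b \<noteq> partner h a}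
     \<subseteq> (\<Union>c<h. ?E c) \<union> (\<Union>c<h. ?E c)\<inverse>"
  proof
    fix e assume "e \<in> {(a, b). a < 2 * h + 2 \<and> b < 2 * h + 2 \<and> a \<noteq> b \<and> b \<noteq> partner h a}"
    then obtain a b where e: "e = (a, b)" "a < Suc ?N" "b < Suc ?N" "a \<noteq> b" "b \<noteq> partner h a"
      by auto
    then consider "a < ?N" "b < ?N" | "a < ?N" "b = ?N" | "b < ?N" "a = ?N" by linarith
    then show "e \<in> (\<Union>c<h. ?E c) \<union> (\<Union>c<h. ?E c)\<inverse>"
    proof cases
      case 1
      define s where "s = (a + b) mod ?N"
      have "s < ?N" by (simp add: s_def)
      \<comment> \<open>Two vertices below 2 h + 1 add up to at most 4 h, so this residue would mean
        a + b = 2 h, which is the partner relation.\<close>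
      moreover have "s \<noteq> 2 * h"
      proof
        assume s: "s = 2 * h"
        have "a + b < 2 * ?N" using 1 by simp
        then have "a + b = s \<or> a + b = s + ?N" unfolding s_def
          by (metis add.commute le_mod_geq linorder_not_less mod_less mult_2 less_diff_conv2 le_add_diff_inverse)
        then have "b = 2 * h - a" using s 1 by auto
        then show False using e(4,5) 1 by (auto simp: partner_def split: if_splits)
      qed
      ultimately have "s div 2 < h" "s = 2 * (s div 2) \<or> s = Suc (2 * (s div 2))" by presburger+
      then have "(a + b) mod ?N = 2 * (s div 2) mod ?N \<or> (a + b) mod ?N = Suc (2 * (s div 2)) mod ?N"
        unfolding s_def by (metis mod_mod_trivial)
      then have "(a, b) \<in> ?E (s div 2)" using e(4) 1 by simp
      then show ?thesis using \<open>s div 2 < h\<close> e(1) by blast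
    next
      case 2
      then have "a \<noteq> h" using e(5) by (auto simp: partner_def)
      then show ?thesis using N[OF 2(1)] e(1) 2 by blast
    next
      case 3
      then have "b \<noteq> h" using e(5) by (auto simp: partner_def)
      then show ?thesis using N[OF 3(1)] e(1) 3 by blast
    qed
  qed
  from covers_mono[OF covers this] have "covers (replicate h (Suc ?N)) {..<Suc ?N}
    {(a, b). a < 2 * h + 2 \<and> b < 2 * h + 2 \<and> a \<noteq> b \<and> b \<noteq> partner h a}" .
  moreover have "Suc ?N = 2 * h + 2" by simp
  ultimately show ?thesis by (simp only:)
qed

lemma covers_partner_matching:
  "covers [2] {..<2 * h + 2} {(a, partner h a) | a. a < 2 * h + 2}"
proof (rule covers_singleI[where J = "{..<Suc h}" and \<phi> = "\<lambda>j k. if k = 0 then j else partner h j"])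
  have inv: "partner h a \<le> h \<and> partner h (partner h a) = a" if "h < a" "a < 2 * h + 2" for a
    using that by (auto simp: partner_def)
  {
    fix v assume "v \<in> {..<2 * h + 2}"
    then show "\<exists>j\<in>{..<Suc h}. \<exists>k<2::nat. (if k = 0 then j else partner h j) = v"
    proof (cases "v \<le> h")
      case True
      then show ?thesis by (intro bexI[of _ v] exI[of _ 0]) auto
    next
      case False
      then show ?thesis using inv[of v] \<open>v \<in> _\<close>
        by (intro bexI[of _ "partner h v"] exI[of _ 1]) auto
    qed
  next
    fix u w assume "(u, w) \<in> {(a, partner h a) | a. a < 2 * h + 2}"
    then have uw: "w = partner h u" "u < 2 * h + 2" by auto
    show "\<exists>j\<in>{..<Suc h}. \<exists>k<2::nat. ((if k = 0 then j else partner h j) = u \<and>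
        (if Suc k mod 2 = 0 then j else partner h j) = w) \<or>
        ((if k = 0 then j else partner h j) = w \<and> (if Suc k mod 2 = 0 then j else partner h j) = u)"
    proof (cases "u \<le> h")
      case True
      then show ?thesis using uw by (intro bexI[of _ u] exI[of _ 0]) auto
    next
      case False
      then show ?thesis using inv[of u] uw
        by (intro bexI[of _ w] exI[of _ 0]) auto
    qed
  }
qed auto

section \<open>1-factorizations of complete graphs of even order\<close>

lemma covers_even_cycle_matchings:
  assumes "d > 0"
  shows "covers (replicate 2 2) {..<2 * d} {(i, Suc i mod (2 * d)) | i. i < 2 * d}"
proof -
  let ?E = "\<lambda>r. {(i, Suc i mod (2 * d)) | i. i < 2 * d \<and> i mod 2 = r}"
  have "covers [2] {..<2 * d} (?E r)" if "r < 2" for r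
  proof (rule covers_singleI[where J = "{..<d}" and \<phi> = "\<lambda>j k. (2 * j + r + k) mod (2 * d)"])
    fix v assume v: "v \<in> {..<2 * d}"
    show "\<exists>j\<in>{..<d}. \<exists>k<2. (2 * j + r + k) mod (2 * d) = v"
    proof -
      obtain c where c: "c < 2 * d" "(c + r) mod (2 * d) = v"
        using mod_add_surj[of v "2 * d" r] v by auto
      have "c = 2 * (c div 2) + c mod 2" by simp
      then have "(2 * (c div 2) + r + c mod 2) mod (2 * d) = v"
        using c(2) by (metis add.assoc add.commute)
      then show ?thesis using c(1) by (intro bexI[of _ "c div 2"] exI[of _ "c mod 2"]) auto
    qed
  next
    fix u w assume "(u, w) \<in> ?E r"
    then have uw: "w = Suc u mod (2 * d)" "u < 2 * d" "u mod 2 = r" by auto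
    have "2 * (u div 2) + r = u" using uw(3) by (metis mult_div_mod_eq)
    then show "\<exists>j\<in>{..<d}. \<exists>k<2. ((2 * j + r + k) mod (2 * d) = u \<and>
        (2 * j + r + Suc k mod 2) mod (2 * d) = w) \<or>
        ((2 * j + r + k) mod (2 * d) = w \<and> (2 * j + r + Suc k mod 2) mod (2 * d) = u)"
      using uw by (intro bexI[of _ "u div 2"] exI[of _ 0]) auto
  qed auto
  then have "covers (replicate 2 2) {..<2 * d} (\<Union>r<2. ?E r)" by (rule covers_family)
  then show ?thesis
  proof (rule covers_mono, clarify)
    fix i assume "i < 2 * d"
    then show "(i, Suc i mod (2 * d)) \<in> (\<Union>r<2. ?E r)" by (intro UN_I[of "i mod 2"]) auto
  qed
qed

text \<open>The Walecki cycles have even length, so each splits into two matchings; the partner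
  matching completes them. One matching is kept apart so that it can carry the exceptional
  piece.\<close>

lemma covers_one_factorization:
  "\<exists>E1 E2. covers [2] {..<2 * h + 2} E1 \<and> covers (replicate (2 * h) 2) {..<2 * h + 2} E2 \<and>
     distinct_pairs {..<2 * h + 2} \<subseteq> E1 \<union> E2"
proof (intro exI conjI)
  have "covers (replicate 2 2) {..<2 * h + 2} {(i, Suc i mod (2 * h + 2)) | i. i < 2 * h + 2}"
    using covers_even_cycle_matchings[of "Suc h"] by simp
  from covers_refine[OF covers_walecki_even this]
  show "covers (replicate (2 * h) 2) {..<2 * h + 2}
     {(a, b). a < 2 * h + 2 \<and> b < 2 * h + 2 \<and> a \<noteq> b \<and> b \<noteq> partner h a}"
    by (simp only: mult.commute)
  show "distinct_pairs {..<2 * h + 2} \<subseteq> {(a, partner h a) | a. a < 2 * h + 2} \<union>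
     {(a, b). a < 2 * h + 2 \<and> b < 2 * h + 2 \<and> a \<noteq> b \<and> b \<noteq> partner h a}"
    unfolding distinct_pairs_def by auto
qed (rule covers_partner_matching)

text \<open>Walecki's cycles on two groups of x vertices, relabelled by \<open>g\<close> (with
  inverse \<open>p\<close>) so that the missed 1-factor is exactly the class 0 between the groups.
  All edges inside both groups are thus covered.\<close>

lemma covers_walecki_pairs:
  assumes "x > 0"
  shows "covers (replicate (x - 1) (2 * x)) ({..<2::nat} \<times> {..<x})
    {((b, i), (c, j)) | b i c j. b < 2 \<and> i < x \<and> c < 2 \<and> j < x \<and> i \<noteq> j}"
proof -
  define h where "h = x - 1"
  have x: "x = Suc h" using assms by (simp add: h_def)
  define g :: "nat \<Rightarrow> nat \<times> nat" where "g v = (if v \<le> h then (0, v) else (1, partner h v))" for v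
  define p where "p b i = (if b = 0 then i else partner h i)" for b i :: nat
  let ?V = "{..<2::nat} \<times> {..<x}"
  have p: "p b i < 2 * h + 2" "g (p b i) = (b, i)" if "b < 2" "i < x" for b i
    using that x by (auto simp: p_def g_def partner_def)
  have sub: "?V \<subseteq> g ` {..<2 * h + 2}"
  proof
    fix v assume "v \<in> ?V"
    then obtain b i where "v = (b, i)" "b < 2" "i < x" by auto
    then show "v \<in> g ` {..<2 * h + 2}" using p[of b i] by (metis imageI lessThan_iff)
  qed
  have card: "card ?V = card {..<2 * h + 2}" using x by (simp add: card_cartesian_product)
  have le: "card (g ` {..<2 * h + 2}) \<le> card {..<2 * h + 2}" by (rule card_image_le) simp
  then have eq: "g ` {..<2 * h + 2} = ?V" using card_seteq[OF _ sub] card by simp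
  then have inj: "inj_on g {..<2 * h + 2}" using card by (intro eq_card_imp_inj_on) auto
  have "{((b, i), (c, j)) | b i c j. b < 2 \<and> i < x \<and> c < 2 \<and> j < x \<and> i \<noteq> j} \<subseteq> map_prod g g `
     {(a, b). a < 2 * h + 2 \<and> b < 2 * h + 2 \<and> a \<noteq> b \<and> b \<noteq> partner h a}" (is "_ \<subseteq> _ ` ?E")
  proof clarify
    fix b i c j :: nat assume *: "b < 2" "i < x" "c < 2" "j < x" "i \<noteq> j"
    have "p b i \<noteq> p c j" using p(2)[OF *(1,2)] p(2)[OF *(3,4)] *(5) by auto
    moreover have "p c j \<noteq> partner h (p b i)"
      using * x by (auto simp: p_def partner_def split: if_splits)
    ultimately have "(p b i, p c j) \<in> ?E" using p(1)[OF *(1,2)] p(1)[OF *(3,4)] by simp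
    from imageI[OF this, of "map_prod g g"]
    show "((b, i), (c, j)) \<in> map_prod g g ` ?E" using p(2)[OF *(1,2)] p(2)[OF *(3,4)] by simp
  qed
  moreover have "covers (replicate h (2 * h + 2)) ?V (map_prod g g ` ?E)"
    using covers_image[OF covers_walecki_even inj] eq by simp
  ultimately have "covers (replicate h (2 * h + 2)) ?V
     {((b, i), (c, j)) | b i c j. b < 2 \<and> i < x \<and> c < 2 \<and> j < x \<and> i \<noteq> j}" by (rule covers_mono[rotated])
  moreover have "h = x - 1" "2 * h + 2 = 2 * x" using x by auto
  ultimately show ?thesis by (simp only:)
qed

section \<open>Placing patterns on chosen groups\<close>

definition regroup :: "nat list \<Rightarrow> nat \<times> 'b \<Rightarrow> nat \<times> 'b" where
  "regroup gs = (\<lambda>(b, i). (gs ! b, i))"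

lemma covers_regroup:
  assumes "covers ns ({..<k} \<times> Y) B" "distinct gs" "length gs = k"
  shows "covers ns (set gs \<times> Y) (map_prod (regroup gs) (regroup gs) ` B)"
proof -
  have "inj_on (regroup gs) ({..<k} \<times> Y)"
    using assms(2,3) by (auto simp: regroup_def inj_on_def nth_eq_iff_index_eq)
  moreover have "regroup gs ` ({..<k} \<times> Y) = set gs \<times> Y"
  proof (intro set_eqI iffI)
    fix v assume "v \<in> set gs \<times> Y"
    then obtain b i where "v = (gs ! b, i)" "b < k" "i \<in> Y"
      using assms(3) by (auto simp: in_set_conv_nth)
    then show "v \<in> regroup gs ` ({..<k} \<times> Y)"
      by (intro image_eqI[of _ _ "(b, i)"]) (auto simp: regroup_def)
  qed (use assms(3) in \<open>auto simp: regroup_def\<close>)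
  ultimately show ?thesis using covers_image[OF assms(1)] by metis
qed

lemma regroupI:
  "((b, i), (c, j)) \<in> B \<Longrightarrow> ((gs ! b, i), (gs ! c, j)) \<in> map_prod (regroup gs) (regroup gs) ` B"
  by (force simp: regroup_def)

lemma covers_three_pairs:
  assumes "covers ns ({..<2} \<times> Y) B" "distinct [p, q, p', q', p'', q'']"
    "{p, q, p', q', p'', q''} = {..<6}"
  shows "covers ns ({..<6} \<times> Y)
    (\<Union>gs\<in>{[p, q], [p', q'], [p'', q'']}. map_prod (regroup gs) (regroup gs) ` B)"
proof -
  let ?R = "\<lambda>gs. map_prod (regroup gs) (regroup gs) ` B"
  have *: "covers ns (set gs \<times> Y) (?R gs)" if "gs \<in> {[p, q], [p', q'], [p'', q'']}" for gs
    using that assms(2) by (intro covers_regroup[OF assms(1)]) auto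
  have "covers ns ((set [p, q] \<times> Y \<union> set [p', q'] \<times> Y) \<union> set [p'', q''] \<times> Y)
     ((?R [p, q] \<union> ?R [p', q']) \<union> ?R [p'', q''])"
    using assms(2) by (intro covers_Un *) auto
  moreover have "(set [p, q] \<times> Y \<union> set [p', q'] \<times> Y) \<union> set [p'', q''] \<times> Y = {..<6} \<times> Y"
    unfolding assms(3)[symmetric] by auto
  ultimately show ?thesis by (simp add: Un_assoc)
qed

text \<open>A closed walk through four groups that advances by \<open>2\<close> in the cyclic group of even order \<open>x\<close>
  lifts to two cycles of length \<open>4 (x / 2)\<close>.\<close>

lemma covers_four_walk:
  assumes "x = 2 * y" "y > 0" "off 0 = 0"
  shows "covers [2 * x] ({..<4::nat} \<times> {..<x})
    ({((r, (a + off r) mod x), (Suc r, (a + off (Suc r)) mod x)) | r a. r < 3 \<and> a < x} \<union>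
     {((3, (a + off 3) mod x), (0, (a + 2) mod x)) | a. a < x})"
proof -
  \<comment> \<open>One turn through the four groups adds 2, and x is even, so the parity of the
    value in group 0 never changes: the starting values 0 and 1 give two disjoint cycles.\<close>
  define \<phi> where "\<phi> j l = (l mod 4, (2 * (l div 4) + j + off (l mod 4)) mod x)" for j l :: nat
  have \<phi>: "\<phi> (a mod 2) (4 * (a div 2) + r) = (r, (a + off r) mod x)" if "r < 4" for a r
  proof -
    have "(4 * (a div 2) + r) mod 4 = r" "(4 * (a div 2) + r) div 4 = a div 2" using that by auto
    then show ?thesis unfolding \<phi>_def by simp
  qed
  have l: "4 * (a div 2) + r < 2 * x" if "a < x" "r < 4" for a r
  proof -
    have "a div 2 < y" using that assms(1) by simp
    then show ?thesis using that assms(1) by linarith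
  qed
  show ?thesis
  proof (rule covers_singleI[where J = "{..<2}" and \<phi> = \<phi>])
    fix v assume "v \<in> {..<4::nat} \<times> {..<x}"
    then obtain r i where v: "v = (r, i)" "r < 4" "i < x" by auto
    obtain a where "a < x" "(a + off r) mod x = i" by (rule mod_add_surj[OF v(3)])
    then show "\<exists>j\<in>{..<2}. \<exists>k<2 * x. \<phi> j k = v" using v \<phi>[OF v(2), of a] l[of a r]
      by (intro bexI[of _ "a mod 2"] exI[of _ "4 * (a div 2) + r"]) auto
  next
    fix u w assume "(u, w) \<in> {((r, (a + off r) mod x), (Suc r, (a + off (Suc r)) mod x)) | r a. r < 3 \<and> a < x} \<union>
     {((3, (a + off 3) mod x), (0, (a + 2) mod x)) | a. a < x}"
    then consider r a where "r < 3" "a < x" "u = (r, (a + off r) mod x)" "w = (Suc r, (a + off (Suc r)) mod x)"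
      | a where "a < x" "u = (3, (a + off 3) mod x)" "w = (0, (a + 2) mod x)" by blast
    then have "\<exists>j\<in>{..<2}. \<exists>k<2 * x. \<phi> j k = u \<and> \<phi> j (Suc k mod (2 * x)) = w"
    proof cases
      case 1
      have "Suc (4 * (a div 2) + r) mod (2 * x) = 4 * (a div 2) + Suc r"
        using l[of a "Suc r"] 1 by simp
      then show ?thesis using 1 \<phi>[of r a] \<phi>[of "Suc r" a] l[of a r]
        by (intro bexI[of _ "a mod 2"] exI[of _ "4 * (a div 2) + r"]) auto
    next
      case 2
      have "\<phi> (a mod 2) (Suc (4 * (a div 2) + 3) mod (2 * x)) = (0, (a + 2) mod x)"
      proof (cases "a + 2 < x")
        case True
        have "Suc (4 * (a div 2) + 3) = 4 * ((a + 2) div 2) + 0" by simp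
        moreover have "\<dots> < 2 * x" using l[OF True, of 0] by simp
        ultimately have "Suc (4 * (a div 2) + 3) mod (2 * x) = 4 * ((a + 2) div 2) + 0" by simp
        moreover have "(a + 2) mod 2 = a mod 2" by simp
        ultimately show ?thesis using \<phi>[of 0 "a + 2"] assms(3) by simp
      next
        case False
        then have "a div 2 = y - 1" and a: "a + 2 = x + a mod 2" using 2 assms(1,2) by presburger+
        moreover have "(x + a mod 2) mod x = a mod 2" using assms(1,2) by simp
        then have m: "(a + 2) mod x = a mod 2" by (simp only: a)
        moreover have "Suc (4 * (y - 1) + 3) = 2 * x" using assms(1,2) by simp
        ultimately have "Suc (4 * (a div 2) + 3) mod (2 * x) = 0" by simp
        moreover have "\<phi> (a mod 2) 0 = (0, a mod 2)" unfolding \<phi>_def using assms by simp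
        ultimately show ?thesis using m by simp
      qed
      then show ?thesis using 2 \<phi>[of 3 a] l[of a 3]
        by (intro bexI[of _ "a mod 2"] exI[of _ "4 * (a div 2) + 3"]) auto
    qed
    then show "\<exists>j\<in>{..<2}. \<exists>k<2 * x. \<phi> j k = u \<and> \<phi> j (Suc k mod (2 * x)) = w \<or>
        \<phi> j k = w \<and> \<phi> j (Suc k mod (2 * x)) = u" by blast
  qed (use assms in auto)
qed

section \<open>Even cycle parameter\<close>

text \<open>A triple (p, q, s) stands for the x edges from group p to group q with difference s.
  Reading it backwards negates s, so the direction matters; class 0 may be listed either
  way.\<close>

definition classes :: "nat \<Rightarrow> (nat \<times> nat \<times> nat) set \<Rightarrow> ((nat \<times> nat) \<times> (nat \<times> nat)) set" where
  "classes x T = {((p, i), (q, (i + s) mod x)) | p q s i. i < x \<and> (p, q, s) \<in> T}"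

lemma classesI: "(p, q, s) \<in> T \<Longrightarrow> i < x \<Longrightarrow> ((p, i), (q, (i + s) mod x)) \<in> classes x T"
  unfolding classes_def by blast

lemma covers_four_walk_classes:
  assumes "x = 2 * y" "y > 0" "s0 + s1 + s2 + s3 = 2"
  shows "covers [2 * x] ({..<4::nat} \<times> {..<x}) (classes x {(0, 1, s0), (1, 2, s1), (2, 3, s2), (3, 0, s3)})"
proof -
  \<comment> \<open>Partial sums of the differences along the walk. The total 2 makes the last class
    lead to the start of the next turn.\<close>
  define off where "off r = (if r = 0 then 0 else if r = 1 then s0 else if r = 2 then s0 + s1
    else s0 + s1 + s2)" for r :: nat
  let ?E = "{((r, (a + off r) mod x), (Suc r, (a + off (Suc r)) mod x)) | r a. r < 3 \<and> a < x} \<union>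
     {((3, (a + off 3) mod x), (0, (a + 2) mod x)) | a. a < x}"
  have "covers [2 * x] ({..<4::nat} \<times> {..<x}) ?E"
    by (rule covers_four_walk[OF assms(1,2)]) (simp add: off_def)
  then show ?thesis
  proof (rule covers_mono)
    show "classes x {(0, 1, s0), (1, 2, s1), (2, 3, s2), (3, 0, s3)} \<subseteq> ?E"
    proof
      fix e assume "e \<in> classes x {(0, 1, s0), (1, 2, s1), (2, 3, s2), (3, 0, s3)}"
      then obtain p q s i where e: "e = ((p, i), (q, (i + s) mod x))" "i < x"
        "(p, q, s) \<in> {(0, 1, s0), (1, 2, s1), (2, 3, s2), (3, 0, s3)}"
        unfolding classes_def by blast
      obtain a where a: "a < x" "(a + off p) mod x = i" by (rule mod_add_surj[OF e(2)])
      have i: "(i + s) mod x = (a + off p + s) mod x" using a(2) by (metis mod_add_left_eq)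
      show "e \<in> ?E"
      proof (cases "p = 3")
        case True
        then have "q = 0" "off p + s = 2" using e(3) assms(3) by (auto simp: off_def)
        then have "e = ((3, (a + off 3) mod x), (0, (a + 2) mod x))"
          using e(1) i a(2) True by (simp add: add.assoc)
        then show ?thesis using a(1) by blast
      next
        case False
        then have "p < 3" "q = Suc p" "off p + s = off (Suc p)" using e(3) by (auto simp: off_def)
        then have "e = ((p, (a + off p) mod x), (Suc p, (a + off (Suc p)) mod x))"
          using e(1) i a(2) by (simp add: add.assoc)
        then show ?thesis using a(1) \<open>p < 3\<close> by blast
      qed
    qed
  qed
qed

lemma classes_regroup:
  "classes x ((\<lambda>(p, q, s). (gs ! p, gs ! q, s)) ` T) \<subseteq>
    map_prod (regroup gs) (regroup gs) ` classes x T"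
proof
  fix e assume "e \<in> classes x ((\<lambda>(p, q, s). (gs ! p, gs ! q, s)) ` T)"
  then obtain p q s i where e: "e = ((gs ! p, i), (gs ! q, (i + s) mod x))" "i < x" "(p, q, s) \<in> T"
    unfolding classes_def by auto
  from regroupI[OF classesI[OF e(3,2)], of gs] show "e \<in> map_prod (regroup gs) (regroup gs) ` classes x T"
    using e(1) by simp
qed

lemma classes_Un: "classes x (S \<union> T) = classes x S \<union> classes x T"
  unfolding classes_def by blast

lemma covers_bip_shift_classes: "x > 0 \<Longrightarrow> covers [2 * x] ({..<2::nat} \<times> {..<x}) (classes x {(0, 1, 0), (0, 1, 1)})"
  by (rule covers_mono[OF covers_bip_shift[of x 0]]) (auto simp: classes_def)

text \<open>The walk occupies four of the six groups; the two groups left out are filled by the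
  cycle formed from their classes 0 and 1.\<close>

lemma covers_walk_and_pair:
  assumes "x = 2 * y" "y > 0" "s0 + s1 + s2 + s3 = 2"
    and "distinct [u0, u1, u2, u3, w0, w1]" "{u0, u1, u2, u3, w0, w1} = {..<6}"
  shows "covers [2 * x] ({..<6::nat} \<times> {..<x})
    (classes x {(u0, u1, s0), (u1, u2, s1), (u2, u3, s2), (u3, u0, s3), (w0, w1, 0), (w0, w1, 1)})"
proof -
  let ?u = "[u0, u1, u2, u3]" let ?w = "[w0, w1]"
  let ?A = "{(0, 1, s0), (1, 2, s1), (2, 3, s2), (3, 0, s3)}" let ?B = "{(0, 1, 0), (0, 1, 1)}"
  let ?RA = "(\<lambda>(p, q, s). (?u ! p, ?u ! q, s)) ` ?A"
  let ?RB = "(\<lambda>(p, q, s). (?w ! p, ?w ! q, s)) ` ?B"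
  have "x > 0" using assms by simp
  have "covers [2 * x] (set ?u \<times> {..<x}) (classes x ?RA)"
    using assms(4) by (intro covers_mono[OF covers_regroup[OF covers_four_walk_classes[OF assms(1-3)]] classes_regroup]) auto
  moreover have "covers [2 * x] (set ?w \<times> {..<x}) (classes x ?RB)"
    using assms(4) by (intro covers_mono[OF covers_regroup[OF covers_bip_shift_classes[OF \<open>x > 0\<close>]] classes_regroup]) auto
  moreover have "(set ?u \<times> {..<x}) \<inter> (set ?w \<times> {..<x}) = {}" using assms(4) by auto
  ultimately have "covers [2 * x] (set ?u \<times> {..<x} \<union> set ?w \<times> {..<x}) (classes x ?RA \<union> classes x ?RB)"
    by (rule covers_Un)
  moreover have "set ?u \<times> {..<x} \<union> set ?w \<times> {..<x} = {..<6} \<times> {..<x}"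
    unfolding assms(5)[symmetric] by auto
  moreover have "classes x ?RA \<union> classes x ?RB = classes x
    {(u0, u1, s0), (u1, u2, s1), (u2, u3, s2), (u3, u0, s3), (w0, w1, 0), (w0, w1, 1)}"
    unfolding classes_Un[symmetric] by (simp add: insert_commute numeral_2_eq_2 numeral_3_eq_3)
  ultimately show ?thesis by (simp only:)
qed

lemma covers_three_pairs_classes:
  assumes "covers ns ({..<2} \<times> {..<x}) (classes x ({0} \<times> {1} \<times> S))"
    and "distinct [p, q, p', q', p'', q'']" "{p, q, p', q', p'', q''} = {..<6}"
  shows "covers ns ({..<6} \<times> {..<x}) (classes x ({p} \<times> {q} \<times> S \<union> {p'} \<times> {q'} \<times> S \<union> {p''} \<times> {q''} \<times> S))"
proof (rule covers_mono[OF covers_three_pairs[OF assms]])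
  have *: "classes x ({a} \<times> {b} \<times> S) \<subseteq>
    map_prod (regroup [a, b]) (regroup [a, b]) ` classes x ({0} \<times> {1} \<times> S)" for a b
  proof -
    have "{a} \<times> {b} \<times> S = (\<lambda>(p, q, s). ([a, b] ! p, [a, b] ! q, s)) ` ({0} \<times> {1} \<times> S)"
      by force
    then show ?thesis using classes_regroup by metis
  qed
  show "classes x ({p} \<times> {q} \<times> S \<union> {p'} \<times> {q'} \<times> S \<union> {p''} \<times> {q''} \<times> S) \<subseteq>
    (\<Union>gs\<in>{[p, q], [p', q'], [p'', q'']}. map_prod (regroup gs) (regroup gs) ` classes x ({0} \<times> {1} \<times> S))"
    unfolding classes_Un using *[of p q] *[of p' q'] *[of p'' q''] by simp blast
qed

lemma covers_group_hexagons:
  "covers [6] ({..<6::nat} \<times> {..<x})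
     (classes x {(0, 1, 0), (1, 2, 0), (2, 3, 0), (3, 4, 0), (4, 5, 0), (5, 0, 0)})"
proof (rule covers_singleI[where J = "{..<x}" and \<phi> = "\<lambda>i k. (k, i)"])
  fix u w assume "(u, w) \<in> classes x {(0, 1, 0), (1, 2, 0), (2, 3, 0), (3, 4, 0), (4, 5, 0), (5, 0, 0)}"
  then obtain p q i where uw: "u = (p, i)" "w = (q, i)" "i < x"
    "(p, q) \<in> {(0, 1), (1, 2), (2, 3), (3, 4), (4, 5), (5, 0)}"
    unfolding classes_def by auto
  then have "q = Suc p mod 6" "p < 6" by auto
  then show "\<exists>j\<in>{..<x}. \<exists>k<6. ((k, j) = u \<and> (Suc k mod 6, j) = w) \<or> ((k, j) = w \<and> (Suc k mod 6, j) = u)"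
    using uw by (intro bexI[of _ i] exI[of _ p]) auto
qed auto

lemma covers_group_matching:
  "covers [2] ({..<2::nat} \<times> {..<x}) (classes x ({0} \<times> {1} \<times> {s}))"
proof (rule covers_singleI[where J = "{..<x}" and \<phi> = "\<lambda>i k. if k = 0 then (0, i) else (1, (i + s) mod x)"])
  fix v assume "v \<in> {..<2::nat} \<times> {..<x}"
  then obtain b i where v: "v = (b, i)" "b < 2" "i < x" by auto
  obtain c where c: "c < x" "(c + s) mod x = i" by (rule mod_add_surj[OF v(3)])
  show "\<exists>j\<in>{..<x}. \<exists>k<2::nat. (if k = 0 then (0, j) else (1, (j + s) mod x)) = v"
  proof (cases "b = 0")
    case True
    then show ?thesis using v by (intro bexI[of _ i] exI[of _ 0]) auto
  next
    case False
    then show ?thesis using v c by (intro bexI[of _ c] exI[of _ 1]) auto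
  qed
next
  fix u w :: "nat \<times> nat" assume "(u, w) \<in> classes x ({0} \<times> {1} \<times> {s})"
  then obtain i where "u = (0, i)" "w = (1, (i + s) mod x)" "i < x" unfolding classes_def by auto
  then show "\<exists>j\<in>{..<x}. \<exists>k<2::nat. ((if k = 0 then (0, j) else (1, (j + s) mod x)) = u \<and>
      (if Suc k mod 2 = 0 then (0, j) else (1, (j + s) mod x)) = w) \<or>
      ((if k = 0 then (0, j) else (1, (j + s) mod x)) = w \<and>
      (if Suc k mod 2 = 0 then (0, j) else (1, (j + s) mod x)) = u)"
    by (intro bexI[of _ i] exI[of _ 0]) auto
qed auto

text \<open>As x - 2 is even, these classes pair up; 0 and 1 are held back for the hexagons, the
  1-factor and the walks.\<close>

lemma covers_upper_classes:
  assumes "x = 2 * y" "y > 0"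
  shows "covers (replicate (y - 1) (2 * x)) ({..<2::nat} \<times> {..<x}) (classes x ({0} \<times> {1} \<times> {2..<x}))"
proof -
  have "x > 0" "2 + 2 * (y - 1) = x" using assms by auto
  then show ?thesis
    by (intro covers_mono[OF covers_bip_classes[of x "y - 1" 2]]) (auto simp: classes_def)
qed

lemma lessThan_6: "{..<6::nat} = {0, 1, 2, 3, 4, 5}"
  by auto

text \<open>The six groups carry the 1-factorization \<open>{01, 23, 45}\<close>, \<open>{12, 34, 50}\<close>, \<open>{13, 25, 40}\<close>,
  \<open>{02, 35, 14}\<close>, \<open>{03, 15, 24}\<close> of \<open>K\<^sub>6\<close>. The first two form the hexagons and the third contains the
  1-factor; the fourth, together with the edges inside the groups, is covered by Walecki cycles up to
  the class \<open>0\<close>. What remains of odd size is absorbed by three factors, each of which combines a walk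
  through four groups (one class of each of the first four factors) with the remaining pair.\<close>

lemma covers_base_even:
  assumes "x = 2 * y" "y > 0"
  shows "covers (2 # 6 # replicate (3 * x - 2) (2 * x)) ({..<6::nat} \<times> {..<x}) (distinct_pairs ({..<6} \<times> {..<x}))"
proof -
  let ?V = "{..<6::nat} \<times> {..<x}"
  have x: "x > 0" using assms by simp
  let ?M = "\<lambda>(p :: nat) (q :: nat) p' q' p'' q'' (S :: nat set). {p} \<times> {q} \<times> S \<union> {p'} \<times> {q'} \<times> S \<union> {p''} \<times> {q''} \<times> S"
  \<comment> \<open>Each of \<open>T3\<close>, \<open>T4\<close>, \<open>T5\<close> takes class 1
    once from each of the first two matchings and class 0 once from each of the third and fourth, so
    every walk advances by 2. The three factors serve the three pairs of each matching.\<close>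
  define T1 T2 T3 T4 T5 :: "(nat \<times> nat \<times> nat) set" where
    "T1 = ?M 1 3 4 0 2 5 {1}" and
    "T2 = {(0, 1, 0), (1, 2, 0), (2, 3, 0), (3, 4, 0), (4, 5, 0), (5, 0, 0)}" and
    "T3 = {(0, 1, 1), (1, 3, 0), (3, 5, 0), (5, 0, 1), (2, 4, 0), (2, 4, 1)}" and
    "T4 = {(0, 2, 0), (2, 3, 1), (3, 4, 1), (4, 0, 0), (1, 5, 0), (1, 5, 1)}" and
    "T5 = {(1, 2, 1), (2, 5, 0), (5, 4, 1), (4, 1, 0), (0, 3, 0), (0, 3, 1)}"
  \<comment> \<open>The pairs 35, 02 and 41 are absent: their nonzero classes belong to the Walecki
    cycles in \<open>W\<close>, together with the edges inside the groups.\<close>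
  define U where "U = ?M 0 1 2 3 5 4 {2..<x} \<union> (?M 5 0 3 4 1 2 {2..<x} \<union>
    (?M 1 3 4 0 2 5 {2..<x} \<union> ?M 2 4 1 5 0 3 {2..<x}))"
  let ?D = "{((b, i), (c, j)) | b i c j. b < (2::nat) \<and> i < x \<and> c < 2 \<and> j < x \<and> i \<noteq> j}"
  define W where "W = (\<Union>gs\<in>{[3, 5], [0, 2], [4, 1]}. map_prod (regroup gs) (regroup gs) ` ?D)"
  have f1: "covers [2] ?V (classes x T1)"
    unfolding T1_def by (rule covers_three_pairs_classes[OF covers_group_matching]) (auto simp: lessThan_6)
  have f2: "covers [6] ?V (classes x T2)" unfolding T2_def by (rule covers_group_hexagons)
  have f3: "covers [2 * x] ?V (classes x T3)" unfolding T3_def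
    by (rule covers_walk_and_pair[OF assms]) (auto simp: lessThan_6)
  have f4: "covers [2 * x] ?V (classes x T4)" unfolding T4_def
    by (rule covers_walk_and_pair[OF assms]) (auto simp: lessThan_6)
  have f5: "covers [2 * x] ?V (classes x T5)" unfolding T5_def
    by (rule covers_walk_and_pair[OF assms]) (auto simp: lessThan_6)
  let ?n = "replicate (y - 1) (2 * x)"
  have fU: "covers (?n @ ?n @ ?n @ ?n) ?V (classes x U)"
    unfolding U_def classes_Un[of x "?M 0 1 2 3 5 4 {2..<x}"] classes_Un[of x "?M 5 0 3 4 1 2 {2..<x}"]
      classes_Un[of x "?M 1 3 4 0 2 5 {2..<x}"]
    by (intro covers_append covers_three_pairs_classes[OF covers_upper_classes[OF assms]]) (auto simp: lessThan_6)
  have fW: "covers (replicate (x - 1) (2 * x)) ?V W"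
    unfolding W_def by (rule covers_three_pairs[OF covers_walecki_pairs[OF x]]) (auto simp: lessThan_6)
  define E where "E = classes x T1 \<union> (classes x T2 \<union> (classes x T3 \<union> (classes x T4 \<union> (classes x T5 \<union>
    (classes x U \<union> W)))))"
  have "covers ([2] @ [6] @ [2 * x] @ [2 * x] @ [2 * x] @ (?n @ ?n @ ?n @ ?n) @ replicate (x - 1) (2 * x)) ?V E"
    unfolding E_def by (intro covers_append f1 f2 f3 f4 f5 fU fW)
  moreover have "[2] @ [6] @ [2 * x] @ [2 * x] @ [2 * x] @ (?n @ ?n @ ?n @ ?n) @ replicate (x - 1) (2 * x)
    = 2 # 6 # replicate (3 * x - 2) (2 * x)"
  proof -
    have "[2 * x] @ [2 * x] @ [2 * x] @ (?n @ ?n @ ?n @ ?n) @ replicate (x - 1) (2 * x)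
      = replicate (1 + (1 + (1 + ((y - 1) + ((y - 1) + ((y - 1) + (y - 1))) + (x - 1))))) (2 * x)"
      by (simp only: replicate_add One_nat_def replicate_Suc replicate_0)
    \<comment> \<open>The count is 3 + 4 (y - 1) + (x - 1) with x = 2 y.\<close>
    also have "1 + (1 + (1 + ((y - 1) + ((y - 1) + ((y - 1) + (y - 1))) + (x - 1)))) = 3 * x - 2"
      using assms by simp
    finally show ?thesis by (simp only: append_Cons append_Nil)
  qed
  ultimately have "covers (2 # 6 # replicate (3 * x - 2) (2 * x)) ?V E" by (simp only:)
  note fE = covers_sym[OF this]
  define T where "T = T1 \<union> T2 \<union> T3 \<union> T4 \<union> T5 \<union> U"
  have T: "classes x T \<subseteq> E" unfolding E_def T_def classes_Un by blast
  have inW: "((p, i), (q, j)) \<in> W" if "gs \<in> {[3, 5], [0, 2], [4, 1]}" "p \<in> set gs" "q \<in> set gs"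
    "i < x" "j < x" "i \<noteq> j" for gs p q i j
  proof -
    from that(2) obtain b where b: "b < length gs" "p = gs ! b" by (auto simp: in_set_conv_nth)
    from that(3) obtain c where c: "c < length gs" "q = gs ! c" by (auto simp: in_set_conv_nth)
    have "length gs = 2" using that(1) by auto
    then have "((b, i), (c, j)) \<in> ?D" using that b c by simp
    from regroupI[OF this, of gs] show ?thesis unfolding W_def b(2) c(2) by (rule UN_I[OF that(1)])
  qed
  let ?O = "{(0, 1), (2, 3), (5, 4), (5, 0), (3, 4), (1, 2), (1, 3), (4, 0), (2, 5), (2, 4), (1, 5), (0, 3)}
    :: (nat \<times> nat) set"
  let ?P = "{(3, 5), (0, 2), (4, 1)} :: (nat \<times> nat) set"
  have cov: "((p, i), (q, j)) \<in> E \<union> E\<inverse>" if "(p, q) \<in> ?O" "i < x" "j < x" for p q i j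
  proof -
    have j: "j < x" by (rule that(3))
    obtain s where "s < x" "(s + i) mod x = j" by (rule mod_add_surj[OF j])
    then have s: "s < x" "(i + s) mod x = j" by (simp_all add: add.commute)
    consider "s = 0" | "s = 1" | "s \<ge> 2" by linarith
    \<comment> \<open>The alternative is needed for the pair 54, which the hexagons traverse from 4
      to 5; in class 0 the direction is immaterial.\<close>
    then have "(p, q, s) \<in> T \<or> s = 0 \<and> (q, p, 0) \<in> T"
    proof cases
      case 1
      show ?thesis using that(1)
        by (elim insertE emptyE) (simp_all add: 1 T_def T2_def T3_def T4_def T5_def)
    next
      case 2
      show ?thesis using that(1)
        by (elim insertE emptyE) (simp_all add: 2 T_def T1_def T3_def T4_def T5_def)
    next
      case 3
      then have "s \<in> {2..<x}" using s by simp
      then have "(p, q, s) \<in> U" using that(1)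
        by (elim insertE emptyE) (simp_all add: U_def)
      then show ?thesis unfolding T_def by simp
    qed
    then show ?thesis
    proof (elim disjE conjE)
      assume "(p, q, s) \<in> T"
      from classesI[OF this that(2)] show ?thesis using T unfolding s(2) by blast
    next
      assume "s = 0" "(q, p, 0) \<in> T"
      moreover have "i = j" using s \<open>s = 0\<close> that(2) by simp
      ultimately have "((q, j), (p, i)) \<in> classes x T" using classesI[of q p 0 T i x] that(2) by simp
      then show ?thesis using T by blast
    qed
  qed
  have covP: "((p, i), (q, j)) \<in> E \<union> E\<inverse>" if "(p, q) \<in> ?P" "i < x" "j < x" for p q i j
  proof (cases "i = j")
    case True
    have "(p, q, 0) \<in> T" using that(1)
      by (elim insertE emptyE) (simp_all add: T_def T3_def T4_def T5_def)
    from classesI[OF this that(2)] have "((p, i), (q, j)) \<in> classes x T"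
      using True that(3) by simp
    then show ?thesis using T by blast
  next
    case False
    have "((p, i), (q, j)) \<in> W"
      using that False by (intro inW[of "[p, q]"]) auto
    then show ?thesis unfolding E_def by blast
  qed
  have "distinct_pairs ?V \<subseteq> E \<union> E\<inverse>"
  proof
    fix e assume "e \<in> distinct_pairs ?V"
    then obtain p i q j where e: "e = ((p, i), (q, j))" "p < 6" "q < 6" "i < x" "j < x" "(p, i) \<noteq> (q, j)"
      unfolding distinct_pairs_def by auto
    have "p \<in> {0, 1, 2, 3, 4, 5}" "q \<in> {0, 1, 2, 3, 4, 5}" using e by auto
    then have "p = q \<or> (p, q) \<in> ?O \<or> (q, p) \<in> ?O \<or> (p, q) \<in> ?P \<or> (q, p) \<in> ?P"
      by (elim insertE emptyE) simp_all
    then show "e \<in> E \<union> E\<inverse>"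
    proof (elim disjE)
      assume "p = q"
      have "\<exists>gs\<in>{[3, 5], [0, 2], [4, 1]}. p \<in> set gs" using \<open>p \<in> _\<close>
        by (elim insertE emptyE) simp_all
      then obtain gs where "gs \<in> {[3, 5], [0, 2], [4, 1]}" "p \<in> set gs" ..
      then have "((p, i), (q, j)) \<in> W" using \<open>p = q\<close> e by (intro inW[of gs]) simp_all
      then show ?thesis unfolding e(1) E_def by (intro UnI1 UnI2)
    next
      assume "(p, q) \<in> ?O"
      from cov[OF this e(4,5)] show ?thesis unfolding e(1) .
    next
      assume "(q, p) \<in> ?O"
      from cov[OF this e(5,4)] show ?thesis unfolding e(1) by (simp only: Un_iff converse_iff) argo
    next
      assume "(p, q) \<in> ?P"
      from covP[OF this e(4,5)] show ?thesis unfolding e(1) .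
    next
      assume "(q, p) \<in> ?P"
      from covP[OF this e(5,4)] show ?thesis unfolding e(1) by (simp only: Un_iff converse_iff) argo
    qed
  qed
  with fE show ?thesis by (rule covers_mono)
qed

section \<open>Odd cycle parameter\<close>

text \<open>A column consists of rows of two kinds. A row of the first kind lists, for each cycle of the
  factor, the vertex at which the cycle enters the column and the vertex at which it leaves, the two
  being consecutive on the cycle. A row of the second kind lists the vertices visited in the first
  and in the second turn of a cycle that runs twice around all columns.\<close>

type_synonym column = "(nat \<times> nat) list list \<times> (nat \<times> nat) list list"

text \<open>Each of the r + s rows describes one factor, with q cycles on the 2 q vertices of a
  column. A row has 2 q entries, so meeting every vertex means meeting it once. \<open>D\<close>
  lists edges inside the column, which only rows of the first kind can supply.\<close>

definition column_ok :: "nat \<Rightarrow> nat \<Rightarrow> nat \<Rightarrow> (nat \<times> nat) list \<Rightarrow> column \<Rightarrow> bool" where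
  "column_ok q r s D C \<longleftrightarrow> length (fst C) = r \<and> length (snd C) = s \<and>
     (\<forall>row\<in>set (fst C @ snd C). length row = q \<and>
        (\<forall>a\<in>set [0..<2 * q]. a \<in> set (map fst row @ map snd row))) \<and>
     (\<forall>(a, b)\<in>set D. (a, b) \<in> set (concat (fst C)) \<or> (b, a) \<in> set (concat (fst C)))"

text \<open>The edges from column \<open>X\<close> to the next column \<open>Y\<close>.
  \<open>twist\<close> marks the passage from the last column to the first, where a cycle running
  around twice changes between its first and its second turn.\<close>

definition links :: "bool \<Rightarrow> column \<Rightarrow> column \<Rightarrow> (nat \<times> nat) list" where
  "links twist X Y = concat (map (\<lambda>(u, w). zip (map snd u) (map fst w)) (zip (fst X) (fst Y))) @
     concat (map (\<lambda>(u, w). if twist then zip (map fst u) (map snd w) @ zip (map snd u) (map fst w)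
       else zip (map fst u) (map fst w) @ zip (map snd u) (map snd w)) (zip (snd X) (snd Y)))"

lemma links_cases:
  assumes "(a, b) \<in> set (links twist X Y)" "column_ok q r s D X" "column_ok q r s D Y"
  shows "(\<exists>f<r. \<exists>p<q. snd (fst X ! f ! p) = a \<and> fst (fst Y ! f ! p) = b) \<or>
    (\<exists>f<s. \<exists>p<q. if twist
      then fst (snd X ! f ! p) = a \<and> snd (snd Y ! f ! p) = b \<or> snd (snd X ! f ! p) = a \<and> fst (snd Y ! f ! p) = b
      else fst (snd X ! f ! p) = a \<and> fst (snd Y ! f ! p) = b \<or> snd (snd X ! f ! p) = a \<and> snd (snd Y ! f ! p) = b)"
proof -
  have len: "length (fst X) = r" "length (fst Y) = r" "length (snd X) = s" "length (snd Y) = s"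
    "\<And>f. f < r \<Longrightarrow> length (fst X ! f) = q" "\<And>f. f < r \<Longrightarrow> length (fst Y ! f) = q"
    "\<And>f. f < s \<Longrightarrow> length (snd X ! f) = q" "\<And>f. f < s \<Longrightarrow> length (snd Y ! f) = q"
    using assms(2,3) unfolding column_ok_def by auto
  have zipD: "\<exists>p<length xs. xs ! p = a \<and> ys ! p = b"
    if "(a, b) \<in> set (zip xs ys)" for xs ys :: "nat list"
    using that by (auto simp: set_zip)
  from assms(1) consider
    u w where "(u, w) \<in> set (zip (fst X) (fst Y))" "(a, b) \<in> set (zip (map snd u) (map fst w))"
  | u w where "(u, w) \<in> set (zip (snd X) (snd Y))"
      "(a, b) \<in> set (if twist then zip (map fst u) (map snd w) @ zip (map snd u) (map fst w)
       else zip (map fst u) (map fst w) @ zip (map snd u) (map snd w))"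
  proof -
    assume one: "\<And>u w. (u, w) \<in> set (zip (fst X) (fst Y)) \<Longrightarrow>
        (a, b) \<in> set (zip (map snd u) (map fst w)) \<Longrightarrow> thesis"
      and two: "\<And>u w. (u, w) \<in> set (zip (snd X) (snd Y)) \<Longrightarrow>
        (a, b) \<in> set (if twist then zip (map fst u) (map snd w) @ zip (map snd u) (map fst w)
          else zip (map fst u) (map fst w) @ zip (map snd u) (map snd w)) \<Longrightarrow> thesis"
    have conc: "\<exists>z\<in>set zs. e \<in> set (g z)" if "e \<in> set (concat (map g zs))" for e g zs
      using that by auto
    from assms(1)[unfolded links_def set_append Un_iff] show thesis
    proof
      assume "(a, b) \<in> set (concat (map (\<lambda>(u, w). zip (map snd u) (map fst w)) (zip (fst X) (fst Y))))"
      from conc[OF this] obtain z where z: "z \<in> set (zip (fst X) (fst Y))"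
        "(a, b) \<in> set ((\<lambda>(u, w). zip (map snd u) (map fst w)) z)" ..
      obtain u w where "z = (u, w)" by (cases z)
      then show thesis using z by (intro one[of u w]) simp_all
    next
      assume "(a, b) \<in> set (concat (map (\<lambda>(u, w). if twist
        then zip (map fst u) (map snd w) @ zip (map snd u) (map fst w)
        else zip (map fst u) (map fst w) @ zip (map snd u) (map snd w)) (zip (snd X) (snd Y))))"
      from conc[OF this] obtain z where z: "z \<in> set (zip (snd X) (snd Y))"
        "(a, b) \<in> set ((\<lambda>(u, w). if twist then zip (map fst u) (map snd w) @ zip (map snd u) (map fst w)
        else zip (map fst u) (map fst w) @ zip (map snd u) (map snd w)) z)" ..
      obtain u w where "z = (u, w)" by (cases z)
      then show thesis using z by (intro two[of u w]) simp_all
    qed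
  qed
  then show ?thesis
  proof cases
    case 1
    from 1(1) obtain f where f: "f < r" "u = fst X ! f" "w = fst Y ! f" using len by (auto simp: set_zip)
    from zipD[OF 1(2)] obtain p where "p < q" "snd (fst X ! f ! p) = a" "fst (fst Y ! f ! p) = b"
      using f len by auto
    then show ?thesis using f(1) by blast
  next
    case 2
    from 2(1) obtain f where f: "f < s" "u = snd X ! f" "w = snd Y ! f" using len by (auto simp: set_zip)
    have "\<exists>p<q. if twist
      then fst (u ! p) = a \<and> snd (w ! p) = b \<or> snd (u ! p) = a \<and> fst (w ! p) = b
      else fst (u ! p) = a \<and> fst (w ! p) = b \<or> snd (u ! p) = a \<and> snd (w ! p) = b"
      using 2(2) len(7,8)[OF f(1)] f(2,3)
      by (cases twist) (auto dest!: zipD)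
    then show ?thesis using f by blast
  qed
qed

text \<open>The last column has the even index x - 1 > 0 and is therefore a copy of
  \<open>C2\<close>. So the four inclusions for \<open>L\<close> include every passage between
  consecutive columns, for all odd x at once.\<close>

lemma covers_table:
  assumes x: "odd x" "x \<ge> 3" and ok: "column_ok q r s D C0" "column_ok q r s D C1" "column_ok q r s D C2"
    and L: "set L \<subseteq> set (links False C0 C1)" "set L \<subseteq> set (links False C1 C2)"
      "set L \<subseteq> set (links False C2 C1)" "set L \<subseteq> set (links True C2 C0)"
  shows "covers (replicate (r + s) (2 * x)) ({..<x} \<times> {..<2 * q})
    ({((i, a), (Suc i mod x, b)) | i a b. i < x \<and> (a, b) \<in> set L} \<union>
     {((i, a), (i, b)) | i a b. i < x \<and> (a, b) \<in> set D})"
proof -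
  define C where "C i = (if i = 0 then C0 else if odd i then C1 else C2)" for i :: nat
  have okC: "column_ok q r s D (C i)" for i using ok by (simp add: C_def)
  let ?V = "{..<x} \<times> {..<2 * q}"
  \<comment> \<open>Cycles of the first kind meet column i at positions 2 i and 2 i + 1, those of
    the second kind (\<psi>) at positions i and x + i.\<close>
  define \<phi> where "\<phi> f p k = (k div 2, (if even k then fst else snd) (fst (C (k div 2)) ! f ! p))"
    for f p k :: nat
  define \<psi> where "\<psi> f p k = (if k < x then (k, fst (snd (C k) ! f ! p)) else (k - x, snd (snd (C (k - x)) ! f ! p)))"
    for f p k :: nat
  define E where "E f = {(u, w). \<exists>p<q. \<exists>k<2 * x. \<phi> f p k = u \<and> \<phi> f p (Suc k mod (2 * x)) = w}" for f
  define F where "F f = {(u, w). \<exists>p<q. \<exists>k<2 * x. \<psi> f p k = u \<and> \<psi> f p (Suc k mod (2 * x)) = w}" for f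
  have row: "\<exists>p<q. fst (row ! p) = a \<or> snd (row ! p) = a"
    if "row \<in> set (fst (C i)) \<union> set (snd (C i))" "a < 2 * q" for row i a
  proof -
    have "length row = q" "a \<in> set (map fst row @ map snd row)"
      using okC[of i] that unfolding column_ok_def by auto
    then show ?thesis by (auto simp: in_set_conv_nth) (metis fst_conv snd_conv)+
  qed
  have "covers [2 * x] ?V (E f)" if f: "f < r" for f
  proof (rule covers_singleI[where J = "{..<q}" and \<phi> = "\<phi> f"])
    fix v assume "v \<in> ?V"
    then obtain i a where v: "v = (i, a)" "i < x" "a < 2 * q" by auto
    have "fst (C i) ! f \<in> set (fst (C i)) \<union> set (snd (C i))" using okC[of i] f by (auto simp: column_ok_def)
    from row[OF this v(3)] obtain p where p: "p < q" "fst (fst (C i) ! f ! p) = a \<or> snd (fst (C i) ! f ! p) = a"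
      by blast
    have "\<phi> f p (2 * i) = (i, fst (fst (C i) ! f ! p))" "\<phi> f p (2 * i + 1) = (i, snd (fst (C i) ! f ! p))"
      by (simp_all add: \<phi>_def)
    moreover have "2 * i < 2 * x" "2 * i + 1 < 2 * x" using v by auto
    ultimately show "\<exists>p\<in>{..<q}. \<exists>k<2 * x. \<phi> f p k = v" using p v(1) by (metis lessThan_iff)
  next
    fix u w assume "(u, w) \<in> E f"
    then show "\<exists>p\<in>{..<q}. \<exists>k<2 * x. \<phi> f p k = u \<and> \<phi> f p (Suc k mod (2 * x)) = w \<or>
        \<phi> f p k = w \<and> \<phi> f p (Suc k mod (2 * x)) = u" unfolding E_def by blast
  qed auto
  then have fE: "covers (replicate r (2 * x)) ?V (\<Union>f<r. E f)" by (rule covers_family)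
  have "covers [2 * x] ?V (F f)" if f: "f < s" for f
  proof (rule covers_singleI[where J = "{..<q}" and \<phi> = "\<psi> f"])
    fix v assume "v \<in> ?V"
    then obtain i a where v: "v = (i, a)" "i < x" "a < 2 * q" by auto
    have "snd (C i) ! f \<in> set (fst (C i)) \<union> set (snd (C i))" using okC[of i] f by (auto simp: column_ok_def)
    from row[OF this v(3)] obtain p where p: "p < q" "fst (snd (C i) ! f ! p) = a \<or> snd (snd (C i) ! f ! p) = a"
      by blast
    have "\<psi> f p i = (i, fst (snd (C i) ! f ! p))" "\<psi> f p (x + i) = (i, snd (snd (C i) ! f ! p))"
      using v by (simp_all add: \<psi>_def)
    moreover have "i < 2 * x" "x + i < 2 * x" using v by auto
    ultimately show "\<exists>p\<in>{..<q}. \<exists>k<2 * x. \<psi> f p k = v" using p v(1) by (metis lessThan_iff)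
  next
    fix u w assume "(u, w) \<in> F f"
    then show "\<exists>p\<in>{..<q}. \<exists>k<2 * x. \<psi> f p k = u \<and> \<psi> f p (Suc k mod (2 * x)) = w \<or>
        \<psi> f p k = w \<and> \<psi> f p (Suc k mod (2 * x)) = u" unfolding F_def by blast
  qed auto
  then have fF: "covers (replicate s (2 * x)) ?V (\<Union>f<s. F f)" by (rule covers_family)
  let ?U = "(\<Union>f<r. E f) \<union> (\<Union>f<s. F f)"
  have EI: "(\<phi> f p k, \<phi> f p (Suc k mod (2 * x))) \<in> ?U" if "f < r" "p < q" "k < 2 * x" for f p k
    using that unfolding E_def by blast
  have FI: "(\<psi> f p k, \<psi> f p (Suc k mod (2 * x))) \<in> ?U" if "f < s" "p < q" "k < 2 * x" for f p k
    using that unfolding F_def by blast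
  have vert: "((i, a), (Suc i mod x, b)) \<in> ?U" if i: "i < x" and ab: "(a, b) \<in> set L" for i a b
  proof -
    let ?i = "Suc i mod x" let ?t = "Suc i = x"
    have "(a, b) \<in> set (links ?t (C i) (C ?i))"
    proof (cases ?t)
      case True
      then have "C i = C2" "C ?i = C0" using x by (auto simp: C_def)
      then show ?thesis using L(4) ab True by auto
    next
      case False
      then have "C ?i = C (Suc i)" using i by simp
      then show ?thesis using False L ab by (auto simp: C_def)
    qed
    from links_cases[OF this okC okC] show ?thesis
    proof (elim disjE exE conjE)
      fix f p assume f: "f < r" "p < q" "snd (fst (C i) ! f ! p) = a" "fst (fst (C ?i) ! f ! p) = b"
      have "\<phi> f p (2 * i + 1) = (i, a)" using f by (simp add: \<phi>_def)
      moreover have "\<phi> f p (Suc (2 * i + 1) mod (2 * x)) = (?i, b)"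
      proof -
        have "Suc (2 * i + 1) mod (2 * x) = 2 * ?i" using mult_mod_right[of 2 "Suc i" x] by simp
        then show ?thesis using f by (simp add: \<phi>_def)
      qed
      ultimately show ?thesis using EI[OF f(1,2), of "2 * i + 1"] i by simp
    next
      fix f p assume f: "f < s" "p < q" and t: "if ?t then fst (snd (C i) ! f ! p) = a \<and> snd (snd (C ?i) ! f ! p) = b \<or>
          snd (snd (C i) ! f ! p) = a \<and> fst (snd (C ?i) ! f ! p) = b
        else fst (snd (C i) ! f ! p) = a \<and> fst (snd (C ?i) ! f ! p) = b \<or>
          snd (snd (C i) ! f ! p) = a \<and> snd (snd (C ?i) ! f ! p) = b"
      have 1: "\<psi> f p i = (i, fst (snd (C i) ! f ! p))" "\<psi> f p (x + i) = (i, snd (snd (C i) ! f ! p))"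
        using i by (simp_all add: \<psi>_def)
      have 2: "\<psi> f p (Suc i mod (2 * x)) = (?i, (if ?t then snd else fst) (snd (C ?i) ! f ! p))"
      proof (cases ?t)
        case True
        then show ?thesis using x by (simp add: \<psi>_def)
      next
        case False
        then show ?thesis using i by (simp add: \<psi>_def)
      qed
      have 3: "\<psi> f p (Suc (x + i) mod (2 * x)) = (?i, (if ?t then fst else snd) (snd (C ?i) ! f ! p))"
      proof (cases ?t)
        case True
        then have "Suc (x + i) = 2 * x" by simp
        then have "Suc (x + i) mod (2 * x) = 0" by (simp only: mod_self)
        moreover have "?i = 0" using True by simp
        ultimately show ?thesis using True x by (simp add: \<psi>_def del: mod_self)
      next
        case False
        then show ?thesis using i by (simp add: \<psi>_def)
      qed
      from t consider "(i, a) = \<psi> f p i" "(?i, b) = \<psi> f p (Suc i mod (2 * x))"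
        | "(i, a) = \<psi> f p (x + i)" "(?i, b) = \<psi> f p (Suc (x + i) mod (2 * x))"
        unfolding 1 2 3 by (auto split: if_splits)
      then show ?thesis
      proof cases
        case 1
        then show ?thesis using FI[OF f, of i] i by simp
      next
        case 2
        then show ?thesis using FI[OF f, of "x + i"] i by simp
      qed
    qed
  qed
  have hor: "((i, a), (i, b)) \<in> ?U \<union> ?U\<inverse>" if i: "i < x" and ab: "(a, b) \<in> set D" for i a b
  proof -
    have "(a, b) \<in> set (concat (fst (C i))) \<or> (b, a) \<in> set (concat (fst (C i)))"
      using okC[of i] ab unfolding column_ok_def by blast
    moreover have "((i, a), (i, b)) \<in> ?U" if "(a, b) \<in> set (concat (fst (C i)))" for a b
    proof -
      from that obtain row where "row \<in> set (fst (C i))" "(a, b) \<in> set row" by auto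
      then obtain f p where f: "f < r" "p < q" "fst (C i) ! f ! p = (a, b)"
        using okC[of i] unfolding column_ok_def by (auto simp: in_set_conv_nth)
      have "\<phi> f p (2 * i) = (i, a)" using f by (simp add: \<phi>_def)
      moreover have "Suc (2 * i) mod (2 * x) = Suc (2 * i)" using i by simp
      then have "\<phi> f p (Suc (2 * i) mod (2 * x)) = (i, b)" using f by (simp add: \<phi>_def)
      ultimately show ?thesis using EI[OF f(1,2), of "2 * i"] i by simp
    qed
    ultimately show ?thesis by blast
  qed
  have "covers (replicate (r + s) (2 * x)) ?V (?U \<union> ?U\<inverse>)"
    using covers_sym[OF covers_append[OF fE fF]] by (simp only: replicate_add)
  then show ?thesis
  proof (rule covers_mono)
    show "{((i, a), (Suc i mod x, b)) | i a b. i < x \<and> (a, b) \<in> set L} \<union>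
     {((i, a), (i, b)) | i a b. i < x \<and> (a, b) \<in> set D} \<subseteq> ?U \<union> ?U\<inverse>"
    proof (intro subsetI, elim UnE CollectE exE conjE)
      fix e i a b assume "e = ((i, a), (Suc i mod x, b))" "i < x" "(a, b) \<in> set L"
      then show "e \<in> ?U \<union> ?U\<inverse>" using vert[of i a b] by simp
    next
      fix e i a b assume "e = ((i, a), (i, b))" "i < x" "(a, b) \<in> set D"
      then show "e \<in> ?U \<union> ?U\<inverse>" using hor[of i a b] by simp
    qed
  qed
qed

text \<open>The following columns were found with a SAT solver. In the columns \<open>bip_column\<close> the numbers
  \<open>0, \<dots>, 5\<close> and \<open>6, \<dots>, 11\<close> stand for the two sides of the bipartite graph.\<close>

definition ring_column0 :: column where
  "ring_column0 =
    ([[(1, 0), (3, 2), (5, 4)],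
      [(0, 5), (2, 1), (4, 3)]],
     [[(3, 5), (2, 0), (1, 4)],
      [(0, 4), (2, 1), (3, 5)],
      [(2, 1), (3, 4), (5, 0)],
      [(4, 3), (1, 2), (0, 5)],
      [(5, 2), (1, 3), (0, 4)]])"

definition ring_column1 :: column where
  "ring_column1 =
    ([[(3, 2), (1, 0), (5, 4)],
      [(0, 5), (2, 1), (4, 3)]],
     [[(5, 4), (0, 2), (1, 3)],
      [(1, 4), (2, 5), (0, 3)],
      [(4, 3), (1, 2), (5, 0)],
      [(0, 2), (4, 3), (5, 1)],
      [(2, 5), (0, 3), (4, 1)]])"

definition ring_column2 :: column where
  "ring_column2 =
    ([[(1, 0), (3, 2), (5, 4)],
      [(4, 3), (2, 1), (0, 5)]],
     [[(5, 0), (4, 2), (3, 1)],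
      [(4, 1), (5, 0), (2, 3)],
      [(3, 5), (1, 4), (2, 0)],
      [(1, 0), (4, 2), (3, 5)],
      [(3, 1), (5, 4), (2, 0)]])"

definition bip_column0 :: column where
  "bip_column0 =
    ([[(0, 6), (1, 7), (2, 8), (3, 9), (4, 10), (5, 11)],
      [(0, 10), (1, 11), (2, 9), (3, 7), (4, 8), (5, 6)],
      [(0, 9), (1, 10), (2, 11), (3, 6), (4, 7), (5, 8)],
      [(11, 0), (8, 1), (6, 2), (10, 3), (9, 4), (7, 5)],
      [(8, 0), (9, 1), (7, 2), (11, 3), (6, 4), (10, 5)],
      [(7, 0), (6, 1), (10, 2), (8, 3), (11, 4), (9, 5)]],
     [[(0, 10), (1, 11), (2, 8), (3, 6), (4, 7), (5, 9)],
      [(0, 11), (1, 7), (2, 10), (3, 9), (4, 6), (5, 8)],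
      [(0, 10), (1, 8), (2, 11), (3, 6), (4, 7), (5, 9)]])"

definition bip_column1 :: column where
  "bip_column1 =
    ([[(5, 6), (1, 11), (4, 7), (0, 9), (2, 10), (3, 8)],
      [(5, 11), (4, 9), (1, 10), (0, 8), (2, 6), (3, 7)],
      [(5, 7), (4, 11), (0, 10), (1, 6), (2, 8), (3, 9)],
      [(11, 0), (10, 3), (9, 2), (6, 4), (7, 1), (8, 5)],
      [(9, 5), (11, 2), (7, 0), (8, 1), (6, 3), (10, 4)],
      [(8, 4), (6, 0), (10, 5), (7, 2), (9, 1), (11, 3)]],
     [[(6, 1), (9, 2), (8, 5), (10, 0), (11, 4), (7, 3)],
      [(10, 5), (7, 3), (11, 0), (9, 2), (8, 4), (6, 1)],
      [(7, 3), (8, 0), (6, 1), (11, 2), (10, 5), (9, 4)]])"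

definition bip_column2 :: column where
  "bip_column2 =
    ([[(0, 7), (2, 6), (5, 11), (3, 8), (4, 9), (1, 10)],
      [(0, 8), (5, 10), (2, 7), (3, 9), (4, 11), (1, 6)],
      [(0, 6), (5, 9), (3, 10), (2, 11), (4, 7), (1, 8)],
      [(9, 2), (8, 4), (7, 5), (10, 0), (11, 1), (6, 3)],
      [(7, 1), (9, 0), (8, 5), (6, 4), (10, 2), (11, 3)],
      [(9, 1), (10, 4), (8, 2), (11, 0), (7, 3), (6, 5)]],
     [[(5, 10), (0, 8), (2, 9), (1, 7), (4, 6), (3, 11)],
      [(5, 11), (2, 7), (1, 6), (4, 10), (0, 8), (3, 9)],
      [(4, 9), (5, 11), (1, 8), (3, 6), (0, 10), (2, 7)]])"

lemma ring_columns:
  "column_ok 3 2 5 [(0, 1), (1, 2), (2, 3), (3, 4), (4, 5), (5, 0)] ring_column0"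
  "column_ok 3 2 5 [(0, 1), (1, 2), (2, 3), (3, 4), (4, 5), (5, 0)] ring_column1"
  "column_ok 3 2 5 [(0, 1), (1, 2), (2, 3), (3, 4), (4, 5), (5, 0)] ring_column2"
  by code_simp+

text \<open>The numbers fit exactly: two rows of the first kind give 2 * 3 links and five of the
  second kind 5 * 6, in total the 36 pairs between consecutive columns. The 2 * 3 edges inside a
  column form a hexagon.\<close>

lemma ring_links:
  "list_all (\<lambda>e. e \<in> set (links False ring_column0 ring_column1)) (List.product [0..<6] [0..<6])"
  "list_all (\<lambda>e. e \<in> set (links False ring_column1 ring_column2)) (List.product [0..<6] [0..<6])"
  "list_all (\<lambda>e. e \<in> set (links False ring_column2 ring_column1)) (List.product [0..<6] [0..<6])"
  "list_all (\<lambda>e. e \<in> set (links True ring_column2 ring_column0)) (List.product [0..<6] [0..<6])"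
  by code_simp+

lemma bip_columns:
  "column_ok 6 6 3 (List.product [0..<6] [6..<12]) bip_column0"
  "column_ok 6 6 3 (List.product [0..<6] [6..<12]) bip_column1"
  "column_ok 6 6 3 (List.product [0..<6] [6..<12]) bip_column2"
  by code_simp+

text \<open>Links join opposite sides, and the step to the next column can start on either side: 72
  = 6 * 6 + 3 * 12 pairs, the yield of six rows of the first kind and three of the second.\<close>

definition bip_links :: "(nat \<times> nat) list" where
  "bip_links = List.product [0..<6] [6..<12] @ List.product [6..<12] [0..<6]"

lemma bip_columns_links:
  "list_all (\<lambda>e. e \<in> set (links False bip_column0 bip_column1)) bip_links"
  "list_all (\<lambda>e. e \<in> set (links False bip_column1 bip_column2)) bip_links"
  "list_all (\<lambda>e. e \<in> set (links False bip_column2 bip_column1)) bip_links"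
  "list_all (\<lambda>e. e \<in> set (links True bip_column2 bip_column0)) bip_links"
  by code_simp+

lemma covers_distinct_image:
  assumes "covers ns V (distinct_pairs V)" "bij_betw g V V'"
  shows "covers ns V' (distinct_pairs V')"
proof -
  have inj: "inj_on g V" and im: "g ` V = V'" using assms(2) by (auto simp: bij_betw_def)
  have "distinct_pairs V' \<subseteq> map_prod g g ` distinct_pairs V"
    unfolding im[symmetric] distinct_pairs_def by (auto simp: image_iff map_prod_def)
  moreover have "covers ns V' (map_prod g g ` distinct_pairs V)" using covers_image[OF assms(1) inj] im by simp
  ultimately show ?thesis by (rule covers_mono[rotated])
qed

lemma covers_image_sub:
  assumes "covers ns V E" "inj_on g V" "g ` V = V'" "E' \<subseteq> map_prod g g ` E"
  shows "covers ns V' E'"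
  using covers_mono[OF covers_image[OF assms(1,2)] assms(4)] assms(3) by simp

lemma covers_singleE:
  assumes "covers [n] V E"
  obtains H where "cycle_factor n V H" "E \<subseteq> {(u, w). {u, w} \<in> H}"
proof -
  from assms obtain Hs where "list_all2 (\<lambda>n. cycle_factor n V) [n] Hs"
    "\<forall>u w. (u, w) \<in> E \<longrightarrow> (\<exists>H\<in>set Hs. {u, w} \<in> H)" unfolding covers_def by blast
  then obtain H where "cycle_factor n V H" "\<forall>u w. (u, w) \<in> E \<longrightarrow> {u, w} \<in> H"
    by (auto simp: list_all2_Cons1)
  then show thesis by (intro that[of H]) auto
qed

lemma list_all_subset: "list_all (\<lambda>e. e \<in> A) xs \<Longrightarrow> set xs \<subseteq> A"
  by (auto simp: list_all_iff)

lemma blow_mono: "E \<subseteq> E' \<Longrightarrow> blow E Y \<subseteq> blow E' Y"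
  unfolding blow_def by blast

lemma distinct_pairs_times:
  "distinct_pairs (W \<times> Y) \<subseteq> blow (distinct_pairs W) Y \<union> inner W (distinct_pairs Y)"
  unfolding distinct_pairs_def blow_def inner_def by auto

lemma covers_ring_blow_2:
  assumes "covers ns ({..<2::nat} \<times> Y) {((0, a), (1, b)) | a b. a \<in> Y \<and> b \<in> Y}"
  shows "covers ns ({..<2} \<times> Y) (ring_blow 2 Y)"
proof (rule covers_mono[OF covers_sym[OF assms]])
  show "ring_blow 2 Y \<subseteq> {((0, a), (1, b)) | a b. a \<in> Y \<and> b \<in> Y} \<union>
    {((0, a), (1, b)) | a b. a \<in> Y \<and> b \<in> Y}\<inverse>"
    unfolding ring_blow_def by (auto simp: less_2_cases_iff)
qed

text \<open>For even x the differences pair up into y Hamilton cycles on two groups; their length 2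
  x is even, so blowing up by 3 gives three factors for each.\<close>

lemma covers_bip_even:
  assumes "x = 2 * y" "y > 0"
  shows "covers (replicate (y * 3) (2 * x)) ({..<2::nat} \<times> ({..<3::nat} \<times> {..<x})) (ring_blow 2 ({..<3} \<times> {..<x}))"
proof (rule covers_ring_blow_2)
  have x: "x > 0" using assms by simp
  have 3: "covers (replicate 3 (2 * x)) ({..<2 * x} \<times> {..<3::nat}) (ring_blow (2 * x) {..<3})"
    using x by (intro covers_ring_even) auto
  let ?E = "{((0::nat, i), (1::nat, (i + s) mod x)) | i s. i < x \<and> 0 \<le> s \<and> s < 0 + 2 * y}"
  have f: "covers (replicate (y * 3) (2 * x)) (({..<2::nat} \<times> {..<x}) \<times> {..<3::nat}) (blow ?E {..<3})"
    by (rule covers_blow[OF covers_bip_classes[OF x] 3])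
  let ?g = "\<lambda>((b::nat, i::nat), p::nat). (b, (p, i))"
  show "covers (replicate (y * 3) (2 * x)) ({..<2::nat} \<times> ({..<3::nat} \<times> {..<x}))
    {((0, a), (1, b)) | a b. a \<in> {..<3} \<times> {..<x} \<and> b \<in> {..<3} \<times> {..<x}}"
  proof (rule covers_image_sub[OF f, of ?g])
    show "inj_on ?g (({..<2} \<times> {..<x}) \<times> {..<3})" by (auto simp: inj_on_def)
    show "?g ` (({..<2} \<times> {..<x}) \<times> {..<3}) = {..<2} \<times> ({..<3} \<times> {..<x})" by (auto simp: image_iff)
    show "{((0, a), (1, b)) | a b. a \<in> {..<3} \<times> {..<x} \<and> b \<in> {..<3} \<times> {..<x}}
      \<subseteq> map_prod ?g ?g ` blow ?E {..<3}"
    proof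
      fix e assume "e \<in> {((0::nat, a), (1::nat, b)) | a b. a \<in> {..<3::nat} \<times> {..<x} \<and> b \<in> {..<3::nat} \<times> {..<x}}"
      then obtain p i q j where e: "e = ((0, (p, i)), (1, (q, j)))" "p < 3" "i < x" "q < 3" "j < x" by auto
      obtain s where s: "s < x" "(s + i) mod x = j" by (rule mod_add_surj[OF e(5)])
      then have "((0, i), (1, j)) \<in> ?E" using e(3) assms(1) by (auto simp: add.commute)
      then have "(((0, i), p), ((1, j), q)) \<in> blow ?E {..<3}" using e unfolding blow_def by blast
      from imageI[OF this, of "map_prod ?g ?g"] show "e \<in> map_prod ?g ?g ` blow ?E {..<3}"
        using e(1) by simp
    qed
  qed
qed

text \<open>The differences 0, 1 and -1 between the two sides. Put into one column of 12 vertices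
  for each index, difference 0 becomes the edges inside columns and the differences 1 and -1 the
  links to the next column.\<close>

lemma covers_bip_odd_special:
  assumes "odd x" "x \<ge> 3"
  shows "covers (replicate 9 (2 * x)) ({..<2::nat} \<times> ({..<x} \<times> {..<6::nat}))
    {((0, (i, a)), (1, (j, b))) | i a j b. i < x \<and> j < x \<and> a < 6 \<and> b < 6 \<and>
      (j = i \<or> j = Suc i mod x \<or> i = Suc j mod x)}"
proof -
  let ?D = "List.product [0..<6] [6..<12::nat]"
  have f: "covers (replicate (6 + 3) (2 * x)) ({..<x} \<times> {..<2 * 6})
    ({((i, a), (Suc i mod x, b)) | i a b. i < x \<and> (a, b) \<in> set bip_links} \<union>
     {((i, a), (i, b)) | i a b. i < x \<and> (a, b) \<in> set ?D})"
    by (rule covers_table[OF assms bip_columns bip_columns_links[THEN list_all_subset]])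
  let ?g = "\<lambda>(i::nat, a::nat). (a div 6, (i, a mod 6))"
  let ?E = "{((i, a), (Suc i mod x, b)) | i a b. i < x \<and> (a, b) \<in> set bip_links} \<union>
     {((i, a), (i, b)) | i a b. i < x \<and> (a, b) \<in> set ?D}"
  have "covers (replicate (6 + 3) (2 * x)) ({..<2::nat} \<times> ({..<x} \<times> {..<6::nat}))
    {((0, (i, a)), (1, (j, b))) | i a j b. i < x \<and> j < x \<and> a < 6 \<and> b < 6 \<and>
      (j = i \<or> j = Suc i mod x \<or> i = Suc j mod x)}"
  proof (rule covers_image_sub[OF covers_sym[OF f], of ?g])
    have dm: "a = b" if "a div 6 = b div 6" "a mod 6 = b mod 6" for a b :: nat
      using that by (metis div_mult_mod_eq)
    show "inj_on ?g ({..<x} \<times> {..<2 * 6})" by (auto simp: inj_on_def intro: dm)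
    show "?g ` ({..<x} \<times> {..<2 * 6}) = {..<2} \<times> ({..<x} \<times> {..<6})"
    proof (intro set_eqI iffI)
      fix v :: "nat \<times> nat \<times> nat" assume "v \<in> {..<2} \<times> ({..<x} \<times> {..<6})"
      then obtain b i a where "v = (b, (i, a))" "b < 2" "i < x" "a < 6" by auto
      then show "v \<in> ?g ` ({..<x} \<times> {..<2 * 6})"
        by (intro image_eqI[of _ _ "(i, 6 * b + a)"]) auto
    qed auto
    show "{((0, (i, a)), (1, (j, b))) | i a j b. i < x \<and> j < x \<and> a < 6 \<and> b < 6 \<and>
      (j = i \<or> j = Suc i mod x \<or> i = Suc j mod x)} \<subseteq> map_prod ?g ?g ` (?E \<union> ?E\<inverse>)"
    proof
      fix e assume "e \<in> {((0::nat, (i, a)), (1::nat, (j, b))) | i a j b. i < x \<and> j < x \<and> a < (6::nat) \<and> b < (6::nat) \<and>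
        (j = i \<or> j = Suc i mod x \<or> i = Suc j mod x)}"
      then obtain i a j b where e: "e = ((0, (i, a)), (1, (j, b)))" "i < x" "j < x" "a < 6" "b < 6"
        "j = i \<or> j = Suc i mod x \<or> i = Suc j mod x" by blast
      have D: "(a, b + 6) \<in> set ?D" "(a, b + 6) \<in> set bip_links" "(b + 6, a) \<in> set bip_links"
        unfolding bip_links_def set_append set_product set_upt using e(4,5) by simp_all
      have "((i, a), (j, b + 6)) \<in> ?E \<union> ?E\<inverse>"
        using e(6)
      proof (elim disjE)
        assume "j = i"
        then show ?thesis using D(1) e(2) by blast
      next
        assume "j = Suc i mod x"
        then show ?thesis using D(2) e(2) by blast
      next
        assume i: "i = Suc j mod x"
        have h: "((j, b + 6), (Suc j mod x, a)) \<in> ?E" using D(3) e(3) by blast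
        show ?thesis unfolding i by (rule UnI2, rule converseI, rule h)
      qed
      note img = imageI[OF this, of "map_prod ?g ?g"]
      have "(b + 6) div 6 = 1" "(b + 6) mod 6 = b" using e(5) by auto
      then have "map_prod ?g ?g ((i, a), (j, b + 6)) = e" using e(1,4) by simp
      then show "e \<in> map_prod ?g ?g ` (?E \<union> ?E\<inverse>)" using img by (simp only:)
    qed
  qed
  then show ?thesis by simp
qed

text \<open>Once 0, 1 and -1 are removed, an even number of differences 2, ..., x - 2 remains and
  pairs up. The count is 6 (x - 3) / 2 + 9 = 3 x.\<close>

lemma covers_bip_odd:
  assumes "odd x" "x \<ge> 3"
  shows "covers (replicate (3 * x) (2 * x)) ({..<2::nat} \<times> ({..<x} \<times> {..<6::nat})) (ring_blow 2 ({..<x} \<times> {..<6}))"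
proof (rule covers_ring_blow_2)
  define d where "d = (x - 3) div 2"
  have d: "x = 2 * d + 3" using assms by (auto simp: d_def elim: oddE)
  have x: "x > 0" using assms by simp
  have 6: "covers (replicate 6 (2 * x)) ({..<2 * x} \<times> {..<6::nat}) (ring_blow (2 * x) {..<6})"
    using x by (intro covers_ring_even) auto
  let ?E = "{((0::nat, i), (1::nat, (i + s) mod x)) | i s. i < x \<and> 2 \<le> s \<and> s < 2 + 2 * d}"
  have f: "covers (replicate (d * 6) (2 * x)) (({..<2::nat} \<times> {..<x}) \<times> {..<6::nat}) (blow ?E {..<6})"
    by (rule covers_blow[OF covers_bip_classes[OF x] 6])
  let ?g = "\<lambda>((b::nat, i::nat), p::nat). (b, (i, p))"
  let ?V = "{..<2::nat} \<times> ({..<x} \<times> {..<6::nat})"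
  let ?B = "map_prod ?g ?g ` blow ?E {..<6}"
  have fB: "covers (replicate (d * 6) (2 * x)) ?V ?B"
  proof (rule covers_image_sub[OF f, of ?g])
    show "inj_on ?g (({..<2} \<times> {..<x}) \<times> {..<6})" by (auto simp: inj_on_def)
    show "?g ` (({..<2} \<times> {..<x}) \<times> {..<6}) = ?V" by (auto simp: image_iff)
  qed simp
  let ?S = "{((0::nat, (i, a)), (1::nat, (j, b))) | i a j b. i < x \<and> j < x \<and> a < (6::nat) \<and> b < (6::nat) \<and>
      (j = i \<or> j = Suc i mod x \<or> i = Suc j mod x)}"
  have "covers (replicate (d * 6) (2 * x) @ replicate 9 (2 * x)) ?V (?B \<union> ?S)"
    by (rule covers_append[OF fB covers_bip_odd_special[OF assms]])
  moreover have "replicate (d * 6) (2 * x) @ replicate 9 (2 * x) = replicate (3 * x) (2 * x)"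
    unfolding replicate_add[symmetric] using d by simp
  moreover have "{((0::nat, a), (1::nat, b)) | a b. a \<in> {..<x} \<times> {..<6::nat} \<and> b \<in> {..<x} \<times> {..<6::nat}} \<subseteq> ?B \<union> ?S"
  proof
    fix e assume "e \<in> {((0::nat, a), (1::nat, b)) | a b. a \<in> {..<x} \<times> {..<6::nat} \<and> b \<in> {..<x} \<times> {..<6::nat}}"
    then obtain i p j q where e: "e = ((0, (i, p)), (1, (j, q)))" "i < x" "p < 6" "j < x" "q < 6" by auto
    obtain s where s: "s < x" "(s + i) mod x = j" by (rule mod_add_surj[OF e(4)])
    consider "s = 0" | "s = 1" | "2 \<le> s" "s < 2 + 2 * d" | "s = x - 1" using s(1) d by linarith
    then show "e \<in> ?B \<union> ?S"
    proof cases
      case 1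
      then have "j = i" using s e by simp
      then show ?thesis using e by blast
    next
      case 2
      then have "j = Suc i mod x" using s by simp
      then show ?thesis using e by blast
    next
      case 3
      then have "((0, i), (1, j)) \<in> ?E" using s e(2) by (auto simp: add.commute)
      then have "(((0, i), p), ((1, j), q)) \<in> blow ?E {..<6}" using e unfolding blow_def by blast
      from imageI[OF this, of "map_prod ?g ?g"] show ?thesis using e(1) by simp
    next
      case 4
      \<comment> \<open>The difference x - 1 is -1, that is, an edge to the preceding
        column.\<close>
      have "Suc j mod x = Suc (s + i) mod x" unfolding s(2)[symmetric] by (rule mod_Suc_eq)
      also have "Suc (s + i) = i + x" using 4 x by simp
      finally have "i = Suc j mod x" using e(2) by simp
      then show ?thesis using e by blast
    qed
  qed
  ultimately show "covers (replicate (3 * x) (2 * x)) ?V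
    {((0, a), (1, b)) | a b. a \<in> {..<x} \<times> {..<6} \<and> b \<in> {..<x} \<times> {..<6}}"
    by (simp only: covers_mono)
qed

text \<open>In every fibre the complete graph on six vertices is split into the matching
  \<open>?M\<close>, the hexagon \<open>?C\<close> and the hexagon \<open>?D\<close>. The first two
  yield the 1-factor and the 6-cycles. The third has as many edges as one more factor and is
  absorbed by the columns, which is why seven factors appear instead of six.\<close>

lemma covers_ring_special:
  assumes "odd x" "x \<ge> 3"
  shows "covers (2 # 6 # replicate 7 (2 * x)) ({..<x} \<times> {..<6::nat})
    (ring_blow x {..<6} \<union> inner {..<x} (distinct_pairs {..<6}))"
proof -
  let ?V = "{..<x} \<times> {..<6::nat}"
  let ?D = "[(0, 1), (1, 2), (2, 3), (3, 4), (4, 5), (5, 0)] :: (nat \<times> nat) list"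
  let ?L = "List.product [0..<6] [0..<6::nat]"
  let ?E = "{((i, a), (Suc i mod x, b)) | i a b. i < x \<and> (a, b) \<in> set ?L} \<union>
     {((i, a), (i, b)) | i a b. i < x \<and> (a, b) \<in> set ?D}"
  have f: "covers (replicate (2 + 5) (2 * x)) ({..<x} \<times> {..<2 * 3}) ?E"
    by (rule covers_table[OF assms ring_columns ring_links[THEN list_all_subset]])
  let ?m = "[0, 4, 2, 5, 1, 3] :: nat list" let ?c = "[0, 2, 4, 1, 5, 3] :: nat list"
  let ?M = "{((i, a), (i, b)) | i a b. i < x \<and> (a, b) \<in> {(0, 4), (2, 5), (1::nat, 3::nat)}}"
  let ?C = "{((i, a), (i, b)) | i a b. i < x \<and> (a, b) \<in> {(0, 2), (2, 4), (4, 1), (1, 5), (5, 3), (3::nat, 0::nat)}}"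
  have 6: "a = 0 \<or> a = 1 \<or> a = 2 \<or> a = 3 \<or> a = 4 \<or> a = 5" if "a < 6" for a :: nat
    using that by linarith
  have fM: "covers [2] ?V ?M"
  proof (rule covers_singleI[where J = "{..<x} \<times> {..<3}" and \<phi> = "\<lambda>(i, p) k. (i, ?m ! (2 * p + k))"])
    fix v assume "v \<in> ?V"
    then obtain i a where v: "v = (i, a)" "i < x" "a < 6" by auto
    have "a \<in> set ?m" using 6[OF v(3)] by (elim disjE) simp_all
    then obtain n where n: "n < length ?m" "?m ! n = a" by (metis in_set_conv_nth)
    then have "n div 2 < 3" "?m ! (2 * (n div 2) + n mod 2) = a" by simp_all
    then have "\<exists>p<3. \<exists>k<2. ?m ! (2 * p + k) = a"
      by (intro exI[of _ "n div 2"] conjI exI[of _ "n mod 2"]) simp_all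
    then show "\<exists>j\<in>{..<x} \<times> {..<3}. \<exists>k<2. (case j of (i, p) \<Rightarrow> \<lambda>k. (i, ?m ! (2 * p + k))) k = v"
      using v by auto
  next
    fix u w assume "(u, w) \<in> ?M"
    then obtain i a b where uw: "u = (i, a)" "w = (i, b)" "i < x" "(a, b) \<in> {(0, 4), (2, 5), (1::nat, 3::nat)}"
      by blast
    have "{0, 1, 2} = {..<3::nat}" by auto
    moreover have "(a, b) \<in> (\<lambda>p. (?m ! (2 * p), ?m ! (2 * p + 1))) ` {0, 1, 2}" using uw(4) by simp
    ultimately obtain p where p: "p < 3" "?m ! (2 * p) = a" "?m ! (2 * p + 1) = b" by blast
    then show "\<exists>j\<in>{..<x} \<times> {..<3}. \<exists>k<2. ((case j of (i, p) \<Rightarrow> \<lambda>k. (i, ?m ! (2 * p + k))) k = u \<and>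
        (case j of (i, p) \<Rightarrow> \<lambda>k. (i, ?m ! (2 * p + k))) (Suc k mod 2) = w) \<or>
        ((case j of (i, p) \<Rightarrow> \<lambda>k. (i, ?m ! (2 * p + k))) k = w \<and>
        (case j of (i, p) \<Rightarrow> \<lambda>k. (i, ?m ! (2 * p + k))) (Suc k mod 2) = u)"
      using uw by (intro bexI[of _ "(i, p)"] exI[of _ 0]) simp_all
  qed auto
  have fC: "covers [6] ?V ?C"
  proof (rule covers_singleI[where J = "{..<x}" and \<phi> = "\<lambda>i k. (i, ?c ! k)"])
    fix v assume "v \<in> ?V"
    then obtain i a where v: "v = (i, a)" "i < x" "a < 6" by auto
    have "a \<in> set ?c" using 6[OF v(3)] by (elim disjE) simp_all
    moreover have "length ?c = 6" by simp
    ultimately have "\<exists>k<6. ?c ! k = a" by (metis in_set_conv_nth)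
    then show "\<exists>i\<in>{..<x}. \<exists>k<6. (i, ?c ! k) = v" using v by auto
  next
    fix u w assume "(u, w) \<in> ?C"
    then obtain i a b where uw: "u = (i, a)" "w = (i, b)" "i < x"
      "(a, b) \<in> {(0, 2), (2, 4), (4, 1), (1, 5), (5, 3), (3::nat, 0::nat)}" by blast
    have "(a, b) \<in> (\<lambda>k. (?c ! k, ?c ! (Suc k mod 6))) ` {0, 1, 2, 3, 4, 5}" using uw(4) by simp
    then have "\<exists>k<6. ?c ! k = a \<and> ?c ! (Suc k mod 6) = b" unfolding lessThan_6[symmetric] by blast
    then show "\<exists>i\<in>{..<x}. \<exists>k<6. (i, ?c ! k) = u \<and> (i, ?c ! (Suc k mod 6)) = w \<or>
        (i, ?c ! k) = w \<and> (i, ?c ! (Suc k mod 6)) = u"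
      using uw(1-3) by blast
  qed auto
  have "covers ([2] @ [6] @ replicate 7 (2 * x)) ?V (?M \<union> (?C \<union> ?E))"
    using f by (intro covers_append fM fC) simp
  from covers_sym[OF this] have fU: "covers (2 # 6 # replicate 7 (2 * x)) ?V ((?M \<union> (?C \<union> ?E)) \<union> (?M \<union> (?C \<union> ?E))\<inverse>)"
    by simp
  have hor: "(a, b) \<in> S \<or> (b, a) \<in> S" if "a < 6" "b < 6" "a \<noteq> b"
    "S = {(0, 4), (2, 5), (1, 3)} \<union> ({(0, 2), (2, 4), (4, 1), (1, 5), (5, 3), (3, 0)} \<union> set ?D)" for a b :: nat and S
    using 6[OF that(1)] 6[OF that(2)] that(3) unfolding that(4) by (elim disjE) simp_all
  show ?thesis
  proof (rule covers_mono[OF fU], intro subsetI, elim UnE)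
    fix e assume "e \<in> ring_blow x {..<6::nat}"
    then obtain i a b where "e = ((i, a), (Suc i mod x, b))" "i < x" "a < 6" "b < 6"
      unfolding ring_blow_def by auto
    moreover from this have "(a, b) \<in> set ?L" by simp
    ultimately have "e \<in> ?E" by blast
    then show "e \<in> (?M \<union> (?C \<union> ?E)) \<union> (?M \<union> (?C \<union> ?E))\<inverse>" by blast
  next
    fix e assume "e \<in> inner {..<x} (distinct_pairs {..<6::nat})"
    then obtain i a b where e: "e = ((i, a), (i, b))" "i < x" "a < 6" "b < 6" "a \<noteq> b"
      unfolding inner_def distinct_pairs_def by auto
    have *: "((i, a), (i, b)) \<in> ?M \<union> (?C \<union> ?E)"
      if "(a, b) \<in> {(0, 4), (2, 5), (1, 3)} \<union> ({(0, 2), (2, 4), (4, 1), (1, 5), (5, 3), (3, 0)} \<union> set ?D)" for a b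
      using that e(2) by blast
    from hor[OF e(3-5) refl] show "e \<in> (?M \<union> (?C \<union> ?E)) \<union> (?M \<union> (?C \<union> ?E))\<inverse>"
    proof
      assume "(a, b) \<in> {(0, 4), (2, 5), (1, 3)} \<union> ({(0, 2), (2, 4), (4, 1), (1, 5), (5, 3), (3, 0)} \<union> set ?D)"
      from *[OF this] show ?thesis unfolding e(1) by (rule UnI1)
    next
      assume "(b, a) \<in> {(0, 4), (2, 5), (1, 3)} \<union> ({(0, 2), (2, 4), (4, 1), (1, 5), (5, 3), (3, 0)} \<union> set ?D)"
      note h = *[OF this]
      show ?thesis unfolding e(1) by (rule UnI2, rule converseI, rule h)
    qed
  qed
qed

section \<open>Assembling the solutions\<close>

text \<open>One Hamilton cycle of the complete graph on x vertices carries the special piece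
  together with all fibres; the h others are blown up by 6. With x = 2 h + 3 this makes 7 + 6 h = 3
  x - 2 factors.\<close>

lemma covers_base_odd:
  assumes "odd x" "x \<ge> 3"
  shows "covers (2 # 6 # replicate (3 * x - 2) (2 * x)) ({..<x} \<times> {..<6::nat}) (distinct_pairs ({..<x} \<times> {..<6}))"
proof -
  define h where "h = x div 2 - 1"
  have x: "x = 2 * Suc h + 1" using assms by (auto simp: h_def elim: oddE)
  have "covers (replicate (Suc h) x) {..<x} (distinct_pairs {..<x})"
    using covers_walecki_odd[of "Suc h"] x by simp
  then have "covers ([x] @ replicate h x) {..<x} (distinct_pairs {..<x})" by simp
  then obtain E1 E2 where E: "covers [x] {..<x} E1" "covers (replicate h x) {..<x} E2"
    "distinct_pairs {..<x} \<subseteq> E1 \<union> E2" by (rule covers_split)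
  from E(1) obtain H where H: "cycle_factor x {..<x} H" "E1 \<subseteq> {(u, w). {u, w} \<in> H}" by (rule covers_singleE)
  let ?A = "blow {(u, w). {u, w} \<in> H} {..<6::nat} \<union> inner {..<x} (distinct_pairs {..<6})"
  have f1: "covers (2 # 6 # replicate 7 (2 * x)) ({..<x} \<times> {..<6}) ?A"
    by (rule covers_subst[OF H(1) covers_ring_special[OF assms]])
  have f2: "covers (replicate (h * 6) (2 * x)) ({..<x} \<times> {..<6::nat}) (blow E2 {..<6})"
    using assms by (intro covers_blow[OF E(2)] covers_ring_six[where d = 1]) auto
  have "covers ((2 # 6 # replicate 7 (2 * x)) @ replicate (h * 6) (2 * x)) ({..<x} \<times> {..<6}) (?A \<union> blow E2 {..<6})"
    by (rule covers_append[OF f1 f2])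
  moreover have "(2 # 6 # replicate 7 (2 * x)) @ replicate (h * 6) (2 * x) = 2 # 6 # replicate (3 * x - 2) (2 * x)"
    unfolding append_Cons replicate_add[symmetric] using x by simp
  moreover have "distinct_pairs ({..<x} \<times> {..<6::nat}) \<subseteq> ?A \<union> blow E2 {..<6}"
  proof -
    have "blow (distinct_pairs {..<x}) {..<6::nat} \<subseteq> blow (E1 \<union> E2) {..<6}" by (rule blow_mono[OF E(3)])
    also have "\<dots> \<subseteq> blow {(u, w). {u, w} \<in> H} {..<6} \<union> blow E2 {..<6}"
      using H(2) unfolding blow_def by blast
    finally show ?thesis using distinct_pairs_times[of "{..<x}" "{..<6::nat}"] by blast
  qed
  ultimately show ?thesis by (simp only: covers_mono)
qed

text \<open>For odd t, Walecki cycles of length t blown up by x become Hamilton cycles of length t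
  x, which doubling can cut into arcs of length x. For even t a 1-factorization reduces everything
  to the bipartite piece. Both ways spend 3 x factors for each of the t - 1 other copies.\<close>

lemma covers_blow_distinct_odd:
  assumes "odd x" "x \<ge> 3" "t > 0"
  shows "covers (replicate (3 * x * (t - 1)) (2 * x)) ({..<t} \<times> ({..<x} \<times> {..<6::nat}))
    (blow (distinct_pairs {..<t}) ({..<x} \<times> {..<6}))"
proof -
  let ?Y = "{..<x} \<times> {..<6::nat}"
  consider "t = 1" | "odd t" "t \<ge> 3" | "even t" "t \<ge> 2" using assms(3) by (cases "t \<ge> 3") (auto simp: numeral_eq_Suc not_less_eq_eq le_Suc_eq)
  then show ?thesis
  proof cases
    case 1
    then have "blow (distinct_pairs {..<t}) ?Y = {}" by (auto simp: blow_def distinct_pairs_def)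
    then show ?thesis using 1 by (simp add: covers_Nil)
  next
    case 2
    define h where "h = t div 2"
    have h: "t = 2 * h + 1" "h > 0" using 2 by (auto simp: h_def elim: oddE)
    have fW: "covers (replicate h t) {..<t} (distinct_pairs {..<t})"
      using covers_walecki_odd[OF h(2)] h(1) by simp
    let ?R = "blow (ring_blow t {..<x}) {..<6::nat}"
    have "covers (replicate (x * 6) (2 * x)) (({..<t} \<times> {..<x}) \<times> {..<6::nat}) ?R"
      using assms 2 by (intro covers_blow[OF covers_ring_odd_hamilton] covers_ring_six[where d = t]) auto
    then have "covers (replicate (x * 6) (2 * x)) ({..<t} \<times> ?Y) (ring_blow t ?Y)"
    proof (rule covers_image_sub)
      let ?g = "\<lambda>((k::nat, i::nat), b::nat). (k, (i, b))"
      show "inj_on ?g (({..<t} \<times> {..<x}) \<times> {..<6})" by (auto simp: inj_on_def)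
      show "?g ` (({..<t} \<times> {..<x}) \<times> {..<6}) = {..<t} \<times> ?Y" by (auto simp: image_iff)
      show "ring_blow t ?Y \<subseteq> map_prod ?g ?g ` ?R"
      proof
        fix e assume "e \<in> ring_blow t ?Y"
        then obtain k i b j c where e: "e = ((k, (i, b)), (Suc k mod t, (j, c)))"
          "k < t" "i < x" "b < 6" "j < x" "c < 6" unfolding ring_blow_def by auto
        then have "(((k, i), b), ((Suc k mod t, j), c)) \<in> ?R" unfolding blow_def ring_blow_def by auto
        from imageI[OF this, of "map_prod ?g ?g"] show "e \<in> map_prod ?g ?g ` ?R" using e(1) by simp
      qed
    qed
    from covers_blow[OF fW this] have "covers (replicate (h * (x * 6)) (2 * x)) ({..<t} \<times> ?Y) (blow (distinct_pairs {..<t}) ?Y)" .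
    moreover have "h * (x * 6) = 3 * x * (t - 1)" using h by simp
    ultimately show ?thesis by (simp only:)
  next
    case 3
    define h where "h = t div 2 - 1"
    have h: "t = 2 * h + 2" using 3 by (auto simp: h_def elim: evenE)
    obtain E1 E2 where E: "covers [2] {..<t} E1" "covers (replicate (2 * h) 2) {..<t} E2" "distinct_pairs {..<t} \<subseteq> E1 \<union> E2"
      using covers_one_factorization[of h] h by auto
    have "covers ([2] @ replicate (2 * h) 2) {..<t} (E1 \<union> E2)" by (rule covers_append[OF E(1,2)])
    then have "covers (replicate (t - 1) 2) {..<t} (E1 \<union> E2)" using h by simp
    from covers_blow[OF covers_mono[OF this E(3)] covers_bip_odd[OF assms(1,2)]]
    have "covers (replicate ((t - 1) * (3 * x)) (2 * x)) ({..<t} \<times> ?Y) (blow (distinct_pairs {..<t}) ?Y)" .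
    then show ?thesis by (simp only: mult.commute)
  qed
qed

lemma covers_odd:
  assumes "odd x" "x \<ge> 3" "t > 0"
  shows "covers (2 # 6 # replicate (3 * x * t - 2) (2 * x)) ({..<t} \<times> ({..<x} \<times> {..<6::nat}))
    (distinct_pairs ({..<t} \<times> ({..<x} \<times> {..<6})))"
proof -
  let ?Y = "{..<x} \<times> {..<6::nat}"
  have "covers ((2 # 6 # replicate (3 * x - 2) (2 * x)) @ replicate (3 * x * (t - 1)) (2 * x)) ({..<t} \<times> ?Y)
    (inner {..<t} (distinct_pairs ?Y) \<union> blow (distinct_pairs {..<t}) ?Y)"
    using covers_copies[OF _ covers_base_odd[OF assms(1,2)], of "{..<t}"]
    by (intro covers_append covers_blow_distinct_odd assms) simp
  moreover have "(2 # 6 # replicate (3 * x - 2) (2 * x)) @ replicate (3 * x * (t - 1)) (2 * x)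
    = 2 # 6 # replicate (3 * x * t - 2) (2 * x)"
  proof -
    have "3 * x * t = 3 * x * (t - 1) + 3 * x" using assms(3) by (cases t) auto
    then have "3 * x - 2 + 3 * x * (t - 1) = 3 * x * t - 2" using assms(2) by simp
    then show ?thesis unfolding append_Cons replicate_add[symmetric] by simp
  qed
  ultimately show ?thesis using distinct_pairs_times[of "{..<t}" ?Y]
    by (metis (no_types, lifting) Un_commute covers_mono)
qed

text \<open>The 6 t groups form 2 t blocks of three. One matching of blocks joins them into units of
  six groups that carry the exceptional solution; every other matching needs only the complete
  bipartite piece.\<close>

lemma covers_even:
  assumes "x = 2 * y" "y > 0" "t > 0"
  shows "covers (2 # 6 # replicate (3 * x * t - 2) (2 * x)) ({..<2 * t} \<times> ({..<3::nat} \<times> {..<x}))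
    (distinct_pairs ({..<2 * t} \<times> ({..<3} \<times> {..<x})))"
proof -
  let ?Y = "{..<3::nat} \<times> {..<x}" let ?W = "{..<2 * t}"
  define h where "h = t - 1"
  have t: "t = h + 1" using assms(3) by (simp add: h_def)
  obtain E1 E2 where E: "covers [2] ?W E1" "covers (replicate (2 * h) 2) ?W E2" "distinct_pairs ?W \<subseteq> E1 \<union> E2"
    using covers_one_factorization[of h] t by auto
  from E(1) obtain H where H: "cycle_factor 2 ?W H" "E1 \<subseteq> {(u, w). {u, w} \<in> H}" by (rule covers_singleE)
  let ?A = "blow {(u, w). {u, w} \<in> H} ?Y \<union> inner ?W (distinct_pairs ?Y)"
  let ?b = "2 # 6 # replicate (3 * x - 2) (2 * x)"
  have "covers ?b ({..<2::nat} \<times> ?Y) (distinct_pairs ({..<2} \<times> ?Y))"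
  proof (rule covers_distinct_image[OF covers_base_even[OF assms(1,2)]])
    \<comment> \<open>Reads the six groups as two blocks of three.\<close>
    let ?g = "\<lambda>(g::nat, i::nat). (g div 3, (g mod 3, i))"
    have dm: "a = b" if "a div 3 = b div 3" "a mod 3 = b mod 3" for a b :: nat
      using that by (metis div_mult_mod_eq)
    have "inj_on ?g ({..<6} \<times> {..<x})" by (auto simp: inj_on_def intro: dm)
    moreover have "?g ` ({..<6} \<times> {..<x}) = {..<2} \<times> ?Y"
    proof (intro set_eqI iffI)
      fix v :: "nat \<times> nat \<times> nat" assume "v \<in> {..<2} \<times> ?Y"
      then obtain b p i where "v = (b, (p, i))" "b < 2" "p < 3" "i < x" by auto
      then show "v \<in> ?g ` ({..<6} \<times> {..<x})"
        by (intro image_eqI[of _ _ "(3 * b + p, i)"]) auto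
    qed auto
    ultimately show "bij_betw ?g ({..<6} \<times> {..<x}) ({..<2} \<times> ?Y)" by (simp add: bij_betw_def)
  qed
  moreover have "ring_blow 2 ?Y \<union> inner {..<2} (distinct_pairs ?Y) \<subseteq> distinct_pairs ({..<2} \<times> ?Y)"
    unfolding ring_blow_def inner_def distinct_pairs_def by (auto simp: less_2_cases_iff)
  ultimately have "covers ?b ({..<2} \<times> ?Y) (ring_blow 2 ?Y \<union> inner {..<2} (distinct_pairs ?Y))"
    by (rule covers_mono)
  from covers_subst[OF H(1) this] have f1: "covers ?b (?W \<times> ?Y) ?A" .
  have f2: "covers (replicate (2 * h * (y * 3)) (2 * x)) (?W \<times> ?Y) (blow E2 ?Y)"
    by (rule covers_blow[OF E(2) covers_bip_even[OF assms(1,2)]])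
  have "covers (?b @ replicate (2 * h * (y * 3)) (2 * x)) (?W \<times> ?Y) (?A \<union> blow E2 ?Y)"
    by (rule covers_append[OF f1 f2])
  moreover have "?b @ replicate (2 * h * (y * 3)) (2 * x) = 2 # 6 # replicate (3 * x * t - 2) (2 * x)"
  proof -
    have "3 * x * t = 2 * h * (y * 3) + 3 * x" using assms(1) t by (simp add: algebra_simps)
    then have "3 * x - 2 + 2 * h * (y * 3) = 3 * x * t - 2" using assms(1,2) by simp
    then show ?thesis unfolding append_Cons replicate_add[symmetric] by simp
  qed
  moreover have "distinct_pairs (?W \<times> ?Y) \<subseteq> ?A \<union> blow E2 ?Y"
  proof -
    have "blow (distinct_pairs ?W) ?Y \<subseteq> blow (E1 \<union> E2) ?Y" by (rule blow_mono[OF E(3)])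
    also have "\<dots> \<subseteq> blow {(u, w). {u, w} \<in> H} ?Y \<union> blow E2 ?Y"
      using H(2) unfolding blow_def by blast
    finally show ?thesis using distinct_pairs_times[of ?W ?Y] by blast
  qed
  ultimately show ?thesis by (simp only: covers_mono)
qed

text \<open>Both divisibilities are visible from the form of v, so the equivalence amounts to the
  construction of a solution, which splits by the parity of x.\<close>

theorem theorem4:
  fixes x t v N \<beta> :: nat
  assumes "t \<ge> 1" and "x \<ge> 2" and "\<not> 6 dvd x"
    and "v = 6 * x * t" and "N = 2 * x" and "\<beta> = 3 * x * t - 2"
    and "\<not> (gcd 6 N = 1 \<or> (gcd 6 N = 2 \<and> x = 3))"
  shows "HWP_solution_exists v 6 N 1 \<beta> \<longleftrightarrow> 6 dvd v \<and> N dvd v"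
proof -
  have "x * t \<ge> 2 * 1" using assms(1,2) by (intro mult_le_mono) auto
  then have \<beta>: "v = 2 * (\<beta> + 2)" using assms(4,6) by simp
  have "HWP_solution_exists v 6 N 1 \<beta>"
  proof (cases "even x")
    case True
    then obtain y where y: "x = 2 * y" by (rule evenE)
    have "covers (2 # 6 # replicate \<beta> N) ({..<2 * t} \<times> ({..<3::nat} \<times> {..<x}))
      (distinct_pairs ({..<2 * t} \<times> ({..<3} \<times> {..<x})))"
      unfolding assms(5,6) using assms(1,2) y by (intro covers_even[OF y]) auto
    then show ?thesis
      by (rule covers_imp_HWP) (use assms \<beta> in \<open>auto simp: card_cartesian_product\<close>)
  next
    case False
    have "covers (2 # 6 # replicate \<beta> N) ({..<t} \<times> ({..<x} \<times> {..<6::nat}))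
      (distinct_pairs ({..<t} \<times> ({..<x} \<times> {..<6})))"
      unfolding assms(5,6) using assms(1,2) False by (intro covers_odd) (auto elim: oddE)
    then show ?thesis
      by (rule covers_imp_HWP) (use assms \<beta> in \<open>auto simp: card_cartesian_product\<close>)
  qed
  moreover have "6 dvd v" "N dvd v" unfolding assms(4,5) by (simp_all add: mult.assoc)
  ultimately show ?thesis by simp
qed

end
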